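(* Let $p$ be a prime number. The Markoff graph mod $p$ is planar if and only if $p \in \{2, 3, 7\}$.
   Context: For a prime $p$, define maps $m_1, m_2, m_3 : \mathbb{F}_p^3 \to \mathbb{F}_p^3$ by $m_1(x,y,z) = (yz-x,y,z)$, $m_2(x,y,z) = (x,xz-y,z)$, $m_3(x,y,z) = (x,y,xy-z)$. These are involutions preserving the polynomial $x^2+y^2+z^2-xyz$. The Markoff graph mod $p$ is the graph whose vertices are the triples $(x,y,z) \in \mathbb{F}_p^3$ with $(x,y,z)\neq(0,0,0)$ and $x^2+y^2+z^2=xyz$ in $\mathbb{F}_p$, with an (undirected) edge joining each vertex $v$ to $m_j(v)$ for $j=1,2,3$. If $m_j(v)=v$ this edge is a self-edge (loop) at $v$; loops do not affect planarity. A graph is planar if it can be drawn in the plane without edges crossing; the empty graph (which occurs for $p=3$) is counted as planar. *)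

theory Defs
  imports "HOL-Analysis.Analysis" "HOL-Number_Theory.Residues"
begin

text \<open>A graph is a pair of a vertex set and an edge set. An edge is the set of its endpoints,
  so a loop at \<open>v\<close> is the singleton \<open>{v}\<close>; there are no parallel edges.\<close>

type_synonym 'v graph = "'v set \<times> 'v set set"

definition proper_edges :: "'v graph \<Rightarrow> 'v set set" where
  "proper_edges G = {e \<in> snd G. card e = 2}"

text \<open>A drawing in the plane: distinct vertices go to distinct points, every edge
  that is not a loop goes to an arc (an injective path) joining its two endpoints and avoiding all
  other vertices, and two different arcs meet at most in common endpoints. Loops are not drawn,
  since they do not affect planarity.\<close>

definition plane_drawing ::
  "'v graph \<Rightarrow> ('v \<Rightarrow> complex) \<Rightarrow> ('v set \<Rightarrow> real \<Rightarrow> complex) \<Rightarrow> bool" where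
  "plane_drawing G pos \<gamma> \<longleftrightarrow>
     inj_on pos (fst G) \<and>
     (\<forall>e \<in> proper_edges G.
        arc (\<gamma> e) \<and>
        {pathstart (\<gamma> e), pathfinish (\<gamma> e)} = pos ` e \<and>
        path_image (\<gamma> e) \<inter> pos ` fst G = pos ` e) \<and>
     (\<forall>e \<in> proper_edges G. \<forall>e' \<in> proper_edges G. e \<noteq> e' \<longrightarrow>
        path_image (\<gamma> e) \<inter> path_image (\<gamma> e') \<subseteq> pos ` (e \<inter> e'))"

definition planar :: "'v graph \<Rightarrow> bool" where
  "planar G \<longleftrightarrow> (\<exists>pos \<gamma>. plane_drawing G pos \<gamma>)"

type_synonym 'a triple = "'a \<times> 'a \<times> 'a"

context
  fixes R :: "('a, 'b) ring_scheme" (structure)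
begin

fun move1 :: "'a triple \<Rightarrow> 'a triple" where
  "move1 (x, y, z) = ((y \<otimes> z) \<ominus> x, y, z)"

fun move2 :: "'a triple \<Rightarrow> 'a triple" where
  "move2 (x, y, z) = (x, (x \<otimes> z) \<ominus> y, z)"

fun move3 :: "'a triple \<Rightarrow> 'a triple" where
  "move3 (x, y, z) = (x, y, (x \<otimes> y) \<ominus> z)"

definition markoff_triples :: "'a triple set" where
  "markoff_triples =
     {(x, y, z). x \<in> carrier R \<and> y \<in> carrier R \<and> z \<in> carrier R \<and>
        (x, y, z) \<noteq> (\<zero>, \<zero>, \<zero>) \<and>
        x [^] (2::nat) \<oplus> y [^] (2::nat) \<oplus> z [^] (2::nat) = x \<otimes> y \<otimes> z}"

definition markoff_edges :: "'a triple set set" where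
  "markoff_edges = {{v, m v} | v m. v \<in> markoff_triples \<and> m \<in> {move1, move2, move3}}"

end

text \<open>The field with \<open>p\<close> elements is the library's residue ring, with carrier \<open>{0..p - 1}\<close>.
  Different moves change different coordinates, so two of them never give the same non-loop edge
  and representing edges as sets of endpoints identifies no parallel edges.\<close>

definition markoff_graph :: "nat \<Rightarrow> int triple graph" where
  "markoff_graph p =
     (markoff_triples (residue_ring (int p)), markoff_edges (residue_ring (int p)))"

end

theory Submission
  imports Defs
begin

text \<open>
  Two vertices are adjacent exactly when they differ in a single coordinate, and the two values of
  that coordinate are the roots of a quadratic equation given by the other two.

  For large \<open>p\<close> the graph has about \<open>p\<^sup>2\<close> vertices, almost all of degree 3, so by Euler's formula
  a plane drawing would have about \<open>p\<^sup>2 / 2\<close> faces with average length about 6. But short cycles are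
  rare. No coordinate changes exactly once along a cycle, hence a cycle of length at most 6 either
  keeps one coordinate constant, which by Vieta's formulas must be 0 (length 4) or \<open>\<plusminus>1\<close> (length 6),
  or it changes the coordinates in the cyclic order \<open>ijkijk\<close>, and then the two constant coordinates
  of each edge have squares adding up to 3. So only \<open>O(p)\<close> edges lie on a cycle of length at
  most 6, and weighting these edges suitably contradicts Euler's formula once \<open>p \<ge> 67\<close>. For the
  primes below 67 there are explicit subdivisions of \<open>K\<^sub>3\<^sub>,\<^sub>3\<close>, or straight-line drawings if
  \<open>p \<in> {2, 3, 7}\<close>.

  The part of Euler's formula that is needed holds for arbitrary drawings by arcs: an edge that
  closes a cycle splits a face (Jordan curve theorem), an edge touches at most two faces, and a
  forest does not separate the plane (both by Janiszewski's theorem), so that the edges touching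
  a face contain a cycle.
\<close>

section \<open>Plane drawings and Euler's formula\<close>

text \<open>Faces are components of the complement of arbitrary arcs, so there is no boundary walk
  to follow. \<open>touches\<close> takes the place of incidence, and only two facts about it enter
  the count: the edges touching a face contain a cycle, and an edge touches at most two faces.
  Distributing weights over these pairs bounds the number of faces from above; adding the edges one
  at a time bounds it from below.

  The margin is thin. With cycles of weight 84 and ordinary edges of weight 12, Euler's formula
  gives 60 |E| \<le> 84 |V| + O(p), while degree 3 gives 60 |E| = 90 |V| - O(p). What remains is 6
  |V|, about 6 p^2, against linear terms of about 384 p. The constants therefore decide where the
  contradiction sets in, and for smaller primes each graph needs its own certificate.\<close>

definition joined :: "'v set set \<Rightarrow> ('v \<times> 'v) set" where
  "joined A = {(u, v). {u, v} \<in> A}\<^sup>*"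

lemma equiv_joined: "equiv UNIV (joined A)"
proof (rule equivI)
  have "sym {(u, v). {u, v} \<in> A}"
    by (auto simp: sym_def insert_commute)
  then show "sym (joined A)"
    unfolding joined_def by (rule sym_rtrancl)
qed (auto simp: joined_def refl_rtrancl trans_rtrancl)

lemma joined_sym: "(u, v) \<in> joined A \<Longrightarrow> (v, u) \<in> joined A"
  using equiv_joined[of A] by (meson equivE symE)

lemma joined_trans: "(u, v) \<in> joined A \<Longrightarrow> (v, w) \<in> joined A \<Longrightarrow> (u, w) \<in> joined A"
  unfolding joined_def by (rule rtrancl_trans)

lemma joined_refl: "(u, u) \<in> joined A"
  unfolding joined_def by simp

lemma joined_edge: "{u, v} \<in> A \<Longrightarrow> (u, v) \<in> joined A"
  unfolding joined_def by auto

lemma joined_mono: "A \<subseteq> B \<Longrightarrow> joined A \<subseteq> joined B"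
  unfolding joined_def by (rule rtrancl_mono) auto

text \<open>A common setting for two kinds of drawings: the Markoff graph itself, and a
  \<open>K33_edges\<close> graph whose arcs are assembled from several edges of the former.\<close>

locale plane_graph =
  fixes W :: "'v set" and E :: "'v set set"
    and pos :: "'v \<Rightarrow> complex" and \<gamma> :: "'v set \<Rightarrow> real \<Rightarrow> complex"
  assumes inj_pos: "inj_on pos W"
    and finite_edges: "finite E"
    and edge_sub: "e \<in> E \<Longrightarrow> e \<subseteq> W"
    and edge_card: "e \<in> E \<Longrightarrow> card e = 2"
    and edge_arc: "e \<in> E \<Longrightarrow> arc (\<gamma> e)"
    and edge_ends: "e \<in> E \<Longrightarrow> {pathstart (\<gamma> e), pathfinish (\<gamma> e)} = pos ` e"
    and edge_meet: "\<lbrakk>e \<in> E; e' \<in> E; e \<noteq> e'\<rbrakk> \<Longrightarrow>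
      path_image (\<gamma> e) \<inter> path_image (\<gamma> e') \<subseteq> pos ` (e \<inter> e')"
begin

definition trace :: "'v set set \<Rightarrow> complex set" where
  "trace A = (\<Union>e\<in>A. path_image (\<gamma> e))"

text \<open>Only interior points of the arc count. At an endpoint many faces may meet the edge,
  which would ruin the bound of two faces per edge.\<close>

definition touches :: "complex set \<Rightarrow> 'v set \<Rightarrow> bool" where
  "touches f e \<longleftrightarrow> (\<exists>t. 0 < t \<and> t < 1 \<and> \<gamma> e t \<in> closure f)"

lemma pos_eq_iff: "u \<in> W \<Longrightarrow> v \<in> W \<Longrightarrow> pos u = pos v \<longleftrightarrow> u = v"
  using inj_pos by (auto dest: inj_onD)

lemma edge_orient:
  assumes "e \<in> E"
  obtains u v where "e = {u, v}" "u \<noteq> v" "u \<in> W" "v \<in> W"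
    "pathstart (\<gamma> e) = pos u" "pathfinish (\<gamma> e) = pos v"
proof -
  obtain a b where ab: "e = {a, b}" "a \<noteq> b"
    using edge_card[OF assms] by (meson card_2_iff)
  have W: "a \<in> W" "b \<in> W"
    using edge_sub[OF assms] ab by auto
  have "{pathstart (\<gamma> e), pathfinish (\<gamma> e)} = {pos a, pos b}"
    using edge_ends[OF assms] ab by auto
  then consider "pathstart (\<gamma> e) = pos a" "pathfinish (\<gamma> e) = pos b"
    | "pathstart (\<gamma> e) = pos b" "pathfinish (\<gamma> e) = pos a"
    by (auto simp: doubleton_eq_iff)
  then show thesis
    by cases (use that ab W in blast)+
qed

lemma compact_trace: "A \<subseteq> E \<Longrightarrow> compact (trace A)"
  unfolding trace_def using finite_edges edge_arc
  by (intro compact_UN) (auto intro: finite_subset compact_arc_image)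

lemma closed_trace: "A \<subseteq> E \<Longrightarrow> closed (trace A)"
  using compact_trace compact_imp_closed by blast

lemma trace_Int:
  assumes "A \<subseteq> E" "B \<subseteq> E" "A \<inter> B = {}" "z \<in> trace A" "z \<in> trace B"
  obtains w e e' where "e \<in> A" "e' \<in> B" "w \<in> e" "w \<in> e'" "z = pos w"
proof -
  obtain e e' where e: "e \<in> A" "e' \<in> B" "z \<in> path_image (\<gamma> e)" "z \<in> path_image (\<gamma> e')"
    using assms unfolding trace_def by blast
  moreover have "e \<noteq> e'" "e \<in> E" "e' \<in> E"
    using e assms by auto
  ultimately have "z \<in> pos ` (e \<inter> e')"
    using edge_meet by blast
  then show thesis
    using that e by blast
qed

lemma joined_sub:
  assumes "(u, v) \<in> joined A" "A \<subseteq> E" "u \<noteq> v"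
  shows "u \<in> W" "v \<in> W"
proof -
  have "\<exists>w. {u, w} \<in> A"
    using assms unfolding joined_def by (auto elim: converse_rtranclE)
  then show "u \<in> W"
    using edge_sub assms by blast
  have "\<exists>w. {w, v} \<in> A"
    using assms unfolding joined_def by (auto elim: rtranclE)
  then show "v \<in> W"
    using edge_sub assms by blast
qed

lemma joined_path_component:
  assumes "(u, v) \<in> joined A" "A \<subseteq> E"
  shows "u = v \<or> path_component (trace A) (pos u) (pos v)"
  using assms(1) unfolding joined_def
proof (induction rule: rtrancl_induct)
  case base
  show ?case by simp
next
  case (step w v)
  then have e: "{w, v} \<in> A" "{w, v} \<in> E"
    using assms by auto
  have sub: "path_image (\<gamma> {w, v}) \<subseteq> trace A"
    using e by (auto simp: trace_def)
  obtain a b where ab: "{w, v} = {a, b}" "a \<noteq> b"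
    "pathstart (\<gamma> {w, v}) = pos a" "pathfinish (\<gamma> {w, v}) = pos b"
    using edge_orient[OF e(2)] by metis
  have "path_component (trace A) (pos a) (pos b)"
    unfolding path_component_def
    using ab(3,4) sub edge_arc[OF e(2)] arc_imp_path by blast
  then have "path_component (trace A) (pos w) (pos v)"
    using ab(1) path_component_sym by (auto simp: doubleton_eq_iff)
  then show ?case
    using step.IH path_component_trans by metis
qed

lemma joined_arc:
  assumes "(u, v) \<in> joined A" "A \<subseteq> E" "u \<noteq> v"
  obtains \<delta> where "arc \<delta>" "path_image \<delta> \<subseteq> trace A" "pathstart \<delta> = pos u" "pathfinish \<delta> = pos v"
proof -
  have "path_component (trace A) (pos u) (pos v)"
    using joined_path_component assms by blast
  moreover have "pos u \<noteq> pos v"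
    using joined_sub[OF assms] assms pos_eq_iff by metis
  ultimately show thesis
    using that path_contains_arc unfolding path_component_def
    by (metis (no_types, opaque_lifting) order_trans)
qed

lemma edge_Int_trace:
  assumes "{u, v} \<in> E" "A \<subseteq> E - {{u, v}}"
  shows "path_image (\<gamma> {u, v}) \<inter> trace A \<subseteq> {pos u, pos v}"
proof
  fix z assume "z \<in> path_image (\<gamma> {u, v}) \<inter> trace A"
  then obtain e where e: "e \<in> A" "z \<in> path_image (\<gamma> {u, v}) \<inter> path_image (\<gamma> e)"
    unfolding trace_def by blast
  then have "z \<in> pos ` ({u, v} \<inter> e)"
    using edge_meet[of "{u, v}" e] assms by blast
  then show "z \<in> {pos u, pos v}"
    by auto
qed

lemma edge_closing_loop:
  assumes e: "e \<in> E" and A: "A \<subseteq> E - {e}" and uv: "e = {u, v}" "(u, v) \<in> joined A"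
    "pathstart (\<gamma> e) = pos u" "pathfinish (\<gamma> e) = pos v" "u \<noteq> v"
  obtains \<delta> where "arc \<delta>" "path_image \<delta> \<subseteq> trace A" "pathstart \<delta> = pos v" "pathfinish \<delta> = pos u"
    "simple_path (\<gamma> e +++ \<delta>)" "pathfinish (\<gamma> e +++ \<delta>) = pathstart (\<gamma> e +++ \<delta>)"
    "path_image (\<gamma> e +++ \<delta>) = path_image (\<gamma> e) \<union> path_image \<delta>"
proof -
  obtain \<delta> where d: "arc \<delta>" "path_image \<delta> \<subseteq> trace A" "pathstart \<delta> = pos v" "pathfinish \<delta> = pos u"
    using joined_arc[OF joined_sym[OF uv(2)]] A uv by (metis Diff_subset order_trans)
  have "path_image (\<gamma> e) \<inter> path_image \<delta> \<subseteq> {pos u, pos v}"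
    using edge_Int_trace[of u v A] e A uv d by blast
  then have "simple_path (\<gamma> e +++ \<delta>)"
    using d uv edge_arc[OF e] by (intro simple_path_join_loop) auto
  then show thesis
    using that[OF d] d uv by (simp add: path_image_join)
qed

lemma edge_interior_notin_trace:
  assumes e: "e \<in> E" and A: "A \<subseteq> E - {e}" and t: "0 < t" "t < 1"
  shows "\<gamma> e t \<notin> trace A"
proof
  assume "\<gamma> e t \<in> trace A"
  moreover have "\<gamma> e t \<in> path_image (\<gamma> e)"
    using t by (auto simp: path_image_def)
  moreover obtain u v where uv: "e = {u, v}" "pathstart (\<gamma> e) = pos u" "pathfinish (\<gamma> e) = pos v"
    using edge_orient[OF e] by metis
  ultimately have "\<gamma> e t = \<gamma> e 0 \<or> \<gamma> e t = \<gamma> e 1"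
    using edge_Int_trace[of u v A] e A by (auto simp: pathstart_def pathfinish_def)
  moreover have "inj_on (\<gamma> e) {0..1}"
    using edge_arc[OF e] by (simp add: arc_def)
  ultimately show False
    using t inj_onD[of "\<gamma> e" "{0..1}" t 0] inj_onD[of "\<gamma> e" "{0..1}" t 1] by auto
qed

text \<open>The midpoint of \<open>e\<close> is on the frontier of both sides of the Jordan curve
  that \<open>e\<close> closes, yet a small ball around it avoids \<open>trace A\<close>. Two points
  of this ball on different sides are connected off \<open>trace A\<close> and separated by the
  curve.\<close>

lemma new_face_pair:
  assumes e: "e \<in> E" and A: "A \<subseteq> E - {e}" and uv: "e = {u, v}" "(u, v) \<in> joined A"
  obtains x y where "connected_component (- trace A) x y"
    "x \<notin> trace (insert e A)" "y \<notin> trace (insert e A)"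
    "\<not> connected_component (- trace (insert e A)) x y"
proof -
  obtain a b where ab: "e = {a, b}" "a \<noteq> b" "pathstart (\<gamma> e) = pos a" "pathfinish (\<gamma> e) = pos b"
    using edge_orient[OF e] by metis
  have "(a, b) \<in> joined A"
    using ab uv joined_sym by (auto simp: doubleton_eq_iff)
  then obtain \<delta> where d: "path_image \<delta> \<subseteq> trace A"
    "simple_path (\<gamma> e +++ \<delta>)" "pathfinish (\<gamma> e +++ \<delta>) = pathstart (\<gamma> e +++ \<delta>)"
    "path_image (\<gamma> e +++ \<delta>) = path_image (\<gamma> e) \<union> path_image \<delta>"
    using edge_closing_loop[OF e A] ab by metis
  define C where "C = path_image (\<gamma> e +++ \<delta>)"
  obtain inner outer where io: "open inner" "open outer" "inner \<inter> outer = {}"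
    "inner \<union> outer = - C" "frontier inner = C" "frontier outer = C"
    using Jordan_curve[OF d(2,3)] unfolding C_def by metis
  define m where "m = \<gamma> e (1/2)"
  have "m \<in> C"
    unfolding m_def C_def d by (rule UnI1) (auto simp: path_image_def)
  have "m \<notin> trace A"
    unfolding m_def by (rule edge_interior_notin_trace[OF e A]) auto
  moreover have "open (- trace A)"
    using closed_trace A by (auto simp: open_Compl)
  ultimately obtain r where r: "r > 0" "ball m r \<subseteq> - trace A"
    by (meson ComplI open_contains_ball)
  obtain x where x: "x \<in> inner" "x \<in> ball m r"
    using \<open>m \<in> C\<close> io(5) r(1) closure_approachable[of m inner]
    by (auto simp: frontier_def dist_commute)
  obtain y where y: "y \<in> outer" "y \<in> ball m r"
    using \<open>m \<in> C\<close> io(6) r(1) closure_approachable[of m outer]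
    by (auto simp: frontier_def dist_commute)
  have C: "C \<subseteq> trace (insert e A)"
    using d by (auto simp: C_def trace_def)
  have xy: "x \<notin> C" "y \<notin> C"
    using x y io by auto
  show thesis
  proof
    show "connected_component (- trace A) x y"
      using r x y unfolding connected_component_def by (meson connected_ball)
    show "x \<notin> trace (insert e A)" "y \<notin> trace (insert e A)"
      using xy d(4) subsetD[OF r(2) x(2)] subsetD[OF r(2) y(2)] by (simp_all add: trace_def C_def)
    show "\<not> connected_component (- trace (insert e A)) x y"
    proof
      assume "connected_component (- trace (insert e A)) x y"
      then obtain T where T: "connected T" "T \<subseteq> - C" "x \<in> T" "y \<in> T"
        using C unfolding connected_component_def by blast
      have "inner \<inter> T = {} \<or> outer \<inter> T = {}"
        by (rule connectedD[OF T(1) io(1,2)]) (use io(3,4) T(2) in auto)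
      then show False
        using x(1) y(1) T(3,4) by auto
    qed
  qed
qed

section \<open>Faces that touch a given edge\<close>

lemma touching_points:
  assumes e: "e \<in> A" "A \<subseteq> E" and t: "touches f e" "touches g e"
  obtains s s' x y where "0 < s" "s < s'" "s' < 1" "x \<in> f" "y \<in> g"
    "connected_component
       (- (trace (A - {e}) \<union> \<gamma> e ` {0..s} \<union> \<gamma> e ` {s'..1})) x y"
proof -
  obtain a b where a: "0 < a" "a < 1" "\<gamma> e a \<in> closure f" and b: "0 < b" "b < 1" "\<gamma> e b \<in> closure g"
    using t unfolding touches_def by blast
  have eE: "e \<in> E" "A - {e} \<subseteq> E - {e}"
    using e by auto
  \<comment> \<open>These parameters put both touching points strictly inside the middle stretch of
    \<open>e\<close>. The stretch between them, with small balls around its ends, is connected and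
    avoids the other edges and the two end pieces. So \<open>f\<close> and \<open>g\<close> become
    connected once the middle of \<open>e\<close> is opened; closing it again is left to
    Janiszewski's theorem.\<close>
  define s s' where "s = min a b / 2" and "s' = (max a b + 1) / 2"
  have s: "0 < s" "s < a" "s < b" "a < s'" "b < s'" "s' < 1"
    using a b by (auto simp: s_def s'_def)
  have cont: "continuous_on {0..1} (\<gamma> e)" and inj: "inj_on (\<gamma> e) {0..1}"
    using edge_arc[OF eE(1)] by (auto simp: arc_def path_def)
  let ?B = "trace (A - {e}) \<union> \<gamma> e ` {0..s} \<union> \<gamma> e ` {s'..1}"
  have cl: "compact (\<gamma> e ` {0..s})" "compact (\<gamma> e ` {s'..1})"
    using s by (auto intro!: compact_continuous_image continuous_on_subset[OF cont])
  then have "open (- ?B)"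
    using closed_trace[of "A - {e}"] e by (intro open_Compl closed_Un) (auto intro: compact_imp_closed)
  moreover have nB: "\<gamma> e r \<notin> ?B" if "s < r" "r < s'" for r
  proof -
    have "\<gamma> e r \<noteq> \<gamma> e t" if "t \<in> {0..s} \<union> {s'..1}" for t
    proof -
      have "r \<in> {0..1}" "t \<in> {0..1}" "r \<noteq> t"
        using that \<open>s < r\<close> \<open>r < s'\<close> s by auto
      then show ?thesis
        using inj by (simp add: inj_on_eq_iff)
    qed
    then have "\<gamma> e r \<notin> \<gamma> e ` {0..s}" "\<gamma> e r \<notin> \<gamma> e ` {s'..1}"
      by blast+
    moreover have "\<gamma> e r \<notin> trace (A - {e})"
      using edge_interior_notin_trace[OF eE, of r] that s by linarith
    ultimately show ?thesis
      by blast
  qed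
  ultimately obtain ra rb where r: "ra > 0" "rb > 0" "ball (\<gamma> e a) ra \<subseteq> - ?B" "ball (\<gamma> e b) rb \<subseteq> - ?B"
    using s by (metis ComplI open_contains_ball)
  obtain x where x: "x \<in> f" "x \<in> ball (\<gamma> e a) ra"
    using a(3) r(1) unfolding closure_approachable mem_ball by (metis dist_commute)
  obtain y where y: "y \<in> g" "y \<in> ball (\<gamma> e b) rb"
    using b(3) r(2) unfolding closure_approachable mem_ball by (metis dist_commute)
  let ?J = "\<gamma> e ` {min a b..max a b}"
  have J: "connected ?J" "?J \<subseteq> - ?B" "\<gamma> e a \<in> ?J" "\<gamma> e b \<in> ?J"
  proof -
    show "connected ?J"
      using a b by (intro connected_continuous_image continuous_on_subset[OF cont]) auto
    show "?J \<subseteq> - ?B"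
    proof
      fix z assume "z \<in> ?J"
      then obtain t where "z = \<gamma> e t" "min a b \<le> t" "t \<le> max a b"
        by auto
      moreover from this have "s < t" "t < s'"
        using s(2-5) by (auto simp: min_le_iff_disj le_max_iff_disj)
      ultimately show "z \<in> - ?B"
        using nB[of t] by simp
    qed
    show "\<gamma> e a \<in> ?J" "\<gamma> e b \<in> ?J"
      by (intro imageI; simp)+
  qed
  define U where "U = ball (\<gamma> e a) ra \<union> (?J \<union> ball (\<gamma> e b) rb)"
  have "connected (?J \<union> ball (\<gamma> e b) rb)"
    using J(4) centre_in_ball[of "\<gamma> e b" rb] r(2) by (intro connected_Un[OF J(1) connected_ball]) blast
  moreover have "\<gamma> e a \<in> ball (\<gamma> e a) ra \<inter> (?J \<union> ball (\<gamma> e b) rb)"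
    using J(3) r(1) by simp
  ultimately have "connected U"
    unfolding U_def by (intro connected_Un[OF connected_ball]) blast+
  moreover have "U \<subseteq> - ?B"
    unfolding U_def by (intro Un_least r(3,4) J(2))
  moreover have "x \<in> U" "y \<in> U"
    unfolding U_def using x(2) y(2) by simp_all
  ultimately have "connected_component (- ?B) x y"
    unfolding connected_component_def by blast
  then show thesis
    using that[of s s' x y] s x(1) y(1) by simp
qed

text \<open>The edges in the component of \<open>a\<close>. Their trace is disjoint from that of the
  other edges of \<open>A\<close>, so deleting a bridge cuts the drawing into two separate compact
  pieces.\<close>

definition reach :: "'v \<Rightarrow> 'v set set \<Rightarrow> 'v set set" where
  "reach a A = {e \<in> A. \<exists>w\<in>e. (a, w) \<in> joined A}"

lemma reach_vertex:
  assumes "A \<subseteq> E" "e \<in> reach a A" "w \<in> e"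
  shows "(a, w) \<in> joined A"
proof -
  obtain w' where w': "w' \<in> e" "(a, w') \<in> joined A" "e \<in> A"
    using assms by (auto simp: reach_def)
  show ?thesis
  proof (cases "w = w'")
    case False
    obtain c d where "e = {c, d}"
      using edge_card[of e] w' assms by (meson card_2_iff subsetD)
    then have "{w', w} = e"
      using w' False assms(3) by auto
    then show ?thesis
      using w' joined_edge joined_trans by metis
  qed (use w' in simp)
qed

lemma trace_reach_disjoint:
  assumes "A \<subseteq> E"
  shows "trace (reach a A) \<inter> trace (A - reach a A) = {}"
proof (rule equals0I)
  fix z assume z: "z \<in> trace (reach a A) \<inter> trace (A - reach a A)"
  have "reach a A \<subseteq> E" "A - reach a A \<subseteq> E"
    using assms by (auto simp: reach_def)
  then obtain w e e' where "e \<in> reach a A" "e' \<in> A - reach a A" "w \<in> e" "w \<in> e'"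
    by (rule trace_Int[of "reach a A" "A - reach a A" z]) (use z in auto)
  then show False
    using reach_vertex[OF assms, of e a w] by (auto simp: reach_def)
qed

lemma edge_Int_trace_vertex:
  assumes "e \<in> E" "A \<subseteq> E - {e}" "z \<in> path_image (\<gamma> e)" "z \<in> trace A"
  obtains w e' where "w \<in> e" "e' \<in> A" "w \<in> e'" "z = pos w"
  by (rule trace_Int[of "{e}" A z]) (use assms in \<open>auto simp: trace_def\<close>)

lemma edge_Int_reach:
  assumes "{a, b} \<in> E" "A \<subseteq> E - {{a, b}}" "(a, b) \<notin> joined A"
  shows "path_image (\<gamma> {a, b}) \<inter> trace (reach a A) \<subseteq> {pos a}"
    and "path_image (\<gamma> {a, b}) \<inter> trace (A - reach a A) \<subseteq> {pos b}"
proof -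
  have sub: "reach a A \<subseteq> E - {{a, b}}" "A - reach a A \<subseteq> E - {{a, b}}" "A \<subseteq> E"
    using assms by (auto simp: reach_def)
  show "path_image (\<gamma> {a, b}) \<inter> trace (reach a A) \<subseteq> {pos a}"
  proof
    fix z assume "z \<in> path_image (\<gamma> {a, b}) \<inter> trace (reach a A)"
    then obtain w e' where w: "w \<in> {a, b}" "e' \<in> reach a A" "w \<in> e'" "z = pos w"
      using edge_Int_trace_vertex[OF assms(1) sub(1)] by blast
    then show "z \<in> {pos a}"
      using reach_vertex[OF sub(3) w(2,3)] assms(3) by auto
  qed
  show "path_image (\<gamma> {a, b}) \<inter> trace (A - reach a A) \<subseteq> {pos b}"
  proof
    fix z assume "z \<in> path_image (\<gamma> {a, b}) \<inter> trace (A - reach a A)"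
    then obtain w e' where w: "w \<in> {a, b}" "e' \<in> A - reach a A" "w \<in> e'" "z = pos w"
      using edge_Int_trace_vertex[OF assms(1) sub(2)] by blast
    then show "z \<in> {pos b}"
      using joined_refl[of a A] by (auto simp: reach_def)
  qed
qed

lemma component_eqI:
  assumes "f \<in> components S" "g \<in> components S" "x \<in> f" "y \<in> g" "connected_component S x y"
  shows "f = g"
  using assms by (metis components_iff connected_component_eq mem_Collect_eq)

text \<open>The other edges fall apart into \<open>P\<close> at \<open>u\<close> and
  \<open>Q\<close> at \<open>v\<close>. None of the arc \<open>e\<close>,
  \<open>P \<union> K\<close> and \<open>Q \<union> K'\<close> separates \<open>x\<close> from
  \<open>y\<close>. Joining them one after the other, the intersections are the end pieces
  \<open>K\<close> and \<open>K'\<close>, which are connected, so by Janiszewski's theorem the union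
  does not separate either.\<close>

lemma touching_bridge:
  assumes e: "e \<in> A" "A \<subseteq> E" and ab: "e = {a, b}" "(a, b) \<notin> joined (A - {e})"
    and fg: "f \<in> components (- trace A)" "g \<in> components (- trace A)" "touches f e" "touches g e"
  shows "f = g"
proof -
  obtain u v where uv: "e = {u, v}" "pathstart (\<gamma> e) = pos u" "pathfinish (\<gamma> e) = pos v"
    using edge_orient e by (metis subsetD)
  define D where "D = A - {e}"
  have D: "D \<subseteq> E - {{u, v}}" "D \<subseteq> E" "{u, v} \<in> E" "e \<in> E"
    using e uv by (auto simp: D_def)
  have nj: "(u, v) \<notin> joined D"
    using ab uv joined_sym[of u v D] by (auto simp: D_def doubleton_eq_iff)
  obtain s s' x y where s: "0 < s" "s < s'" "s' < 1" and xy: "x \<in> f" "y \<in> g"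
    and cc: "connected_component (- (trace D \<union> \<gamma> e ` {0..s} \<union> \<gamma> e ` {s'..1})) x y"
    using touching_points[OF e fg(3,4)] unfolding D_def by metis
  have arc: "arc (\<gamma> e)"
    using edge_arc D by blast
  then have cont: "continuous_on {0..1} (\<gamma> e)" and inj: "inj_on (\<gamma> e) {0..1}"
    by (auto simp: arc_def path_def)
  define K K' where "K = \<gamma> e ` {0..s}" and "K' = \<gamma> e ` {s'..1}"
  have K: "compact K" "connected K" "compact K'" "connected K'"
    using s unfolding K_def K'_def
    by (auto intro!: compact_continuous_image connected_continuous_image continuous_on_subset[OF cont])
  have KI: "K \<subseteq> path_image (\<gamma> e)" "K' \<subseteq> path_image (\<gamma> e)" "pos u \<in> K" "pos v \<in> K'"
    using s uv unfolding K_def K'_def path_image_def pathstart_def pathfinish_def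
    by (auto intro: rev_image_eqI[of 0] rev_image_eqI[of 1])
  have "\<gamma> e 0 \<noteq> \<gamma> e t" if "t \<in> {s'..1}" for t
  proof -
    have "t \<in> {0..1}" "0 \<noteq> t" "(0::real) \<in> {0..1}"
      using that s by auto
    then show ?thesis
      using inj by (simp add: inj_on_eq_iff)
  qed
  then have uK': "pos u \<notin> K'"
    unfolding K'_def uv(2)[symmetric] pathstart_def by (metis imageE)
  define P Q where "P = trace (reach u D)" and "Q = trace (D - reach u D)"
  have cPQ: "compact P" "compact Q"
    using D by (auto simp: P_def Q_def reach_def intro!: compact_trace)
  have PQ: "P \<inter> Q = {}" "trace D = P \<union> Q"
    using trace_reach_disjoint[OF D(2)] by (auto simp: P_def Q_def trace_def reach_def)
  have eP: "path_image (\<gamma> e) \<inter> P \<subseteq> {pos u}" and eQ: "path_image (\<gamma> e) \<inter> Q \<subseteq> {pos v}"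
    using edge_Int_reach[OF D(3,1) nj] uv by (auto simp: P_def Q_def)
  have tA: "trace A = path_image (\<gamma> e) \<union> P \<union> Q"
    using e PQ(2) by (auto simp: trace_def D_def)
  have xyA: "x \<in> - trace A" "y \<in> - trace A"
    using fg xy in_components_subset by blast+
  have sub: "connected_component (- T) x y" if "T \<subseteq> trace D \<union> K \<union> K'" for T
    using cc that unfolding K_def K'_def by (elim connected_component_of_subset) auto
  have "connected_component (- path_image (\<gamma> e)) x y"
    using connected_arc_complement[OF arc] xyA tA by (intro connected_componentI[of "- path_image (\<gamma> e)"]) auto
  moreover have "(P \<union> K) \<inter> path_image (\<gamma> e) = K"
    using eP KI by blast
  ultimately have "connected_component (- ((P \<union> K) \<union> path_image (\<gamma> e))) x y"
    using K(2) sub[of "P \<union> K"]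
    by (intro Janiszewski[OF compact_Un[OF cPQ(1) K(1)] closed_arc_image[OF arc]])
      (simp_all add: PQ(2) le_supI1)
  moreover have "connected_component (- (Q \<union> K')) x y"
    by (rule sub) (auto simp: PQ(2))
  moreover have "(P \<union> K \<union> path_image (\<gamma> e)) \<inter> (Q \<union> K') = K'"
    using eP eQ KI PQ uK' by blast
  ultimately have "connected_component (- ((P \<union> K \<union> path_image (\<gamma> e)) \<union> (Q \<union> K'))) x y"
    using K(4) compact_imp_closed[OF compact_Un[OF cPQ(2) K(3)]]
    by (intro Janiszewski[OF compact_Un[OF compact_Un[OF cPQ(1) K(1)] compact_arc_image[OF arc]]]) simp_all
  moreover have "(P \<union> K \<union> path_image (\<gamma> e)) \<union> (Q \<union> K') = trace A"
    using tA KI by blast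
  ultimately have "connected_component (- trace A) x y"
    by simp
  then show ?thesis
    using component_eqI fg xy by blast
qed

text \<open>\<open>inner\<close> and \<open>outer\<close> are the sides of a Jordan curve
  \<open>C\<close> through \<open>e\<close>. For faces on the same side, neither \<open>C\<close>
  nor the drawing with the middle of \<open>e\<close> opened separates \<open>x\<close> from
  \<open>y\<close>. These two sets meet in the rest of the curve with the two end pieces attached,
  which is connected, so Janiszewski's theorem applies.\<close>

lemma touching_cycle_edge:
  assumes e: "e \<in> A" "A \<subseteq> E" and ab: "e = {a, b}" "(a, b) \<in> joined (A - {e})"
  obtains inner outer where
    "\<And>f. f \<in> components (- trace A) \<Longrightarrow> f \<subseteq> inner \<or> f \<subseteq> outer"
    "\<And>S f g. S \<in> {inner, outer} \<Longrightarrow> f \<in> components (- trace A) \<Longrightarrow> g \<in> components (- trace A) \<Longrightarrow>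
       touches f e \<Longrightarrow> touches g e \<Longrightarrow> f \<subseteq> S \<Longrightarrow> g \<subseteq> S \<Longrightarrow> f = g"
proof -
  obtain u v where uv: "e = {u, v}" "u \<noteq> v" "pathstart (\<gamma> e) = pos u" "pathfinish (\<gamma> e) = pos v"
    using edge_orient e by (metis subsetD)
  define D where "D = A - {e}"
  have D: "D \<subseteq> E - {e}" "D \<subseteq> E - {{u, v}}" "D \<subseteq> E" "{u, v} \<in> E" "e \<in> E"
    using e uv by (auto simp: D_def)
  have "(u, v) \<in> joined D"
    using ab uv joined_sym[of a b D] by (auto simp: D_def doubleton_eq_iff)
  then obtain \<delta> where d: "arc \<delta>" "path_image \<delta> \<subseteq> trace D" "pathstart \<delta> = pos v" "pathfinish \<delta> = pos u"
    "simple_path (\<gamma> e +++ \<delta>)" "pathfinish (\<gamma> e +++ \<delta>) = pathstart (\<gamma> e +++ \<delta>)"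
    "path_image (\<gamma> e +++ \<delta>) = path_image (\<gamma> e) \<union> path_image \<delta>"
    using edge_closing_loop[OF D(5,1) uv(1)] uv by metis
  define C where "C = path_image (\<gamma> e +++ \<delta>)"
  obtain inner outer where io: "open inner" "connected inner" "open outer" "connected outer"
    "inner \<inter> outer = {}" "inner \<union> outer = - C"
    using Jordan_curve[OF d(5,6)] unfolding C_def by metis
  have arc: "arc (\<gamma> e)"
    using edge_arc D by blast
  then have cont: "continuous_on {0..1} (\<gamma> e)"
    by (auto simp: arc_def path_def)
  have CA: "C \<subseteq> trace A"
    using d e by (auto simp: C_def trace_def D_def)
  show thesis
  proof
    fix f assume f: "f \<in> components (- trace A)"
    then have "connected f" "f \<subseteq> - trace A"
      by (auto simp: in_components_connected in_components_subset)
    then have "inner \<inter> f = {} \<or> outer \<inter> f = {}"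
      by (intro connectedD[OF _ io(1,3)]) (use io(5,6) CA in auto)
    then show "f \<subseteq> inner \<or> f \<subseteq> outer"
      using \<open>f \<subseteq> - trace A\<close> CA io(6) by blast
  next
    fix S f g
    assume S: "S \<in> {inner, outer}" and fg: "f \<in> components (- trace A)" "g \<in> components (- trace A)"
      "touches f e" "touches g e" "f \<subseteq> S" "g \<subseteq> S"
    obtain s s' x y where s: "0 < s" "s < s'" "s' < 1" and xy: "x \<in> f" "y \<in> g"
      and cc: "connected_component (- (trace D \<union> \<gamma> e ` {0..s} \<union> \<gamma> e ` {s'..1})) x y"
      using touching_points[OF e fg(3,4)] unfolding D_def by metis
    define K K' where "K = \<gamma> e ` {0..s}" and "K' = \<gamma> e ` {s'..1}"
    have K: "compact K" "connected K" "compact K'" "connected K'"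
      using s unfolding K_def K'_def
      by (auto intro!: compact_continuous_image connected_continuous_image continuous_on_subset[OF cont])
    have KI: "K \<subseteq> path_image (\<gamma> e)" "K' \<subseteq> path_image (\<gamma> e)" "pos u \<in> K" "pos v \<in> K'"
      using s uv unfolding K_def K'_def path_image_def pathstart_def pathfinish_def
      by (auto intro: rev_image_eqI[of 0] rev_image_eqI[of 1])
    have dp: "pos u \<in> path_image \<delta>" "pos v \<in> path_image \<delta>"
      using d(3,4) pathstart_in_path_image[of \<delta>] pathfinish_in_path_image[of \<delta>] by auto
    have "connected S" "S \<subseteq> - C"
      using S io by auto
    then have "connected_component (- C) x y"
      using fg(5,6) xy unfolding connected_component_def by blast
    moreover have "C \<inter> (trace D \<union> K \<union> K') = path_image \<delta> \<union> (K \<union> K')"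
      using edge_Int_trace[OF D(4,2)] uv(1) d(2,7) KI dp by (auto simp: C_def)
    moreover have "connected (path_image \<delta> \<union> K \<union> K')"
      using KI dp K d(1) by (intro connected_Un) (auto simp: connected_arc_image)
    ultimately have "connected_component (- (C \<union> (trace D \<union> K \<union> K'))) x y"
    proof (intro Janiszewski[of C "trace D \<union> K \<union> K'"])
      show "compact C"
        using d(5) by (simp add: C_def compact_simple_path_image)
      show "closed (trace D \<union> K \<union> K')"
        using D(3) K by (intro closed_Un closed_trace compact_imp_closed)
      show "connected_component (- (trace D \<union> K \<union> K')) x y"
        using cc by (simp add: K_def K'_def)
    qed (simp_all add: Un_assoc)
    moreover have "C \<union> (trace D \<union> K \<union> K') = trace A"
      using d KI e by (auto simp: C_def trace_def D_def)
    ultimately show "f = g"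
      using component_eqI fg(1,2) xy by metis
  qed
qed

text \<open>One face for a bridge, otherwise at most one on each side of the curve. Finiteness is
  part of the claim because \<open>card\<close> is 0 on infinite sets.\<close>

lemma card_touching:
  assumes e: "e \<in> A" "A \<subseteq> E"
  shows "finite {f \<in> components (- trace A). touches f e} \<and> card {f \<in> components (- trace A). touches f e} \<le> 2"
proof -
  let ?F = "{f \<in> components (- trace A). touches f e}"
  obtain a b where ab: "e = {a, b}"
    using edge_orient e by (metis subsetD)
  have "\<exists>G H. ?F \<subseteq> {G, H}"
  proof (cases "(a, b) \<in> joined (A - {e})")
    case True
    obtain inner outer where io: "\<And>f. f \<in> components (- trace A) \<Longrightarrow> f \<subseteq> inner \<or> f \<subseteq> outer"
      "\<And>S f g. S \<in> {inner, outer} \<Longrightarrow> f \<in> components (- trace A) \<Longrightarrow> g \<in> components (- trace A) \<Longrightarrow>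
         touches f e \<Longrightarrow> touches g e \<Longrightarrow> f \<subseteq> S \<Longrightarrow> g \<subseteq> S \<Longrightarrow> f = g"
      using touching_cycle_edge[OF e ab True] by blast
    have "\<exists>G. \<forall>f\<in>?F. f \<subseteq> S \<longrightarrow> f = G" if "S \<in> {inner, outer}" for S
    proof (cases "\<exists>g\<in>?F. g \<subseteq> S")
      case True
      then obtain g where "g \<in> ?F" "g \<subseteq> S"
        by blast
      then have "\<forall>f\<in>?F. f \<subseteq> S \<longrightarrow> f = g"
        using io(2)[OF that] by simp
      then show ?thesis ..
    qed blast
    from this[of inner] this[of outer] obtain G H
      where GH: "\<forall>f\<in>?F. f \<subseteq> inner \<longrightarrow> f = G" "\<forall>f\<in>?F. f \<subseteq> outer \<longrightarrow> f = H"
      by (elim exE meta_impE) simp_all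
    have "?F \<subseteq> {G, H}"
    proof
      fix f assume f: "f \<in> ?F"
      then have "f \<subseteq> inner \<or> f \<subseteq> outer"
        using io(1) by simp
      then show "f \<in> {G, H}"
        using GH f by blast
    qed
    then show ?thesis by blast
  next
    case False
    have "?F \<subseteq> {G}" if "G \<in> ?F" for G
    proof
      fix f assume "f \<in> ?F"
      then show "f \<in> {G}"
        using touching_bridge[OF e ab False, of f G] that by simp
    qed
    then show ?thesis
      by (cases "?F = {}") blast+
  qed
  then obtain G H where GH: "?F \<subseteq> {G, H}"
    by blast
  then have "card ?F \<le> card {G, H}"
    by (intro card_mono) auto
  also have "\<dots> \<le> 2"
    by (simp add: card_insert_if)
  finally show ?thesis
    using GH finite_subset by auto
qed

end

section \<open>Arcs, forests and the cycle around a face\<close>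

lemma open_not_subset_arc:
  fixes g :: "real \<Rightarrow> 'a::euclidean_space"
  assumes "arc g" "open U" "U \<noteq> {}" "2 \<le> DIM('a)"
  shows "\<not> U \<subseteq> path_image g"
proof
  assume U: "U \<subseteq> path_image g"
  obtain h where h: "homeomorphism {0..1} (path_image g) g h"
    using homeomorphism_arc[OF assms(1)] by blast
  obtain m r where mr: "r > 0" "ball m r \<subseteq> U"
    using assms(2,3) by (meson ex_in_conv open_contains_ball)
  let ?B = "ball m r"
  have inj: "inj_on h ?B"
    using h U mr(2) unfolding homeomorphism_def by (metis inj_on_inverseI inj_on_subset)
  have cont: "continuous_on ?B h"
    using h U mr(2) unfolding homeomorphism_def by (meson continuous_on_subset)
  have "infinite (h ` ?B)"
    using inj uncountable_ball[OF mr(1), of m] countable_finite finite_image_iff by blast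
  then obtain T where T: "T \<subseteq> h ` ?B" "card T = 3"
    using infinite_arbitrarily_large by blast
  then obtain x y z where xyz: "{x, y, z} \<subseteq> h ` ?B" "x \<noteq> y" "y \<noteq> z" "x \<noteq> z"
    by (metis card_3_iff)
  then obtain a b c where abc: "a < b" "b < c" "a \<in> h ` ?B" "b \<in> h ` ?B" "c \<in> h ` ?B"
    by (metis insert_subset linorder_neqE_linordered_idom)
  \<comment> \<open>In dimension at least 2 the ball stays connected without \<open>w\<close>. Its
    image is then a connected set of reals that contains \<open>a\<close> and \<open>c\<close> but
    misses \<open>b\<close> between them.\<close>
  then obtain w where w: "w \<in> ?B" "h w = b"
    by blast
  have "connected (?B - {w})"
    by (rule connected_open_delete) (use assms in auto)
  then have "connected (h ` (?B - {w}))"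
    using continuous_on_subset[OF cont] by (intro connected_continuous_image) auto
  moreover have "h ` (?B - {w}) = h ` ?B - {b}"
    using inj w by (auto simp: inj_on_def)
  moreover have "a \<in> h ` ?B - {b}" "c \<in> h ` ?B - {b}"
    using abc by auto
  ultimately have "{a..c} \<subseteq> h ` ?B - {b}"
    using connected_contains_Icc by metis
  moreover have "b \<in> {a..c}"
    using abc by simp
  ultimately show False
    by blast
qed

text \<open>Acyclicity as "every edge is a bridge", the form in which removing an edge splits the
  rest by \<open>reach\<close>.\<close>

definition forest :: "'v set set \<Rightarrow> bool" where
  "forest A \<longleftrightarrow> (\<forall>u v. {u, v} \<in> A \<longrightarrow> u \<noteq> v \<longrightarrow> (u, v) \<notin> joined (A - {{u, v}}))"

lemma forest_subset:
  assumes "forest A" "B \<subseteq> A"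
  shows "forest B"
  unfolding forest_def
proof (intro allI impI notI)
  fix u v assume "{u, v} \<in> B" "u \<noteq> v" "(u, v) \<in> joined (B - {{u, v}})"
  moreover have "joined (B - {{u, v}}) \<subseteq> joined (A - {{u, v}})"
    using assms(2) by (intro joined_mono) auto
  ultimately show False
    using assms unfolding forest_def by blast
qed

definition cycle_edges :: "'v list \<Rightarrow> 'v set set" where
  "cycle_edges vs = {{vs ! i, vs ! (Suc i mod length vs)} | i. i < length vs}"

text \<open>With two vertices both steps would be the same edge, hence length at least 3.\<close>

definition graph_cycle :: "'v set set \<Rightarrow> 'v list \<Rightarrow> bool" where
  "graph_cycle A vs \<longleftrightarrow> 3 \<le> length vs \<and> distinct vs \<and> cycle_edges vs \<subseteq> A"

lemma rtrancl_distinct_list: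
  assumes "(u, v) \<in> R\<^sup>*"
  obtains xs where "xs \<noteq> []" "hd xs = u" "last xs = v" "distinct xs"
    "successively (\<lambda>x y. (x, y) \<in> R) xs"
  using assms
proof (induction arbitrary: thesis rule: rtrancl_induct)
  case base
  show ?case
    by (rule base[of "[u]"]) auto
next
  case (step w v)
  obtain xs where xs: "xs \<noteq> []" "hd xs = u" "last xs = w" "distinct xs"
    "successively (\<lambda>x y. (x, y) \<in> R) xs"
    using step.IH by blast
  show ?case
  proof (cases "v \<in> set xs")
    case True
    then obtain ys zs where "xs = ys @ v # zs"
      by (meson split_list)
    then show ?thesis
      using xs by (intro step.prems[of "ys @ [v]"])
        (auto simp: successively_append_iff hd_append split: if_splits)
  next
    case False
    then show ?thesis
      using xs step.hyps by (intro step.prems[of "xs @ [v]"])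
        (auto simp: successively_append_iff)
  qed
qed

lemma not_forest_cycle:
  assumes "\<not> forest A"
  obtains vs where "graph_cycle A vs"
proof -
  obtain u v where uv: "{u, v} \<in> A" "u \<noteq> v" "(u, v) \<in> joined (A - {{u, v}})"
    using assms unfolding forest_def by blast
  then obtain xs where xs: "xs \<noteq> []" "hd xs = u" "last xs = v" "distinct xs"
    and succ: "successively (\<lambda>x y. {x, y} \<in> A - {{u, v}}) xs"
    unfolding joined_def by (auto elim: rtrancl_distinct_list)
  have nth: "{xs ! i, xs ! Suc i} \<in> A - {{u, v}}" if "Suc i < length xs" for i
    using succ that by (auto simp: successively_conv_nth)
  have ends: "xs ! 0 = u" "xs ! (length xs - 1) = v"
    using xs by (auto simp: hd_conv_nth last_conv_nth)
  \<comment> \<open>A path with a single step would be the deleted edge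
    \<open>{u, v}\<close>.\<close>
  have "length xs \<noteq> 1" "length xs \<noteq> 2" "length xs \<noteq> 0"
    using ends nth[of 0] uv(2) xs(1) by (auto simp: numeral_2_eq_2)
  then have len: "3 \<le> length xs"
    by linarith
  have "{xs ! i, xs ! (Suc i mod length xs)} \<in> A" if "i < length xs" for i
  proof (cases "Suc i < length xs")
    case False
    then have "i = length xs - 1" "Suc i = length xs"
      using that by auto
    then show ?thesis
      using ends uv(1) by (simp add: insert_commute)
  qed (use nth in auto)
  then have "graph_cycle A xs"
    using len xs(4) by (auto simp: graph_cycle_def cycle_edges_def)
  then show thesis
    by (rule that)
qed

context plane_graph
begin

text \<open>Any edge is a bridge between smaller forests \<open>P\<close> and \<open>Q\<close>. The
  arc meets \<open>P\<close> in at most one point, and the two together meet \<open>Q\<close> in at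
  most one point, so Janiszewski's theorem glues the three connected complements.\<close>

lemma forest_connected_complement:
  assumes "A \<subseteq> E" "forest A"
  shows "connected (- trace A)"
  using finite_subset[OF assms(1) finite_edges] assms
proof (induction A rule: finite_psubset_induct)
  case (psubset A)
  show ?case
  proof (cases "A = {}")
    case False
    then obtain e where e: "e \<in> A" "e \<in> E"
      using psubset.prems by blast
    obtain u v where uv: "e = {u, v}" "u \<noteq> v"
      using edge_orient e by metis
    define D where "D = A - {e}"
    have D: "{u, v} \<in> E" "D \<subseteq> E - {{u, v}}" "D \<subseteq> E" "(u, v) \<notin> joined D"
      using e uv psubset.prems by (auto simp: D_def forest_def)
    define P Q where "P = trace (reach u D)" and "Q = trace (D - reach u D)"
    have sub: "reach u D \<subset> A" "D - reach u D \<subset> A"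
      using e by (auto simp: D_def reach_def)
    have "connected (- P)" "connected (- Q)"
      unfolding P_def Q_def using sub psubset.prems forest_subset
      by (intro psubset.IH; blast)+
    moreover have c: "compact P" "compact Q"
      unfolding P_def Q_def using sub psubset.prems by (intro compact_trace; blast)+
    moreover have arc: "arc (\<gamma> e)"
      using edge_arc e by blast
    have I: "path_image (\<gamma> e) \<inter> P \<subseteq> {pos u}" "path_image (\<gamma> e) \<inter> Q \<subseteq> {pos v}" "P \<inter> Q = {}"
      using edge_Int_reach[OF D(1,2,4)] trace_reach_disjoint[OF D(3)] uv by (auto simp: P_def Q_def)
    have small: "connected S" if "S \<subseteq> {z}" for S and z :: complex
      using that by (metis connected_empty connected_sing subset_singletonD)
    have "connected (- (path_image (\<gamma> e) \<union> P))"
      using calculation connected_arc_complement[OF arc] I(1)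
      by (intro Janiszewski_connected[OF compact_arc_image[OF arc] compact_imp_closed[OF c(1)]])
        (auto intro: small)
    moreover have "connected ((path_image (\<gamma> e) \<union> P) \<inter> Q)"
      using I by (intro small[of _ "pos v"]) blast
    ultimately have "connected (- ((path_image (\<gamma> e) \<union> P) \<union> Q))"
      by (intro Janiszewski_connected[OF compact_Un[OF compact_arc_image[OF arc] c(1)] compact_imp_closed[OF c(2)]])
    moreover have "(path_image (\<gamma> e) \<union> P) \<union> Q = trace A"
      using e by (auto simp: P_def Q_def trace_def D_def reach_def)
    ultimately show ?thesis
      by simp
  qed (simp add: trace_def connected_UNIV)
qed

text \<open>The frontier of \<open>f\<close> consists of points of touching edges and of vertices; a
  vertex may lie on it although none of its edges touches \<open>f\<close>. Deleting the finitely
  many vertices keeps the open complement connected. The result \<open>T\<close> contains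
  \<open>f\<close> and misses its frontier, so it is contained in \<open>f\<close>, and so is
  \<open>g\<close>.\<close>

lemma touched_edges_separate:
  assumes A: "A \<subseteq> E" and f: "f \<in> components (- trace A)" and g: "g \<in> components (- trace A)"
    and conn: "connected (- trace {e \<in> A. touches f e})"
  shows "g = f"
proof -
  let ?B = "{e \<in> A. touches f e}"
  define V where "V = pos ` \<Union>A"
  have "finite (\<Union>A)"
  proof (rule finite_Union)
    show "finite A"
      using A finite_edges finite_subset by blast
    show "finite e" if "e \<in> A" for e
      using edge_card[of e] that A card.infinite by fastforce
  qed
  then have "finite V"
    by (simp add: V_def)
  have V: "V \<subseteq> trace A"
  proof
    fix z assume "z \<in> V"
    then obtain e where e: "e \<in> A" "z \<in> pos ` e"
      by (auto simp: V_def)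
    then have "z \<in> {pathstart (\<gamma> e), pathfinish (\<gamma> e)}"
      using edge_ends A by auto
    then have "z \<in> path_image (\<gamma> e)"
      by auto
    then show "z \<in> trace A"
      using e by (auto simp: trace_def)
  qed
  define T where "T = - trace ?B - V"
  have "connected T"
    unfolding T_def using conn \<open>finite V\<close> A
    by (intro connected_open_delete_finite) (auto intro!: open_Compl closed_trace)
  moreover have "T \<inter> frontier f = {}"
  proof (rule equals0I)
    fix z assume z: "z \<in> T \<inter> frontier f"
    then have "z \<in> trace A" "z \<in> closure f"
      using frontier_of_components_closed_complement[OF closed_trace[OF A] f] by (auto simp: frontier_def)
    then obtain e t where e: "e \<in> A" "0 \<le> t" "t \<le> 1" "z = \<gamma> e t"
      by (auto simp: trace_def path_image_def)
    show False
    proof (cases "t = 0 \<or> t = 1")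
      case True
      then have "z \<in> pos ` e"
        using edge_ends[of e] e A by (auto simp: pathstart_def pathfinish_def)
      then show False
        using z e by (auto simp: T_def V_def)
    next
      case False
      then have "e \<in> ?B"
        using e \<open>z \<in> closure f\<close> by (auto simp: touches_def intro!: exI[of _ t])
      then show False
        using z e by (auto simp: T_def trace_def path_image_def)
    qed
  qed
  moreover have "trace ?B \<subseteq> trace A"
    by (auto simp: trace_def)
  then have "- trace A \<subseteq> T"
    using V by (auto simp: T_def)
  then have fT: "f \<subseteq> T" "g \<subseteq> T"
    using in_components_subset[OF f] in_components_subset[OF g] by blast+
  moreover have ne: "f \<noteq> {}" "g \<noteq> {}"
    using f g in_components_nonempty by auto
  ultimately have "T \<subseteq> f"
    using connected_Int_frontier[of T f] by blast
  then show ?thesis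
    using components_eq[OF f g] fT ne by blast
qed

lemma face_touches_cycle:
  assumes "A \<subseteq> E" "f \<in> components (- trace A)" "g \<in> components (- trace A)" "f \<noteq> g"
  obtains vs where "graph_cycle {e \<in> A. touches f e} vs"
proof -
  have "\<not> forest {e \<in> A. touches f e}"
    using touched_edges_separate[OF assms(1-3)] forest_connected_complement[of "{e \<in> A. touches f e}"] assms
    by auto
  then show thesis
    using that not_forest_cycle by blast
qed

section \<open>Faces under insertion of an edge, and Euler's inequality\<close>

lemma face_refines:
  assumes "insert e A \<subseteq> E" "f \<in> components (- trace A)"
  obtains f' where "f' \<in> components (- trace (insert e A))" "f' \<subseteq> f"
proof -
  have "open f"
    using assms closed_trace[of A] open_components[of "- trace A"] by auto
  moreover have ne: "f \<noteq> {}"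
    using assms in_components_nonempty by blast
  ultimately have "\<not> f \<subseteq> path_image (\<gamma> e)"
    using assms edge_arc[of e] by (intro open_not_subset_arc) auto
  then obtain x where x: "x \<in> f" "x \<notin> path_image (\<gamma> e)"
    by blast
  then have xA: "x \<in> - trace (insert e A)"
    using in_components_subset[OF assms(2)] by (auto simp: trace_def)
  let ?f' = "connected_component_set (- trace (insert e A)) x"
  have "?f' \<subseteq> - trace (insert e A)"
    by (rule connected_component_subset)
  then have "?f' \<subseteq> - trace A"
    by (auto simp: trace_def)
  moreover have "x \<in> ?f'"
    using xA by (simp add: connected_component_refl_eq)
  ultimately have "?f' \<subseteq> f"
    using x by (intro components_maximal[OF assms(2)]) auto
  moreover have "?f' \<in> components (- trace (insert e A))"
    using xA by (rule componentsI)
  ultimately show thesis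
    using that by blast
qed

lemma faces_refine:
  assumes "insert e A \<subseteq> E" "finite P" "P \<subseteq> components (- trace A)"
  obtains Q where "finite Q" "Q \<subseteq> components (- trace (insert e A))" "card Q = card P"
    "\<And>q. q \<in> Q \<Longrightarrow> \<exists>f\<in>P. q \<subseteq> f"
proof -
  have "\<exists>f'. f' \<in> components (- trace (insert e A)) \<and> f' \<subseteq> f" if "f \<in> P" for f
    using face_refines[OF assms(1)] that assms(3) by (metis subsetD)
  then obtain r where r: "\<And>f. f \<in> P \<Longrightarrow> r f \<in> components (- trace (insert e A)) \<and> r f \<subseteq> f"
    by metis
  have "inj_on r P"
  proof (rule inj_onI)
    fix f g assume fg: "f \<in> P" "g \<in> P" "r f = r g"
    then have "r f \<noteq> {}" "r f \<subseteq> f \<inter> g"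
      using r[of f] r[of g] in_components_nonempty[of "r f"] by auto
    then have "f \<inter> g \<noteq> {}"
      by auto
    then show "f = g"
      using components_eq fg assms(3) by (metis subsetD)
  qed
  then show thesis
    using r assms(2) by (intro that[of "r ` P"]) (auto simp: card_image)
qed

text \<open>The face \<open>F\<close> that contains both points of \<open>new_face_pair\<close> is
  replaced by two faces, and every other member of \<open>P\<close> by a face inside it. Since
  \<open>F\<close> may lie outside \<open>P\<close>, at most one member is lost while two are
  gained.\<close>

lemma faces_split:
  assumes "insert e A \<subseteq> E" "e \<notin> A" "e = {u, v}" "(u, v) \<in> joined A"
    and P: "finite P" "P \<subseteq> components (- trace A)"
  obtains Q where "finite Q" "Q \<subseteq> components (- trace (insert e A))" "card P + 1 \<le> card Q"
proof -
  let ?S = "- trace A" and ?T = "- trace (insert e A)"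
  have eA: "e \<in> E" "A \<subseteq> E - {e}"
    using assms(1,2) by auto
  obtain x y where xy: "connected_component ?S x y" "x \<in> ?T" "y \<in> ?T" "\<not> connected_component ?T x y"
    using new_face_pair[OF eA assms(3,4)] by (metis ComplI)
  define F where "F = connected_component_set ?S x"
  have F: "F \<in> components ?S"
    using xy(2) unfolding F_def by (intro componentsI) (auto simp: trace_def)
  define f g where "f = connected_component_set ?T x" and "g = connected_component_set ?T y"
  have fg: "f \<in> components ?T" "g \<in> components ?T"
    using xy componentsI unfolding f_def g_def by metis+
  have mem: "x \<in> f" "y \<in> g" "y \<notin> f" "x \<in> F" "y \<in> F"
    using xy unfolding f_def g_def F_def by (auto simp: connected_component_refl_eq trace_def)
  have PF: "finite (P - {F})" "P - {F} \<subseteq> components ?S"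
    using P by auto
  obtain Q where Q: "finite Q" "Q \<subseteq> components ?T" "card Q = card (P - {F})"
    "\<And>q. q \<in> Q \<Longrightarrow> \<exists>h\<in>P - {F}. q \<subseteq> h"
    using faces_refine[OF assms(1) PF] by metis
  have disj: "q \<inter> F = {}" if q: "q \<in> Q" for q
  proof -
    obtain h where h: "h \<in> P" "h \<noteq> F" "q \<subseteq> h"
      using Q(4)[OF q] by auto
    then have "h \<inter> F = {}"
      using components_nonoverlap[of h ?S F] F P(2) by blast
    then show ?thesis
      using h by blast
  qed
  have "f \<notin> Q" "g \<notin> Q" "f \<noteq> g"
    using disj[of f] disj[of g] mem by auto
  then have "card (insert f (insert g Q)) = card (P - {F}) + 2"
    using Q by simp
  moreover have "card P \<le> card (P - {F}) + 1"
    using P by (cases "F \<in> P") (auto simp: card_Diff_singleton)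
  ultimately show thesis
    using Q fg by (intro that[of "insert f (insert g Q)"]) auto
qed

text \<open>A new edge either closes a cycle and creates a face, or merges two components and loses
  none. The finite set \<open>P\<close> of distinct faces makes the inequality meaningful whether or
  not the set of all faces is known to be finite.\<close>

lemma euler_faces:
  assumes "A \<subseteq> E" "finite V" "\<Union>A \<subseteq> V"
  shows "\<exists>P. finite P \<and> P \<subseteq> components (- trace A) \<and>
    1 + card A + card ((\<lambda>v. joined A `` {v}) ` V) \<le> card P + card V"
  using finite_subset[OF assms(1) finite_edges] assms(1,3)
proof (induction A rule: finite_induct)
  case empty
  have "(\<lambda>v. joined {} `` {v}) ` V = (\<lambda>v. {v}) ` V"
    by (simp add: joined_def)
  then have "card ((\<lambda>v. joined {} `` {v}) ` V) = card V"
    by (simp add: card_image)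
  moreover have "{UNIV} \<subseteq> components (- trace {})"
    by (simp add: trace_def components_def connected_component_UNIV)
  ultimately show ?case
    by (intro exI[of _ "{UNIV}"]) auto
next
  case (insert e A)
  then obtain P where P: "finite P" "P \<subseteq> components (- trace A)"
    "1 + card A + card ((\<lambda>v. joined A `` {v}) ` V) \<le> card P + card V"
    by auto
  obtain u v where uv: "e = {u, v}" "u \<noteq> v"
    using insert.prems edge_orient by (metis insert_subset)
  have uvV: "u \<in> V" "v \<in> V"
    using uv insert.prems by auto
  let ?A = "insert e A"
  let ?c = "\<lambda>A v. joined A `` {v}"
  let ?r = "\<lambda>X. joined ?A `` X"
  \<comment> \<open>Each new class is the saturation of an old one, so \<open>?r\<close> maps the
    old classes onto the new ones.\<close>
  have r: "?r (?c A w) = ?c ?A w" for w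
    using joined_mono[of A ?A] joined_trans joined_refl by fast
  then have img: "?c ?A ` V = ?r ` (?c A ` V)"
    by (simp add: image_image)
  show ?case
  proof (cases "(u, v) \<in> joined A")
    case True
    have "card (?c ?A ` V) \<le> card (?c A ` V)"
      unfolding img using assms(2) by (intro card_image_le) auto
    moreover obtain Q where "finite Q" "Q \<subseteq> components (- trace ?A)" "card P + 1 \<le> card Q"
      using faces_split[OF insert.prems(1) insert.hyps(2) uv(1) True P(1,2)] by metis
    ultimately show ?thesis
      using P(3) insert.hyps by (intro exI[of _ Q]) auto
  next
    case False
    have "(u, v) \<in> joined ?A"
      using uv by (intro joined_edge) auto
    then have "?r (?c A u) = ?r (?c A v)"
      unfolding r using equiv_class_eq[OF equiv_joined] by metis
    moreover have "?c A u \<noteq> ?c A v"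
      using False joined_refl[of v A] by blast
    ultimately have "\<not> inj_on ?r (?c A ` V)"
      using uvV by (meson imageI inj_onD)
    then have "card (?c ?A ` V) \<noteq> card (?c A ` V)"
      unfolding img using assms(2) eq_card_imp_inj_on by blast
    moreover have "card (?c ?A ` V) \<le> card (?c A ` V)"
      unfolding img using assms(2) by (intro card_image_le) auto
    moreover obtain Q where "finite Q" "Q \<subseteq> components (- trace ?A)" "card Q = card P"
      using faces_refine[OF insert.prems(1) P(1,2)] by metis
    ultimately show ?thesis
      using P(3) insert.hyps by (intro exI[of _ Q]) auto
  qed
qed

text \<open>Double counting of pairs of a face and an edge touching it: a face collects at least
  \<open>g\<close>, since its edges contain a cycle, and an edge pays its weight at most
  twice.\<close>

theorem euler_weights:
  fixes wt :: "'v set \<Rightarrow> nat"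
  assumes A: "A \<subseteq> E" and V: "finite V" "\<Union>A \<subseteq> V" "V \<noteq> {}" "card V \<le> card A"
    and g: "\<And>vs. graph_cycle A vs \<Longrightarrow> g \<le> sum wt (cycle_edges vs)"
  shows "g * (card A + 2) \<le> 2 * sum wt A + g * card V"
proof -
  obtain P where P: "finite P" "P \<subseteq> components (- trace A)"
    "1 + card A + card ((\<lambda>v. joined A `` {v}) ` V) \<le> card P + card V"
    using euler_faces[OF A V(1,2)] by blast
  moreover have "card ((\<lambda>v. joined A `` {v}) ` V) \<noteq> 0"
    using V by simp
  ultimately have F: "card A + 2 \<le> card P + card V"
    by linarith
  have finA: "finite A"
    using A finite_edges finite_subset by blast
  have face: "g \<le> (\<Sum>e\<in>A. if touches f e then wt e else 0)" if f: "f \<in> P" for f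
  proof -
    \<comment> \<open>\<open>card V \<le> card A\<close> yields two faces at least. A second face is
      what forces a cycle among the edges touching \<open>f\<close>.\<close>
    have "card P \<noteq> 1"
      using F V by linarith
    then have "P \<noteq> {f}"
      by auto
    then obtain h where "h \<in> P" "h \<noteq> f"
      using f by blast
    then obtain vs where vs: "graph_cycle {e \<in> A. touches f e} vs"
      using face_touches_cycle[OF A, of f h] f P by blast
    then have sub: "cycle_edges vs \<subseteq> {e \<in> A. touches f e}"
      by (simp add: graph_cycle_def)
    then have "graph_cycle A vs"
      using vs by (auto simp: graph_cycle_def)
    then have "g \<le> sum wt (cycle_edges vs)"
      by (rule g)
    also have "\<dots> \<le> sum wt {e \<in> A. touches f e}"
      using sub finA by (intro sum_mono2) auto
    also have "\<dots> = (\<Sum>e\<in>A. if touches f e then wt e else 0)"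
      using finA by (simp add: sum.inter_filter)
    finally show ?thesis .
  qed
  have edge: "(\<Sum>f\<in>P. if touches f e then wt e else 0) \<le> 2 * wt e" if e: "e \<in> A" for e
  proof -
    have "(\<Sum>f\<in>P. if touches f e then wt e else 0) = card {f \<in> P. touches f e} * wt e"
      using P(1) by (simp flip: sum.inter_filter)
    moreover have "card {f \<in> P. touches f e} \<le> card {f \<in> components (- trace A). touches f e}"
      using card_touching[OF e A] P by (intro card_mono) auto
    ultimately show ?thesis
      using card_touching[OF e A] by (simp add: order_trans[OF mult_le_mono1])
  qed
  have "g * card P = (\<Sum>f\<in>P. g)"
    by simp
  also have "\<dots> \<le> (\<Sum>f\<in>P. \<Sum>e\<in>A. if touches f e then wt e else 0)"
    by (intro sum_mono face)
  also have "\<dots> = (\<Sum>e\<in>A. \<Sum>f\<in>P. if touches f e then wt e else 0)"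
    by (rule sum.swap)
  also have "\<dots> \<le> (\<Sum>e\<in>A. 2 * wt e)"
    by (intro sum_mono edge)
  finally have "g * card P \<le> 2 * sum wt A"
    by (simp add: sum_distrib_left)
  moreover have "g * (card A + 2) \<le> g * card P + g * card V"
    using mult_le_mono2[OF F, of g] by (simp add: algebra_simps)
  ultimately show ?thesis
    by linarith
qed

end

section \<open>Subdivisions of \<open>K\<^sub>3\<^sub>,\<^sub>3\<close>\<close>

lemma plane_drawing_imp_plane_graph:
  assumes "plane_drawing G pos \<gamma>" "finite (proper_edges G)" "\<Union>(proper_edges G) \<subseteq> fst G"
  shows "plane_graph (fst G) (proper_edges G) pos \<gamma>"
proof
  show "card e = 2" if "e \<in> proper_edges G" for e
    using that by (simp add: proper_edges_def)
qed (use assms in \<open>auto simp: plane_drawing_def\<close>)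

lemma card_cycle_edges:
  assumes "3 \<le> length vs" "distinct vs"
  shows "card (cycle_edges vs) = length vs"
proof -
  let ?n = "length vs"
  have "inj_on (\<lambda>i. {vs ! i, vs ! (Suc i mod ?n)}) {..<?n}"
  proof (rule inj_onI)
    fix i j assume ij: "i \<in> {..<?n}" "j \<in> {..<?n}"
      "{vs ! i, vs ! (Suc i mod ?n)} = {vs ! j, vs ! (Suc j mod ?n)}"
    have "Suc i mod ?n < ?n" "Suc j mod ?n < ?n"
      using assms(1) by (auto intro!: mod_less_divisor)
    \<comment> \<open>The second alternative means that the length divides 2, which length at least
      3 excludes.\<close>
    then have "i = j \<or> (i = Suc j mod ?n \<and> Suc i mod ?n = j)"
      using ij assms by (auto simp: doubleton_eq_iff nth_eq_iff_index_eq)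
    then show "i = j"
      using ij assms(1) by (auto simp: mod_Suc split: if_splits)
  qed
  then have "card ((\<lambda>i. {vs ! i, vs ! (Suc i mod ?n)}) ` {..<?n}) = ?n"
    by (simp add: card_image)
  moreover have "cycle_edges vs = (\<lambda>i. {vs ! i, vs ! (Suc i mod ?n)}) ` {..<?n}"
    by (auto simp: cycle_edges_def)
  ultimately show ?thesis
    by simp
qed

definition path_edges :: "'v list \<Rightarrow> 'v set set" where
  "path_edges xs = {{xs ! i, xs ! Suc i} | i. Suc i < length xs}"

lemma path_edges_joined:
  assumes "xs \<noteq> []"
  shows "(hd xs, last xs) \<in> joined (path_edges xs)"
proof -
  have "i < length xs \<Longrightarrow> (hd xs, xs ! i) \<in> joined (path_edges xs)" for i
  proof (induction i)
    case 0
    then show ?case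
      by (simp add: hd_conv_nth joined_refl)
  next
    case (Suc i)
    then have "(xs ! i, xs ! Suc i) \<in> joined (path_edges xs)"
      by (intro joined_edge) (auto simp: path_edges_def)
    then show ?case
      using Suc joined_trans by (metis Suc_lessD)
  qed
  then show ?thesis
    using assms by (simp add: last_conv_nth)
qed

definition K33_edges :: "nat set set" where
  "K33_edges = {{i, 3 + j} | i j. i < 3 \<and> j < 3}"

lemma K33_edges_eq: "K33_edges = (\<lambda>(i, j). {i, 3 + j}) ` ({..<3} \<times> {..<3})"
  by (auto simp: K33_edges_def)

lemma card_K33_edges: "card K33_edges = 9"
proof -
  have "inj_on (\<lambda>(i, j). {i, 3 + j}) ({..<3} \<times> {..<3::nat})"
    by (auto simp: inj_on_def doubleton_eq_iff)
  then show ?thesis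
    by (simp add: K33_edges_eq card_image)
qed

text \<open>The graph is bipartite, so its cycles have length at least 4. With unit weights Euler's
  inequality reads 4 * (9 + 2) \<le> 2 * 9 + 4 * 6, that is 44 \<le> 42.\<close>

lemma K33_not_plane: "\<not> plane_graph {..<6} K33_edges pos \<gamma>"
proof
  assume "plane_graph {..<6} K33_edges pos \<gamma>"
  then interpret plane_graph "{..<6}" K33_edges pos \<gamma> .
  have "(4::nat) \<le> sum (\<lambda>_. 1) (cycle_edges vs)" if "graph_cycle K33_edges vs" for vs
  proof -
    have vs: "3 \<le> length vs" "distinct vs" "cycle_edges vs \<subseteq> K33_edges"
      using that by (auto simp: graph_cycle_def)
    have side: "u < 3 \<longleftrightarrow> \<not> v < 3" if "{u, v} \<in> K33_edges" for u v :: nat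
      using that by (auto simp: K33_edges_def doubleton_eq_iff)
    have "length vs \<noteq> 3"
    proof
      assume 3: "length vs = 3"
      have edge: "{vs ! i, vs ! ((i + 1) mod 3)} \<in> K33_edges" if "i < 3" for i
        using vs(3) that 3 by (auto simp: cycle_edges_def)
      have "{vs ! 0, vs ! 1} \<in> K33_edges"
        using edge[of 0] by simp
      moreover have "{vs ! 1, vs ! 2} \<in> K33_edges"
        using edge[of 1] by (simp add: one_add_one del: One_nat_def)
      moreover have "{vs ! 2, vs ! 0} \<in> K33_edges"
        using edge[of 2] by simp
      ultimately show False
        using side by blast
    qed
    then show ?thesis
      using card_cycle_edges[OF vs(1,2)] vs(1) by simp
  qed
  moreover have "\<Union>K33_edges \<subseteq> {..<6}"
    by (auto simp: K33_edges_def)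
  ultimately have "4 * (card K33_edges + 2) \<le> 2 * sum (\<lambda>_. 1) K33_edges + 4 * card {..<6::nat}"
    by (intro euler_weights) (auto simp: card_K33_edges lessThan_empty_iff)
  then show False
    by (simp add: card_K33_edges)
qed

text \<open>The trace of each path contains an arc between its two branch vertices, and these nine
  arcs draw \<open>K33_edges\<close>.\<close>

lemma (in plane_graph) no_K33_subdivision:
  fixes b :: "nat \<Rightarrow> 'v"
  assumes b: "inj_on b {..<6}" "b ` {..<6} \<subseteq> W"
    and path: "\<And>i j. i < 3 \<Longrightarrow> j < 3 \<Longrightarrow>
       P i j \<noteq> [] \<and> hd (P i j) = b i \<and> last (P i j) = b (3 + j) \<and> path_edges (P i j) \<subseteq> E"
    and meet: "\<And>i j k l. i < 3 \<Longrightarrow> j < 3 \<Longrightarrow> k < 3 \<Longrightarrow> l < 3 \<Longrightarrow> (i, j) \<noteq> (k, l) \<Longrightarrow>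
       set (P i j) \<inter> set (P k l) \<subseteq> b ` ({i, 3 + j} \<inter> {k, 3 + l})"
  shows False
proof -
  have "\<exists>\<delta>. arc \<delta> \<and> path_image \<delta> \<subseteq> trace (path_edges (P i j)) \<and>
      pathstart \<delta> = pos (b i) \<and> pathfinish \<delta> = pos (b (3 + j))" if ij: "i < 3" "j < 3" for i j
  proof -
    have "b i \<noteq> b (3 + j)"
      using b(1) ij by (auto simp: inj_on_eq_iff)
    moreover have "(b i, b (3 + j)) \<in> joined (path_edges (P i j))"
      using path_edges_joined[of "P i j"] path[OF ij] by auto
    ultimately show ?thesis
      using joined_arc[of "b i" "b (3 + j)" "path_edges (P i j)"] path[OF ij] by metis
  qed
  then obtain \<delta> where \<delta>: "\<And>i j. i < 3 \<Longrightarrow> j < 3 \<Longrightarrow> arc (\<delta> i j) \<and>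
      path_image (\<delta> i j) \<subseteq> trace (path_edges (P i j)) \<and>
      pathstart (\<delta> i j) = pos (b i) \<and> pathfinish (\<delta> i j) = pos (b (3 + j))"
    by metis
  \<comment> \<open>Edges are unordered sets; the smaller element is the index \<open>i\<close>, the
    larger one is \<open>3 + j\<close>.\<close>
  define \<gamma>' where "\<gamma>' e = \<delta> (Min e) (Max e - 3)" for e :: "nat set"
  have \<gamma>': "\<gamma>' {i, 3 + j} = \<delta> i j" if "i < 3" "j < 3" for i j
  proof -
    have "Min {i, 3 + j} = i" "Max {i, 3 + j} = 3 + j"
      using that by auto
    then show ?thesis
      by (simp add: \<gamma>'_def)
  qed
  have meet': "path_image (\<delta> i j) \<inter> path_image (\<delta> k l) \<subseteq> (pos \<circ> b) ` ({i, 3 + j} \<inter> {k, 3 + l})"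
    if ij: "i < 3" "j < 3" "k < 3" "l < 3" "(i, j) \<noteq> (k, l)" for i j k l
  proof
    fix z assume z: "z \<in> path_image (\<delta> i j) \<inter> path_image (\<delta> k l)"
    let ?A = "path_edges (P i j)" and ?B = "path_edges (P k l)"
    have AB: "?A \<subseteq> E" "?B \<subseteq> E"
      using path ij by auto
    have setA: "e \<subseteq> set (P i j)" if "e \<in> ?A" for e
      using that by (auto simp: path_edges_def)
    have setB: "e \<subseteq> set (P k l)" if "e \<in> ?B" for e
      using that by (auto simp: path_edges_def)
    \<comment> \<open>An edge common to both paths would have two vertices among the shared branch
      vertices, and there is at most one of these.\<close>
    have "?A \<inter> ?B = {}"
    proof (rule equals0I)
      fix e assume e: "e \<in> ?A \<inter> ?B"
      then have "e \<subseteq> b ` ({i, 3 + j} \<inter> {k, 3 + l})"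
        using setA[of e] setB[of e] meet[OF ij] by blast
      then have "card e \<le> card ({i, 3 + j} \<inter> {k, 3 + l})"
        by (meson card_image_le card_mono finite_Int finite_imageI finite.intros order_trans)
      also have "\<dots> \<le> 1"
        using ij by (auto simp: card_insert_if Int_insert_left)
      finally show False
        using edge_card[of e] e AB by auto
    qed
    moreover have "z \<in> trace ?A" "z \<in> trace ?B"
      using z \<delta> ij by blast+
    ultimately obtain w e e' where w: "e \<in> ?A" "e' \<in> ?B" "w \<in> e" "w \<in> e'" "z = pos w"
      using trace_Int[OF AB] by metis
    then have "w \<in> b ` ({i, 3 + j} \<inter> {k, 3 + l})"
      using setA setB meet[OF ij] by blast
    then show "z \<in> (pos \<circ> b) ` ({i, 3 + j} \<inter> {k, 3 + l})"
      using w(5) by auto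
  qed
  have "plane_graph {..<6} K33_edges (pos \<circ> b) \<gamma>'"
  proof
    show "inj_on (pos \<circ> b) {..<6}"
      using b inj_pos by (intro comp_inj_on) (auto intro: inj_on_subset)
    show "finite K33_edges"
      by (simp add: K33_edges_eq)
    fix e assume "e \<in> K33_edges"
    then obtain i j where ij: "e = {i, 3 + j}" "i < 3" "j < 3"
      by (auto simp: K33_edges_def)
    show "e \<subseteq> {..<6}" "card e = 2"
      using ij by auto
    show "arc (\<gamma>' e)" "{pathstart (\<gamma>' e), pathfinish (\<gamma>' e)} = (pos \<circ> b) ` e"
      using \<delta>[OF ij(2,3)] \<gamma>'[OF ij(2,3)] ij(1) by auto
    fix e' assume "e' \<in> K33_edges" "e \<noteq> e'"
    then obtain k l where kl: "e' = {k, 3 + l}" "k < 3" "l < 3" "(i, j) \<noteq> (k, l)"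
      using ij(1) by (auto simp: K33_edges_def)
    show "path_image (\<gamma>' e) \<inter> path_image (\<gamma>' e') \<subseteq> (pos \<circ> b) ` (e \<inter> e')"
      using meet'[OF ij(2,3) kl(2,3,4)] \<gamma>'[OF ij(2,3)] \<gamma>'[OF kl(2,3)] ij(1) kl(1) by simp
  qed
  then show False
    using K33_not_plane by blast
qed

text \<open>\<open>ps\<close> holds the inner vertices of the nine paths row by row; an empty list
  stands for a direct edge. A single distinctness test covers the branch vertices, each path, and
  the disjointness of the paths.\<close>

definition K33_subdivision :: "('v \<Rightarrow> 'v \<Rightarrow> bool) \<Rightarrow> 'v list \<Rightarrow> 'v list list \<Rightarrow> bool" where
  "K33_subdivision adj bs ps \<longleftrightarrow> length bs = 6 \<and> length ps = 9 \<and> distinct (bs @ concat ps) \<and>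
     (\<forall>i\<in>{0, 1, 2}. \<forall>j\<in>{0, 1, 2}. successively adj (bs ! i # ps ! (3 * i + j) @ [bs ! (3 + j)]))"

lemma distinct_concat_nth:
  assumes "distinct (concat xss)" "m < length xss"
  shows "distinct (xss ! m)"
  using assms by (simp add: distinct_concat_iff)

text \<open>Positions are compared instead of values, because several of the lists may be empty and
  hence equal.\<close>

lemma distinct_concat_nth_disjoint:
  assumes "distinct (concat xss)" "m < length xss" "n < length xss" "m \<noteq> n"
  shows "set (xss ! m) \<inter> set (xss ! n) = {}"
  using assms
proof (induction xss arbitrary: m n)
  case (Cons xs xss)
  have *: "set xs \<inter> set (xss ! k) = {}" if "k < length xss" for k
    using Cons.prems(1) nth_mem[OF that] by fastforce
  show ?case
    using Cons.prems Cons.IH * by (cases m; cases n) (auto simp: Int_commute)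
qed simp

lemma (in plane_graph) not_K33_subdivision:
  assumes K: "K33_subdivision adj bs ps"
    and adj: "\<And>v w. v \<in> W \<Longrightarrow> adj v w \<Longrightarrow> v \<noteq> w \<Longrightarrow> {v, w} \<in> E"
    and W: "set bs \<subseteq> W"
  shows False
proof -
  have len: "length bs = 6" "length ps = 9" and dist: "distinct bs" "distinct (concat ps)"
    "set bs \<inter> set (concat ps) = {}"
    using K by (auto simp: K33_subdivision_def)
  define P where "P i j = bs ! i # ps ! (3 * i + j) @ [bs ! (3 + j)]" for i j
  have cert: "\<forall>i\<in>{0, 1, 2}. \<forall>j\<in>{0, 1, 2}. successively adj (P i j)"
    using K unfolding K33_subdivision_def P_def by (elim conjE)
  have succ: "successively adj (P i j)" if "i < 3" "j < 3" for i j
  proof -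
    have "i \<in> {0, 1, 2}" "j \<in> {0, 1, 2}"
      using that by auto
    then show ?thesis
      using cert by blast
  qed
  have setP: "set (P i j) = {bs ! i, bs ! (3 + j)} \<union> set (ps ! (3 * i + j))" for i j
    by (auto simp: P_def)
  have inner: "set (ps ! m) \<inter> set bs = {}" if "m < 9" for m
  proof -
    have "set (ps ! m) \<subseteq> set (concat ps)"
      using that len by (auto intro!: bexI[of _ "ps ! m"])
    then show ?thesis
      using dist(3) by blast
  qed
  have bs: "bs ! i \<in> set bs" if "i < 6" for i
    using that len by simp
  have inj: "inj_on ((!) bs) {..<6}"
    using dist(1) len by (auto simp: inj_on_def nth_eq_iff_index_eq)
  have distP: "distinct (P i j)" if "i < 3" "j < 3" for i j
  proof -
    have "3 * i + j < 9"
      using that by linarith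
    then have "distinct (ps ! (3 * i + j))" "set (ps ! (3 * i + j)) \<inter> set bs = {}"
      using distinct_concat_nth[OF dist(2)] inner len by auto
    moreover have "bs ! i \<noteq> bs ! (3 + j)"
      using inj that by (auto simp: inj_on_eq_iff)
    ultimately show ?thesis
      using bs[of i] bs[of "3 + j"] that by (auto simp: P_def)
  qed
  have step: "{P i j ! n, P i j ! Suc n} \<in> E"
    if "i < 3" "j < 3" "Suc n < length (P i j)" "P i j ! n \<in> W" for i j n
    using adj[OF that(4)] succ[OF that(1,2)] distP[OF that(1,2)] that(3)
    by (simp add: successively_conv_nth nth_eq_iff_index_eq)
  \<comment> \<open>Membership in \<open>W\<close> spreads along the path, since an edge leaving a
    vertex of \<open>W\<close> ends in \<open>W\<close>. Therefore only the branch vertices have to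
    be checked.\<close>
  have sub: "n < length (P i j) \<Longrightarrow> P i j ! n \<in> W" if "i < 3" "j < 3" for i j n
  proof (induction n)
    case 0
    have "bs ! i \<in> W"
      using W bs[of i] that by auto
    then show ?case
      by (simp add: P_def)
  next
    case (Suc n)
    then show ?case
      using step[OF that, of n] edge_sub by fastforce
  qed
  show False
  proof (rule no_K33_subdivision[of "\<lambda>i. bs ! i" P])
    show "inj_on ((!) bs) {..<6}"
      by (rule inj)
    show "(!) bs ` {..<6} \<subseteq> W"
      using W bs by auto
    fix i j :: nat assume ij: "i < 3" "j < 3"
    have "path_edges (P i j) \<subseteq> E"
      using step[OF ij] sub[OF ij] by (auto simp: path_edges_def)
    then show "P i j \<noteq> [] \<and> hd (P i j) = bs ! i \<and> last (P i j) = bs ! (3 + j) \<and> path_edges (P i j) \<subseteq> E"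
      by (simp add: P_def)
    fix k l :: nat assume kl: "k < 3" "l < 3" "(i, j) \<noteq> (k, l)"
    have m: "3 * i + j < 9" "3 * k + l < 9" "3 * i + j \<noteq> 3 * k + l"
      using ij kl by (auto; presburger)+
    have "set (ps ! (3 * i + j)) \<inter> set (ps ! (3 * k + l)) = {}"
      using distinct_concat_nth_disjoint[OF dist(2)] m len by simp
    moreover have "{bs ! i, bs ! (3 + j), bs ! k, bs ! (3 + l)} \<subseteq> set bs"
      using bs ij kl by simp
    ultimately have "set (P i j) \<inter> set (P k l) \<subseteq> {bs ! i, bs ! (3 + j)} \<inter> {bs ! k, bs ! (3 + l)}"
      unfolding setP using inner[OF m(1)] inner[OF m(2)] by blast
    also have "\<dots> = (!) bs ` {i, 3 + j} \<inter> (!) bs ` {k, 3 + l}"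
      by simp
    also have "\<dots> = (!) bs ` ({i, 3 + j} \<inter> {k, 3 + l})"
      using ij kl by (intro inj_on_image_Int[OF inj, symmetric]) auto
    finally show "set (P i j) \<inter> set (P k l) \<subseteq> (!) bs ` ({i, 3 + j} \<inter> {k, 3 + l})" .
  qed
qed

section \<open>Straight-line drawings\<close>

type_synonym point = "int \<times> int"

definition cpoint :: "point \<Rightarrow> complex" where
  "cpoint a = Complex (of_int (fst a)) (of_int (snd a))"

definition orient :: "point \<Rightarrow> point \<Rightarrow> point \<Rightarrow> int" where
  "orient a b c = (fst b - fst a) * (snd c - snd a) - (snd b - snd a) * (fst c - fst a)"

text \<open>The extension of \<open>orient a b\<close> to all points of the plane. It is affine, so
  its sign is constant on a segment whose ends agree in sign.\<close>

definition side :: "point \<Rightarrow> point \<Rightarrow> complex \<Rightarrow> real" where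
  "side a b z = of_int (fst b - fst a) * (Im z - of_int (snd a)) - of_int (snd b - snd a) * (Re z - of_int (fst a))"

lemma side_cpoint: "side a b (cpoint c) = of_int (orient a b c)"
  by (simp add: side_def cpoint_def orient_def)

lemma side_affine: "side a b ((1 - t) *\<^sub>R z + t *\<^sub>R w) = (1 - t) * side a b z + t * side a b w"
  by (simp add: side_def algebra_simps)

lemma side_segment_pos:
  assumes "0 < side a b z" "0 < side a b w" "u \<in> closed_segment z w"
  shows "0 < side a b u"
proof -
  obtain t where t: "0 \<le> t" "t \<le> 1" "u = (1 - t) *\<^sub>R z + t *\<^sub>R w"
    using assms(3) by (auto simp: closed_segment_def)
  have "0 < (1 - t) * side a b z + t * side a b w"
    using assms(1,2) t(1,2) by (cases "t = 0") (auto intro!: add_nonneg_pos)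
  then show ?thesis
    unfolding t(3) side_affine .
qed

lemma side_segment_neg:
  assumes "side a b z < 0" "side a b w < 0" "u \<in> closed_segment z w"
  shows "side a b u < 0"
proof -
  have rev: "side b a v = - side a b v" for v
    by (simp add: side_def algebra_simps)
  show ?thesis
    using side_segment_pos[of b a z w u] assms by (simp add: rev)
qed

lemma side_segment_zero:
  assumes "u \<in> closed_segment (cpoint a) (cpoint b)"
  shows "side a b u = 0"
proof -
  obtain t where "u = (1 - t) *\<^sub>R cpoint a + t *\<^sub>R cpoint b"
    using assms by (auto simp: closed_segment_def)
  then show ?thesis
    by (simp add: side_affine side_cpoint) (simp add: orient_def)
qed

definition apart :: "point \<Rightarrow> point \<Rightarrow> point \<Rightarrow> point \<Rightarrow> bool" where
  "apart a b c d \<longleftrightarrow> 0 < orient a b c \<and> 0 < orient a b d \<or> orient a b c < 0 \<and> orient a b d < 0"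

lemma apart_disjoint:
  assumes "apart a b c d"
  shows "closed_segment (cpoint a) (cpoint b) \<inter> closed_segment (cpoint c) (cpoint d) = {}"
proof (rule equals0I)
  fix u assume u: "u \<in> closed_segment (cpoint a) (cpoint b) \<inter> closed_segment (cpoint c) (cpoint d)"
  then have "side a b u = 0"
    using side_segment_zero by blast
  moreover have "side a b u \<noteq> 0"
    using side_segment_pos[of a b "cpoint c" "cpoint d" u] side_segment_neg[of a b "cpoint c" "cpoint d" u]
      assms u by (auto simp: apart_def side_cpoint)
  ultimately show False
    by blast
qed

text \<open>Along the second segment \<open>side a b\<close> equals \<open>t * orient a b c\<close>,
  which vanishes only at the common end.\<close>

lemma hinge_meet:
  assumes "orient a b c \<noteq> 0"
  shows "closed_segment (cpoint a) (cpoint b) \<inter> closed_segment (cpoint a) (cpoint c) \<subseteq> {cpoint a}"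
proof
  fix u assume u: "u \<in> closed_segment (cpoint a) (cpoint b) \<inter> closed_segment (cpoint a) (cpoint c)"
  then obtain t where t: "u = (1 - t) *\<^sub>R cpoint a + t *\<^sub>R cpoint c"
    by (auto simp: closed_segment_def)
  have "side a b u = 0"
    using u side_segment_zero by blast
  moreover have "side a b (cpoint a) = 0"
    by (simp add: side_cpoint orient_def)
  ultimately have "t * of_int (orient a b c) = 0"
    unfolding t side_affine by (simp add: side_cpoint)
  then have "t = 0"
    using assms by simp
  then show "u \<in> {cpoint a}"
    using t by simp
qed

text \<open>In general position, segments without a common end are disjoint exactly if one of them
  lies on one side of the line through the other; which of the two does so varies, hence both
  tests.\<close>

fun no_crossing :: "point \<times> point \<Rightarrow> point \<times> point \<Rightarrow> bool" where
  "no_crossing (a, b) (c, d) \<longleftrightarrow>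
     (if a = c then orient a b d \<noteq> 0 else if a = d then orient a b c \<noteq> 0
      else if b = c then orient b a d \<noteq> 0 else if b = d then orient b a c \<noteq> 0
      else apart a b c d \<or> apart c d a b)"

lemma no_crossing_meet:
  assumes "no_crossing (a, b) (c, d)"
  shows "closed_segment (cpoint a) (cpoint b) \<inter> closed_segment (cpoint c) (cpoint d)
    \<subseteq> cpoint ` ({a, b} \<inter> {c, d})"
proof -
  consider "a = c" "orient a b d \<noteq> 0" | "a = d" "orient a b c \<noteq> 0" | "b = c" "orient b a d \<noteq> 0"
    | "b = d" "orient b a c \<noteq> 0" | "apart a b c d" | "apart c d a b"
    using assms by (auto split: if_splits)
  then show ?thesis
  proof cases
    case 1
    then show ?thesis
      using hinge_meet[of a b d] by auto
  next
    case 2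
    then show ?thesis
      using hinge_meet[of a b c] by (auto simp: closed_segment_commute)
  next
    case 3
    then show ?thesis
      using hinge_meet[of b a d] by (auto simp: closed_segment_commute)
  next
    case 4
    then show ?thesis
      using hinge_meet[of b a c] by (auto simp: closed_segment_commute)
  next
    case 5
    then show ?thesis
      using apart_disjoint by blast
  next
    case 6
    then show ?thesis
      using apart_disjoint[of c d a b] by blast
  qed
qed

lemma inj_cpoint: "inj cpoint"
  by (auto simp: inj_def cpoint_def prod_eq_iff)

text \<open>Isolated vertices are excluded; this makes every vertex avoid the segments not incident
  with it, because it is an end of some other segment.\<close>

theorem straight_line_drawing:
  fixes f :: "'v \<Rightarrow> point"
  assumes inj: "inj_on f (fst G)"
    and edges: "proper_edges G \<subseteq> (\<lambda>(u, v). {u, v}) ` set es"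
    and wf: "\<Union>(proper_edges G) \<subseteq> fst G" "fst G \<subseteq> \<Union>(proper_edges G)"
    and cross: "sorted_wrt no_crossing (map (map_prod f f) es)"
  shows "planar G"
proof -
  \<comment> \<open>Picks a direction for each edge, one that occurs in the list
    \<open>es\<close>.\<close>
  define s where "s e = (SOME uv. uv \<in> set es \<and> e = {fst uv, snd uv})" for e :: "'v set"
  have s: "s e \<in> set es" "e = {fst (s e), snd (s e)}" if "e \<in> proper_edges G" for e
  proof -
    have "\<exists>uv. uv \<in> set es \<and> e = {fst uv, snd uv}"
      using edges that by (force simp: case_prod_beta)
    from someI_ex[OF this] show "s e \<in> set es" "e = {fst (s e), snd (s e)}"
      unfolding s_def by blast+
  qed
  define pos where "pos v = cpoint (f v)" for v
  define \<gamma> where "\<gamma> e = linepath (pos (fst (s e))) (pos (snd (s e)))" for e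
  have inj_pos: "inj_on pos (fst G)"
    using inj inj_cpoint unfolding pos_def inj_on_def inj_def by blast
  have ends: "fst (s e) \<in> fst G" "snd (s e) \<in> fst G" "fst (s e) \<noteq> snd (s e)" if "e \<in> proper_edges G" for e
  proof -
    have "card e = 2"
      using that by (simp add: proper_edges_def)
    then show "fst (s e) \<noteq> snd (s e)"
      using s(2)[OF that] by (metis card_1_singleton_iff insert_absorb2 numeral_eq_one_iff semiring_norm(85) One_nat_def is_singletonI is_singleton_altdef)
    show "fst (s e) \<in> fst G" "snd (s e) \<in> fst G"
      using wf(1) that s(2)[OF that] by blast+
  qed
  have img: "path_image (\<gamma> e) = closed_segment (pos (fst (s e))) (pos (snd (s e)))" for e
    by (simp add: \<gamma>_def)
  have meet: "path_image (\<gamma> e) \<inter> path_image (\<gamma> e') \<subseteq> pos ` (e \<inter> e')"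
    if e: "e \<in> proper_edges G" "e' \<in> proper_edges G" "e \<noteq> e'" for e e'
  proof -
    have "s e \<noteq> s e'"
      using s(2)[OF e(1)] s(2)[OF e(2)] e(3) by metis
    then obtain m n where mn: "m < length es" "n < length es" "m \<noteq> n" "es ! m = s e" "es ! n = s e'"
      using s(1) e by (metis in_set_conv_nth)
    \<comment> \<open>Each pair of listed edges is tested in one order only, so both orders of the
      positions must be treated below.\<close>
    have nc: "no_crossing (map_prod f f (es ! i)) (map_prod f f (es ! j))" if "i < j" "j < length es" for i j
      using cross that by (simp add: sorted_wrt_iff_nth_less)
    have "path_image (\<gamma> e) \<inter> path_image (\<gamma> e') \<subseteq> cpoint ` (f ` e \<inter> f ` e')"
    proof (cases "m < n")
      case True
      have "no_crossing (f (fst (s e)), f (snd (s e))) (f (fst (s e')), f (snd (s e')))"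
        using nc[OF True mn(2)] mn(4,5) by (simp add: map_prod_def case_prod_beta)
      from no_crossing_meet[OF this] show ?thesis
        using s(2)[OF e(1)] s(2)[OF e(2)] unfolding img pos_def by (metis image_insert image_empty)
    next
      case False
      then have "n < m"
        using mn by simp
      have "no_crossing (f (fst (s e')), f (snd (s e'))) (f (fst (s e)), f (snd (s e)))"
        using nc[OF \<open>n < m\<close> mn(1)] mn(4,5) by (simp add: map_prod_def case_prod_beta)
      from no_crossing_meet[OF this] show ?thesis
        using s(2)[OF e(1)] s(2)[OF e(2)] unfolding img pos_def by (metis image_insert image_empty inf_commute)
    qed
    also have "f ` e \<inter> f ` e' = f ` (e \<inter> e')"
      using wf(1) e by (intro inj_on_image_Int[OF inj, symmetric]) auto
    finally show ?thesis
      by (simp add: pos_def image_image)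
  qed
  have "plane_drawing G pos \<gamma>"
    unfolding plane_drawing_def
  proof (intro conjI ballI impI)
    show "inj_on pos (fst G)"
      by (rule inj_pos)
    fix e assume e: "e \<in> proper_edges G"
    have "pos (fst (s e)) \<noteq> pos (snd (s e))"
      using ends[OF e] inj_pos by (meson inj_onD)
    then show "arc (\<gamma> e)"
      by (simp add: \<gamma>_def arc_linepath)
    have pe: "pos ` e = {pos (fst (s e)), pos (snd (s e))}"
      using s(2)[OF e] by (metis image_insert image_empty)
    then show "{pathstart (\<gamma> e), pathfinish (\<gamma> e)} = pos ` e"
      by (simp add: \<gamma>_def)
    show "path_image (\<gamma> e) \<inter> pos ` fst G = pos ` e"
    proof (intro subset_antisym subsetI)
      fix z assume "z \<in> path_image (\<gamma> e) \<inter> pos ` fst G"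
      then obtain w where w: "w \<in> fst G" "z = pos w" "z \<in> path_image (\<gamma> e)"
        by blast
      then obtain e' where e': "e' \<in> proper_edges G" "w \<in> e'"
        using wf(2) by blast
      show "z \<in> pos ` e"
      proof (cases "e' = e")
        case False
        have "w = fst (s e') \<or> w = snd (s e')"
          using s(2)[OF e'(1)] e'(2) by blast
        then have "z \<in> path_image (\<gamma> e')"
          unfolding img w(2) by auto
        then show ?thesis
          using meet[OF e e'(1)] False w(3) by blast
      qed (use e' w in blast)
    next
      fix z assume "z \<in> pos ` e"
      then show "z \<in> path_image (\<gamma> e) \<inter> pos ` fst G"
        using pe ends[OF e] unfolding img by auto
    qed
  qed (use meet in blast)
  then show ?thesis
    unfolding planar_def by blast
qed

section \<open>The Markoff graph\<close>

text \<open>Coordinates by number, so that one argument serves all three moves. Every index from 2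
  on gives the last coordinate.\<close>

fun co :: "nat \<Rightarrow> 'a triple \<Rightarrow> 'a" where
  "co 0 (x, y, z) = x"
| "co (Suc 0) (x, y, z) = y"
| "co (Suc (Suc n)) (x, y, z) = z"

text \<open>The permutations of the three indices. Quantifying over them replaces appeals to the
  symmetry of the surface.\<close>

definition axes :: "nat \<Rightarrow> nat \<Rightarrow> nat \<Rightarrow> bool" where
  "axes i j k \<longleftrightarrow> i < 3 \<and> j < 3 \<and> k < 3 \<and> i \<noteq> j \<and> j \<noteq> k \<and> i \<noteq> k"

lemma axes_cases:
  assumes "axes i j k"
  obtains "i = 0" "j = 1" "k = 2" | "i = 0" "j = 2" "k = 1" | "i = 1" "j = 0" "k = 2"
    | "i = 1" "j = 2" "k = 0" | "i = 2" "j = 0" "k = 1" | "i = 2" "j = 1" "k = 0"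
proof -
  have "i = 0 \<or> i = 1 \<or> i = 2" "j = 0 \<or> j = 1 \<or> j = 2" "k = 0 \<or> k = 1 \<or> k = 2"
    "i \<noteq> j" "j \<noteq> k" "i \<noteq> k"
    using assms unfolding axes_def by auto
  then show thesis
    using that by (elim disjE) simp_all
qed

lemma axes_rotate: "axes i j k \<Longrightarrow> axes j k i"
  by (auto simp: axes_def)

lemma axes_swap: "axes i j k \<Longrightarrow> axes j i k"
  by (auto simp: axes_def)

lemma axes_other: "axes i j k \<Longrightarrow> l < 3 \<Longrightarrow> l \<noteq> i \<longleftrightarrow> l = j \<or> l = k"
  by (auto simp: axes_def)

lemma ex_axes:
  assumes "i < 3"
  obtains j k where "axes i j k"
proof -
  have "axes 0 1 2" "axes 1 2 0" "axes 2 0 1"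
    by (simp_all add: axes_def)
  moreover have "i = 0 \<or> i = 1 \<or> i = 2"
    using assms by linarith
  ultimately show thesis
    using that by metis
qed

lemma triple_eqI:
  assumes "axes i j k" "co i v = co i w" "co j v = co j w" "co k v = co k w"
  shows "v = w"
  using assms(1) by (rule axes_cases; use assms in \<open>cases v; cases w; auto simp: numeral_2_eq_2\<close>)

text \<open>Congruences modulo \<open>P\<close> are derived below by naming the coefficients of a
  linear combination and leaving a polynomial identity to be checked.\<close>

lemma dvd_combine2:
  fixes d :: int
  assumes "d dvd a" "d dvd b" "c = r * a + s * b"
  shows "d dvd c"
  using assms by simp

section \<open>Vieta jumps modulo a prime\<close>

locale markoff =
  fixes p :: nat
  assumes p_prime: "prime p"
begin

abbreviation P :: int where "P \<equiv> int p"

definition V :: "int triple set" where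
  "V = markoff_triples (residue_ring P)"

text \<open>Stated without the moves, hence visibly symmetric; \<open>adj_vieta_jump\<close>
  identifies it with a move that does not fix the vertex.\<close>

definition adj :: "nat \<Rightarrow> int triple \<Rightarrow> int triple \<Rightarrow> bool" where
  "adj i v w \<longleftrightarrow> v \<in> V \<and> w \<in> V \<and> v \<noteq> w \<and> (\<forall>j<3. j \<noteq> i \<longrightarrow> co j v = co j w)"

definition Edge :: "nat \<Rightarrow> int triple set set" where
  "Edge i = {{v, w} | v w. adj i v w}"

lemma P_prime: "prime P"
  using p_prime by simp

lemma P_gt: "P > 1"
  using p_prime prime_gt_1_nat by simp

lemma dvd_mult: "P dvd a * b \<longleftrightarrow> P dvd a \<or> P dvd b"
  using P_prime by (simp add: prime_dvd_mult_iff)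

lemma dvd_sq: "P dvd a\<^sup>2 \<longleftrightarrow> P dvd a"
  using P_prime by (simp add: prime_dvd_power_iff)

lemma residue_eqI: "\<lbrakk>a \<in> {0..<P}; b \<in> {0..<P}; P dvd a - b\<rbrakk> \<Longrightarrow> a = b"
  by (metis atLeastLessThan_iff mod_eq_dvd_iff mod_pos_pos_trivial)

lemma residue_0: "a \<in> {0..<P} \<Longrightarrow> P dvd a \<longleftrightarrow> a = 0"
  using zdvd_not_zless[of a P] by force

lemma move_eq:
  "move1 (residue_ring P) (x, y, z) = ((y * z - x) mod P, y, z)"
  "move2 (residue_ring P) (x, y, z) = (x, (x * z - y) mod P, z)"
  "move3 (residue_ring P) (x, y, z) = (x, y, (x * y - z) mod P)"
proof -
  interpret residues P "residue_ring P"
    by unfold_locales (use P_gt in auto)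
  show "move1 (residue_ring P) (x, y, z) = ((y * z - x) mod P, y, z)"
    "move2 (residue_ring P) (x, y, z) = (x, (x * z - y) mod P, z)"
    "move3 (residue_ring P) (x, y, z) = (x, y, (x * y - z) mod P)"
    by (simp_all add: a_minus_def res_neg_eq res_add_eq res_mult_eq mod_simps)
qed

lemma V_iff: "(x, y, z) \<in> V \<longleftrightarrow>
   x \<in> {0..<P} \<and> y \<in> {0..<P} \<and> z \<in> {0..<P} \<and> (x, y, z) \<noteq> (0, 0, 0) \<and>
   P dvd x\<^sup>2 + y\<^sup>2 + z\<^sup>2 - x * y * z"
proof -
  interpret residues P "residue_ring P"
    by unfold_locales (use P_gt in auto)
  have "x [^]\<^bsub>residue_ring P\<^esub> (2::nat) = x\<^sup>2 mod P" if "x \<in> {0..<P}" for x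
    using pow_cong[of x 2] that by simp
  moreover have "carrier (residue_ring P) = {0..<P}"
    by (auto simp: res_carrier_eq)
  moreover have "(x\<^sup>2 mod P \<oplus>\<^bsub>residue_ring P\<^esub> y\<^sup>2 mod P \<oplus>\<^bsub>residue_ring P\<^esub> z\<^sup>2 mod P =
      x \<otimes>\<^bsub>residue_ring P\<^esub> y \<otimes>\<^bsub>residue_ring P\<^esub> z) \<longleftrightarrow> P dvd x\<^sup>2 + y\<^sup>2 + z\<^sup>2 - x * y * z"
    by (simp add: res_add_eq res_mult_eq mod_simps mod_eq_dvd_iff)
  ultimately show ?thesis
    unfolding V_def markoff_triples_def by (auto simp: res_zero_eq)
qed

lemma V_axes:
  assumes "axes i j k" "v \<in> V"
  shows "co i v \<in> {0..<P}"
    "P dvd (co i v)\<^sup>2 + (co j v)\<^sup>2 + (co k v)\<^sup>2 - co i v * co j v * co k v"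
    "\<not> (co i v = 0 \<and> co j v = 0 \<and> co k v = 0)"
proof -
  obtain x y z where v: "v = (x, y, z)"
    by (cases v)
  have "co i v \<in> {0..<P} \<and>
    P dvd (co i v)\<^sup>2 + (co j v)\<^sup>2 + (co k v)\<^sup>2 - co i v * co j v * co k v \<and>
    \<not> (co i v = 0 \<and> co j v = 0 \<and> co k v = 0)"
    using assms(1) by (rule axes_cases; use assms(2) v in \<open>auto simp: V_iff numeral_2_eq_2 algebra_simps\<close>)
  then show "co i v \<in> {0..<P}"
    "P dvd (co i v)\<^sup>2 + (co j v)\<^sup>2 + (co k v)\<^sup>2 - co i v * co j v * co k v"
    "\<not> (co i v = 0 \<and> co j v = 0 \<and> co k v = 0)"
    by blast+
qed

lemma adj_axes: "axes i j k \<Longrightarrow> adj i v w \<longleftrightarrow> v \<in> V \<and> w \<in> V \<and> v \<noteq> w \<and> co j v = co j w \<and> co k v = co k w"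
  unfolding adj_def using axes_other[of i j k] by (auto simp: axes_def)

lemma adj_sym: "adj i v w \<Longrightarrow> adj i w v"
  by (auto simp: adj_def)

lemma adj_coord_neq:
  assumes "i < 3" "adj i v w"
  shows "co i v \<noteq> co i w" "\<not> P dvd co i v - co i w"
proof -
  obtain j k where ax: "axes i j k"
    using ex_axes assms by blast
  show "co i v \<noteq> co i w"
    using assms adj_axes[OF ax] triple_eqI[OF ax] by blast
  then show "\<not> P dvd co i v - co i w"
    using residue_eqI V_axes(1)[OF ax] assms adj_axes[OF ax] by blast
qed

text \<open>The difference of the two surface equations factors as
  \<open>(a - a') * (a + a' - b * c)\<close>, and the first factor is invertible. The product of the
  roots then follows from the equation of \<open>v\<close>.\<close>

lemma vieta:
  assumes ax: "axes i j k" and adj: "adj i v w"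
  shows "P dvd co i v + co i w - co j v * co k v"
    "P dvd co i v * co i w - ((co j v)\<^sup>2 + (co k v)\<^sup>2)"
proof -
  have vw: "v \<in> V" "w \<in> V" "co j v = co j w" "co k v = co k w"
    using adj adj_axes[OF ax] by auto
  define a a' b c where "a = co i v" "a' = co i w" "b = co j v" "c = co k v"
  have 1: "P dvd a\<^sup>2 + b\<^sup>2 + c\<^sup>2 - a * b * c" and 2: "P dvd a'\<^sup>2 + b\<^sup>2 + c\<^sup>2 - a' * b * c"
    using V_axes(2)[OF ax vw(1)] V_axes(2)[OF ax vw(2)] vw unfolding a_a'_b_c_def by auto
  have "(a - a') * (a + a' - b * c) = (a\<^sup>2 + b\<^sup>2 + c\<^sup>2 - a * b * c) - (a'\<^sup>2 + b\<^sup>2 + c\<^sup>2 - a' * b * c)"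
    by (simp add: algebra_simps power2_eq_square)
  then have "P dvd (a - a') * (a + a' - b * c)"
    using dvd_diff[OF 1 2] by simp
  moreover have "\<not> P dvd a - a'"
    using adj_coord_neq(2)[OF _ adj] ax unfolding a_a'_b_c_def axes_def by blast
  ultimately have 3: "P dvd a + a' - b * c"
    using dvd_mult by blast
  then show "P dvd co i v + co i w - co j v * co k v"
    unfolding a_a'_b_c_def .
  have "a * a' - (b\<^sup>2 + c\<^sup>2) = a * (a + a' - b * c) - (a\<^sup>2 + b\<^sup>2 + c\<^sup>2 - a * b * c)"
    by (simp add: algebra_simps power2_eq_square)
  then have "P dvd a * a' - (b\<^sup>2 + c\<^sup>2)"
    using 1 3 by (metis dvd_diff dvd_mult2 mult.commute)
  then show "P dvd co i v * co i w - ((co j v)\<^sup>2 + (co k v)\<^sup>2)"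
    unfolding a_a'_b_c_def .
qed

lemma adj_unique:
  assumes "i < 3" "adj i v w" "adj i v u"
  shows "w = u"
proof -
  obtain j k where ax: "axes i j k"
    using ex_axes assms by blast
  note w = assms(2)[unfolded adj_axes[OF ax]] and u = assms(3)[unfolded adj_axes[OF ax]]
  show ?thesis
  proof (rule triple_eqI[OF ax])
    have "P dvd (co i v + co i w - co j v * co k v) - (co i v + co i u - co j v * co k v)"
      by (rule dvd_diff[OF vieta(1)[OF ax assms(2)] vieta(1)[OF ax assms(3)]])
    then have "P dvd co i w - co i u"
      by simp
    then show "co i w = co i u"
      using residue_eqI V_axes(1)[OF ax] w u by blast
  qed (use w u in auto)
qed

definition vieta_jump :: "nat \<Rightarrow> int triple \<Rightarrow> int triple" where
  "vieta_jump i = (if i = 0 then move1 (residue_ring P)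
     else if i = 1 then move2 (residue_ring P) else move3 (residue_ring P))"

lemma vieta_jump_co:
  assumes "axes i j k"
  shows "co i (vieta_jump i v) = (co j v * co k v - co i v) mod P"
    "co j (vieta_jump i v) = co j v" "co k (vieta_jump i v) = co k v"
proof -
  obtain x y z where v: "v = (x, y, z)"
    by (cases v)
  have "co i (vieta_jump i v) = (co j v * co k v - co i v) mod P \<and>
    co j (vieta_jump i v) = co j v \<and> co k (vieta_jump i v) = co k v"
    using assms by (rule axes_cases; simp add: v vieta_jump_def move_eq numeral_2_eq_2 mult.commute
        del: move1.simps move2.simps move3.simps)
  then show "co i (vieta_jump i v) = (co j v * co k v - co i v) mod P"
    "co j (vieta_jump i v) = co j v" "co k (vieta_jump i v) = co k v"
    by blast+
qed

lemma V_axesI: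
  assumes ax: "axes i j k" and r: "co i v \<in> {0..<P}" "co j v \<in> {0..<P}" "co k v \<in> {0..<P}"
    and n: "\<not> (co i v = 0 \<and> co j v = 0 \<and> co k v = 0)"
    and d: "P dvd (co i v)\<^sup>2 + (co j v)\<^sup>2 + (co k v)\<^sup>2 - co i v * co j v * co k v"
  shows "v \<in> V"
proof -
  obtain x y z where v: "v = (x, y, z)"
    by (cases v)
  show ?thesis
    using ax by (rule axes_cases; use assms(2-) v in \<open>auto simp: V_iff numeral_2_eq_2 algebra_simps\<close>)
qed

lemma vieta_jump_V:
  assumes "i < 3" "v \<in> V"
  shows "vieta_jump i v \<in> V"
proof -
  obtain j k where ax: "axes i j k"
    using ex_axes assms by blast
  let ?w = "vieta_jump i v"
  let ?a = "co i v" and ?b = "co j v" and ?c = "co k v" and ?a' = "co i ?w"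
  note w = vieta_jump_co[OF ax, of v]
  have d: "P dvd ?b * ?c - ?a - ?a'"
    unfolding w(1) by (simp add: minus_mod_eq_mult_div)
  have "?a'\<^sup>2 + ?b\<^sup>2 + ?c\<^sup>2 - ?a' * ?b * ?c =
    (?a\<^sup>2 + ?b\<^sup>2 + ?c\<^sup>2 - ?a * ?b * ?c) + (?b * ?c - ?a - ?a') * (?a - ?a')"
    by (simp add: algebra_simps power2_eq_square)
  then have e: "P dvd ?a'\<^sup>2 + ?b\<^sup>2 + ?c\<^sup>2 - ?a' * ?b * ?c"
    using d V_axes(2)[OF ax assms(2)] by (metis dvd_add dvd_mult2)
  \<comment> \<open>If the jump led to the origin, the sum of the roots would make the old value 0
    as well.\<close>
  have "\<not> (?a' = 0 \<and> ?b = 0 \<and> ?c = 0)"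
    using d V_axes(3)[OF ax assms(2)] V_axes(1)[OF ax assms(2)] residue_0 by auto
  then show ?thesis
    using e w(2,3) V_axes(1)[OF axes_rotate[OF ax] assms(2)] V_axes(1)[OF axes_rotate[OF axes_rotate[OF ax]] assms(2)]
      P_gt by (intro V_axesI[OF ax]) (simp_all add: w(1))
qed

lemma adj_vieta_jump:
  assumes "i < 3"
  shows "adj i v w \<longleftrightarrow> v \<in> V \<and> w \<noteq> v \<and> w = vieta_jump i v"
proof -
  obtain j k where ax: "axes i j k"
    using ex_axes assms by blast
  have jump: "adj i v (vieta_jump i v)" if "v \<in> V" "vieta_jump i v \<noteq> v"
    using that vieta_jump_V[OF assms] vieta_jump_co[OF ax, of v] adj_axes[OF ax] by auto
  have eq: "w = vieta_jump i v" if "adj i v w"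
  proof (rule triple_eqI[OF ax])
    have "P dvd co i w - (co j v * co k v - co i v)"
      using vieta(1)[OF ax that] by (simp add: algebra_simps)
    then have "co i w mod P = (co j v * co k v - co i v) mod P"
      by (simp add: mod_eq_dvd_iff)
    then show "co i w = co i (vieta_jump i v)"
      using vieta_jump_co(1)[OF ax, of v] V_axes(1)[OF ax, of w] that adj_axes[OF ax] by auto
  qed (use that adj_axes[OF ax] vieta_jump_co[OF ax] in auto)
  show ?thesis
    using jump eq by (auto simp: adj_def)
qed

lemma proper_edges_eq: "proper_edges (markoff_graph p) = (\<Union>i<3. Edge i)"
proof -
  have jumps: "{move1 (residue_ring P), move2 (residue_ring P), move3 (residue_ring P)} = vieta_jump ` {..<3}"
    by (auto simp: vieta_jump_def lessThan_Suc numeral_3_eq_3)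
  have E: "snd (markoff_graph p) = {{v, m v} | v m. v \<in> V \<and> m \<in> vieta_jump ` {..<3}}"
    unfolding markoff_graph_def markoff_edges_def V_def[symmetric] jumps by simp
  show ?thesis
  proof (intro subset_antisym subsetI)
    fix e assume "e \<in> proper_edges (markoff_graph p)"
    then obtain v i where e: "e = {v, vieta_jump i v}" "v \<in> V" "i < 3" "card e = 2"
      unfolding proper_edges_def E by auto
    then have "vieta_jump i v \<noteq> v"
      by auto
    then have "adj i v (vieta_jump i v)"
      using e adj_vieta_jump by blast
    then show "e \<in> (\<Union>i<3. Edge i)"
      using e unfolding Edge_def by blast
  next
    fix e assume "e \<in> (\<Union>i<3. Edge i)"
    then obtain i v w where e: "i < 3" "e = {v, w}" "adj i v w"
      unfolding Edge_def by blast
    then have "v \<in> V" "w \<noteq> v" "w = vieta_jump i v"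
      using adj_vieta_jump by blast+
    then have "e = {v, vieta_jump i v}" "vieta_jump i \<in> vieta_jump ` {..<3}" "card e = 2"
      using e by auto
    then have "e \<in> snd (markoff_graph p)" "card e = 2"
      using \<open>v \<in> V\<close> unfolding E by blast+
    then show "e \<in> proper_edges (markoff_graph p)"
      unfolding proper_edges_def by simp
  qed
qed

lemma edge_iff: "{v, w} \<in> proper_edges (markoff_graph p) \<longleftrightarrow> (\<exists>i<3. adj i v w)"
proof
  assume "{v, w} \<in> proper_edges (markoff_graph p)"
  then obtain i v' w' where i: "i < 3" "{v, w} = {v', w'}" "adj i v' w'"
    unfolding proper_edges_eq Edge_def by blast
  then have "adj i v w"
    using adj_sym by (metis doubleton_eq_iff)
  then show "\<exists>i<3. adj i v w"
    using i by blast
next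
  assume "\<exists>i<3. adj i v w"
  then show "{v, w} \<in> proper_edges (markoff_graph p)"
    unfolding proper_edges_eq Edge_def by blast
qed

lemma adj_distinct_colours:
  assumes "i < 3" "j < 3" "adj i u v" "adj j v w" "u \<noteq> w"
  shows "i \<noteq> j"
  using assms adj_unique[OF assms(1)] adj_sym by metis

text \<open>Both edges in direction \<open>i\<close> have the same two \<open>i\<close>-values,
  hence the same sum of roots. So the constant coordinate \<open>co k v0\<close> has equal products
  with two different \<open>j\<close>-values and must vanish.\<close>

lemma four_cycle_coord:
  assumes ax: "axes i j k"
    and e: "adj i v0 v1" "adj j v1 v2" "adj i v2 v3" "adj j v3 v0"
  shows "co k v0 = 0"
proof -
  have ax': "axes j i k"
    using ax axes_swap by blast
  note a = e(1,3)[unfolded adj_axes[OF ax]] and b = e(2,4)[unfolded adj_axes[OF ax']]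
  have "co k v2 = co k v0" "co i v2 = co i v1" "co i v3 = co i v0"
    using a b by auto
  then have "P dvd co i v0 + co i v1 - co j v0 * co k v0" "P dvd co i v1 + co i v0 - co j v2 * co k v0"
    using vieta(1)[OF ax e(1)] vieta(1)[OF ax e(3)] by simp_all
  then have "P dvd co k v0 * (co j v0 - co j v2)"
    by (rule dvd_combine2[where r = "-1" and s = 1]) (simp add: algebra_simps)
  moreover have "co j v0 = co j v1"
    using a by simp
  moreover have "\<not> P dvd co j v1 - co j v2"
    using adj_coord_neq(2)[of j v1 v2] e ax by (simp add: axes_def)
  ultimately have "P dvd co k v0"
    using dvd_mult by metis
  then show ?thesis
    using residue_0[of "co k v0"] V_axes(1)[of k i j v0] a ax axes_rotate by blast
qed

text \<open>With constant third coordinate \<open>c\<close> the Vieta relations are linear.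
  Eliminating between them leaves \<open>y1 - y2 = c * (z0 - z2)\<close> and
  \<open>z0 - z2 = c * (y1 - y2)\<close> modulo \<open>P\<close>, where \<open>y1 - y2\<close> is
  nonzero.\<close>

lemma six_cycle_coord:
  assumes ax: "axes i j k"
    and e: "adj i v0 v1" "adj j v1 v2" "adj i v2 v3" "adj j v3 v4" "adj i v4 v5" "adj j v5 v0"
  shows "P dvd (co k v0)\<^sup>2 - 1"
proof -
  have ax': "axes j i k"
    using ax axes_swap by blast
  note a = e(1,3,5)[unfolded adj_axes[OF ax]] and b = e(2,4,6)[unfolded adj_axes[OF ax']]
  define c where "c = co k v0"
  have c: "co k v1 = c" "co k v2 = c" "co k v3 = c" "co k v4 = c" "co k v5 = c"
    using a b unfolding c_def by auto
  define y0 y1 y2 z0 z1 z2 where "y0 = co i v0" "y1 = co i v2" "y2 = co i v4"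
    "z0 = co j v0" "z1 = co j v2" "z2 = co j v4"
  have co: "co i v1 = y1" "co i v3 = y2" "co i v5 = y0" "co j v1 = z0" "co j v3 = z1" "co j v5 = z2"
    using a b unfolding y0_y1_y2_z0_z1_z2_def by auto
  have v: "P dvd y0 + y1 - z0 * c" "P dvd z0 + z1 - y1 * c" "P dvd y1 + y2 - z1 * c"
    "P dvd z1 + z2 - y2 * c"
    using vieta(1)[OF ax e(1)] vieta(1)[OF ax' e(2)] vieta(1)[OF ax e(3)] vieta(1)[OF ax' e(4)]
    by (simp_all add: co c flip: y0_y1_y2_z0_z1_z2_def c_def)
  have 5: "P dvd y2 + y0 - z2 * c"
    using vieta(1)[OF ax e(5)] by (simp add: co c flip: y0_y1_y2_z0_z1_z2_def c_def)
  have 6: "P dvd (y0 - y2) - (z0 - z1) * c"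
    by (rule dvd_combine2[OF v(1,3), of _ 1 "-1"]) (simp add: algebra_simps)
  have 7: "P dvd (y0 - y1) - (z2 - z1) * c"
    by (rule dvd_combine2[OF 5 v(3), of _ 1 "-1"]) (simp add: algebra_simps)
  have 8: "P dvd (z0 - z2) - (y1 - y2) * c"
    by (rule dvd_combine2[OF v(2,4), of _ 1 "-1"]) (simp add: algebra_simps)
  have 9: "P dvd (y1 - y2) - (z0 - z2) * c"
    by (rule dvd_combine2[OF 6 7, of _ 1 "-1"]) (simp add: algebra_simps)
  have "P dvd (y1 - y2) * (c\<^sup>2 - 1)"
    by (rule dvd_combine2[OF 9 8, of _ "-1" "-c"]) (simp add: algebra_simps power2_eq_square)
  moreover have "\<not> P dvd y1 - y2"
    using adj_coord_neq(2)[of i v2 v3] e ax co by (simp add: axes_def y0_y1_y2_z0_z1_z2_def)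
  ultimately show ?thesis
    using dvd_mult unfolding c_def by blast
qed

text \<open>As for 4-cycles, the stretch \<open>i\<close>, \<open>j\<close>, \<open>i\<close> forces
  coordinate \<open>k\<close> of \<open>v0\<close> to be 0, and the stretch \<open>k\<close>,
  \<open>j\<close>, \<open>k\<close> forces coordinate \<open>i\<close> to be 0. The surface
  equation then leaves only the origin.\<close>

lemma six_cycle_impossible:
  assumes ax: "axes i j k"
    and e: "adj i v0 v1" "adj j v1 v2" "adj i v2 v3" "adj k v3 v4" "adj j v4 v5" "adj k v5 v0"
  shows False
proof -
  have axj: "axes j k i" and axk: "axes k i j"
    using ax axes_rotate by blast+
  note a = e(1,3)[unfolded adj_axes[OF ax]] and b = e(2,5)[unfolded adj_axes[OF axj]]
    and c = e(4,6)[unfolded adj_axes[OF axk]]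
  have "co k v2 = co k v0" "co i v2 = co i v1" "co i v3 = co i v0" "co j v0 = co j v1"
    using a b c by auto
  then have "P dvd co i v0 + co i v1 - co j v1 * co k v0" "P dvd co i v1 + co i v0 - co j v2 * co k v0"
    using vieta(1)[OF ax e(1)] vieta(1)[OF ax e(3)] by simp_all
  then have "P dvd co k v0 * (co j v1 - co j v2)"
    by (rule dvd_combine2[where r = "-1" and s = 1]) (simp add: algebra_simps)
  moreover have nj: "\<not> P dvd co j v1 - co j v2"
    using adj_coord_neq(2)[of j v1 v2] e ax by (simp add: axes_def)
  ultimately have ck: "P dvd co k v0"
    using dvd_mult by blast
  have "co k v3 = co k v0" "co k v5 = co k v4" "co j v3 = co j v2" "co j v5 = co j v1"
    "co i v3 = co i v0" "co i v5 = co i v0"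
    using a b c by auto
  then have "P dvd co k v0 + co k v4 - co i v0 * co j v2" "P dvd co k v4 + co k v0 - co i v0 * co j v1"
    using vieta(1)[OF axk e(4)] vieta(1)[OF axk e(6)] by simp_all
  then have "P dvd co i v0 * (co j v1 - co j v2)"
    by (rule dvd_combine2[where r = 1 and s = "-1"]) (simp add: algebra_simps)
  then have ci: "P dvd co i v0"
    using nj dvd_mult by blast
  have v0: "v0 \<in> V"
    using a by blast
  have z: "co k v0 = 0" "co i v0 = 0"
    using ck ci residue_0 V_axes(1)[OF ax v0] V_axes(1)[OF axk v0] by blast+
  then have "P dvd (co j v0)\<^sup>2"
    using V_axes(2)[OF ax v0] by simp
  then have "co j v0 = 0"
    using dvd_sq residue_0 V_axes(1)[OF axj v0] by blast
  then show False
    using z V_axes(3)[OF ax v0] by blast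
qed

text \<open>Modulo \<open>P\<close>, \<open>t\<close> equals both \<open>z * x'\<close> and
  \<open>x * y\<close>. Splitting \<open>t\<^sup>2\<close> as \<open>y * t + z * t\<close> gives
  \<open>m * (x + x') = m\<^sup>2\<close>, and multiplying the two values gives
  \<open>m * x * x'\<close>. As \<open>m\<close> is nonzero,
  \<open>y\<^sup>2 + z\<^sup>2 = x * x' = m\<close>. Then \<open>t\<^sup>2 = 3 * m\<close>, so
  \<open>m = 3\<close>.\<close>

lemma hexagon_arith:
  assumes h: "P dvd y + z - z * x'" "P dvd y + z - x * y" "P dvd x + x' - y * z"
    "P dvd x * x' - (y\<^sup>2 + z\<^sup>2)" and ne: "\<not> P dvd y - z"
  shows "P dvd y\<^sup>2 + z\<^sup>2 - 3"
proof -
  define m t where "m = y * z" and "t = y + z"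
  note d = m_def t_def
  have 1: "P dvd t\<^sup>2 - m * (x + x')"
    by (rule dvd_combine2[OF h(1,2), of _ y z]) (simp add: d algebra_simps power2_eq_square)
  have 2: "P dvd t\<^sup>2 - m\<^sup>2"
    by (rule dvd_combine2[OF 1 h(3), of _ 1 m]) (simp add: d algebra_simps power2_eq_square)
  have 3: "P dvd t\<^sup>2 - m * x * x'"
    by (rule dvd_combine2[OF h(2,1), of _ t "x * y"]) (simp add: d algebra_simps power2_eq_square)
  have m: "\<not> P dvd m"
  proof
    assume "P dvd m"
    then have "P dvd t\<^sup>2"
      by (rule dvd_combine2[OF 2, of _ _ 1 m]) (simp add: power2_eq_square)
    then have "P dvd t"
      using dvd_sq by blast
    moreover have "P dvd y \<or> P dvd z"
      using \<open>P dvd m\<close> dvd_mult m_def by blast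
    moreover have "P dvd y - z" if "P dvd t" "P dvd y"
      by (rule dvd_combine2[OF that, of _ "-1" 2]) (simp add: t_def)
    moreover have "P dvd y - z" if "P dvd t" "P dvd z"
      by (rule dvd_combine2[OF that, of _ 1 "-2"]) (simp add: t_def)
    ultimately have "P dvd y - z"
      by blast
    then show False
      using ne by blast
  qed
  have "P dvd m * (x * x' - m)"
    by (rule dvd_combine2[OF 2 3, of _ 1 "-1"]) (simp add: algebra_simps power2_eq_square)
  then have "P dvd x * x' - m"
    using m dvd_mult by blast
  then have 4: "P dvd y\<^sup>2 + z\<^sup>2 - m"
    by (rule dvd_combine2[OF h(4), of _ _ "-1" 1]) simp
  have "P dvd m * (3 - m)"
    by (rule dvd_combine2[OF 2 4, of _ 1 "-1"]) (simp add: d algebra_simps power2_eq_square)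
  then have "P dvd 3 - m"
    using m dvd_mult by blast
  then show ?thesis
    by (rule dvd_combine2[OF 4, of _ _ 1 "-1"]) simp
qed

lemma two_invertible:
  assumes "p > 3" "P dvd 2 * a"
  shows "P dvd a"
proof -
  have "\<not> P dvd 2"
  proof
    assume "P dvd 2"
    then have "P \<le> 2"
      by (rule zdvd_imp_le) simp
    then show False
      using assms(1) by simp
  qed
  then show ?thesis
    using assms(2) dvd_mult by blast
qed

text \<open>The two \<open>i\<close>-edges share both roots, so \<open>(y, z)\<close> and
  \<open>(y', z')\<close> agree modulo \<open>P\<close> in product and in sum of squares, and hence
  up to exchange and common sign. Agreement contradicts the \<open>j\<close>-edge; pure negation
  forces \<open>x\<close> and \<open>x'\<close> to vanish, against the \<open>i\<close>-edge.
  Exchange is \<open>hexagon_arith\<close>, and exchange with negation reduces to it by changing the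
  signs of \<open>x\<close>, \<open>x'\<close> and \<open>y\<close>. Halving in the case split uses
  \<open>p > 3\<close>.\<close>

lemma six_cycle_hexagon:
  assumes ax: "axes i j k" and p3: "p > 3"
    and e: "adj i v0 v1" "adj j v1 v2" "adj k v2 v3" "adj i v3 v4" "adj j v4 v5" "adj k v5 v0"
  shows "P dvd (co j v0)\<^sup>2 + (co k v0)\<^sup>2 - 3"
proof -
  have axj: "axes j k i" and axk: "axes k i j"
    using ax axes_rotate by blast+
  note a = e(1,4)[unfolded adj_axes[OF ax]] and b = e(2,5)[unfolded adj_axes[OF axj]]
    and c = e(3,6)[unfolded adj_axes[OF axk]]
  define x x' y y' z z' where "x = co i v0" "x' = co i v1" "y = co j v0" "y' = co j v2"
    "z = co k v0" "z' = co k v3"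
  have co: "co i v2 = x'" "co i v3 = x'" "co i v4 = x" "co i v5 = x"
    "co j v1 = y" "co j v3 = y'" "co j v4 = y'" "co j v5 = y"
    "co k v1 = z" "co k v2 = z" "co k v4 = z'" "co k v5 = z'"
    using a b c unfolding x_x'_y_y'_z_z'_def by auto
  note defs = x_x'_y_y'_z_z'_def
  have s: "P dvd x + x' - y * z" "P dvd y + y' - z * x'" "P dvd z + z' - x' * y'"
    "P dvd x' + x - y' * z'" "P dvd y' + y - z' * x" "P dvd z' + z - x * y"
    using vieta(1)[OF ax e(1)] vieta(1)[OF axj e(2)] vieta(1)[OF axk e(3)]
      vieta(1)[OF ax e(4)] vieta(1)[OF axj e(5)] vieta(1)[OF axk e(6)]
    by (simp_all add: co flip: defs)
  have q: "P dvd x * x' - (y\<^sup>2 + z\<^sup>2)" "P dvd x' * x - (y'\<^sup>2 + z'\<^sup>2)"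
    using vieta(2)[OF ax e(1)] vieta(2)[OF ax e(4)] by (simp_all add: co flip: defs)
  have ne: "\<not> P dvd x - x'" "\<not> P dvd y - y'" "\<not> P dvd z - z'"
    using adj_coord_neq(2)[of i v0 v1] adj_coord_neq(2)[of j v1 v2] adj_coord_neq(2)[of k v2 v3] e ax
    by (simp_all add: axes_def co flip: defs)
  note half = two_invertible[OF p3]
  have D: "P dvd y * z - y' * z'"
    by (rule dvd_combine2[OF s(1,4), of _ "-1" 1]) (simp add: algebra_simps)
  have Q: "P dvd (y\<^sup>2 + z\<^sup>2) - (y'\<^sup>2 + z'\<^sup>2)"
    by (rule dvd_combine2[OF q, of _ "-1" 1]) (simp add: algebra_simps)
  have "P dvd (y + z - y' - z') * (y + z + y' + z')"
    by (rule dvd_combine2[OF Q D, of _ 1 2]) (simp add: algebra_simps power2_eq_square)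
  then have plus: "P dvd y + z - y' - z' \<or> P dvd y + z + y' + z'"
    using dvd_mult by blast
  have "P dvd (y - z - y' + z') * (y - z + y' - z')"
    by (rule dvd_combine2[OF Q D, of _ 1 "-2"]) (simp add: algebra_simps power2_eq_square)
  then have minus: "P dvd y - z - y' + z' \<or> P dvd y - z + y' - z'"
    using dvd_mult by blast
  consider "P dvd y - y'" | "P dvd y' - z" "P dvd z' - y" | "P dvd y' + z" "P dvd z' + y"
    | "P dvd y + y'" "P dvd z + z'"
  proof -
    have 1: "P dvd y - y'" if "P dvd y + z - y' - z'" "P dvd y - z - y' + z'"
      by (rule half, rule dvd_combine2[OF that, of _ 1 1]) simp
    have 2: "P dvd y' - z \<and> P dvd z' - y" if "P dvd y + z - y' - z'" "P dvd y - z + y' - z'"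
      by (rule conjI; rule half; rule dvd_combine2[OF that, of _ "-1" 1] dvd_combine2[OF that, of _ "-1" "-1"]; simp)
    have 3: "P dvd y' + z \<and> P dvd z' + y" if "P dvd y + z + y' + z'" "P dvd y - z - y' + z'"
      by (rule conjI; rule half; rule dvd_combine2[OF that, of _ 1 "-1"] dvd_combine2[OF that, of _ 1 1]; simp)
    have 4: "P dvd y + y' \<and> P dvd z + z'" if "P dvd y + z + y' + z'" "P dvd y - z + y' - z'"
      by (rule conjI; rule half; rule dvd_combine2[OF that, of _ 1 1] dvd_combine2[OF that, of _ 1 "-1"]; simp)
    show thesis
      using plus minus 1 2 3 4 that by blast
  qed
  then have "P dvd y\<^sup>2 + z\<^sup>2 - 3"
  proof cases
    case 1
    then show ?thesis
      using ne by blast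
  next
    case 2
    show ?thesis
    proof (rule hexagon_arith[where x = x and x' = x'])
      show "P dvd y + z - z * x'"
        by (rule dvd_combine2[OF s(2) 2(1), of _ 1 "-1"]) simp
      show "P dvd y + z - x * y"
        by (rule dvd_combine2[OF s(6) 2(2), of _ 1 "-1"]) simp
      show "\<not> P dvd y - z"
      proof
        assume "P dvd y - z"
        then have "P dvd y - y'"
          by (rule dvd_combine2[OF _ 2(1), of _ _ 1 "-1"]) simp
        then show False
          using ne by blast
      qed
    qed (use s(1) q(1) in auto)
  next
    case 3
    have "P dvd (- y)\<^sup>2 + z\<^sup>2 - 3"
    proof (rule hexagon_arith[where x = "- x" and x' = "- x'"])
      show "P dvd - y + z - z * - x'"
        by (rule dvd_combine2[OF s(2) 3(1), of _ "-1" 1]) (simp add: algebra_simps)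
      show "P dvd - y + z - (- x) * (- y)"
        by (rule dvd_combine2[OF s(6) 3(2), of _ 1 "-1"]) (simp add: algebra_simps)
      show "P dvd - x + - x' - (- y) * z"
        by (rule dvd_combine2[OF s(1) s(1), of _ "-1" 0]) (simp add: algebra_simps)
      show "\<not> P dvd - y - z"
      proof
        assume "P dvd - y - z"
        then have "P dvd y - y'"
          by (rule dvd_combine2[OF _ 3(1), of _ _ "-1" "-1"]) simp
        then show False
          using ne by blast
      qed
    qed (use q(1) in auto)
    then show ?thesis
      by simp
  next
    case 4
    have "P dvd z * x'"
      by (rule dvd_combine2[OF s(2) 4(1), of _ "-1" 1]) simp
    moreover have "P dvd z * x"
    proof -
      have "P dvd z' * x"
        by (rule dvd_combine2[OF s(5) 4(1), of _ "-1" 1]) simp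
      then show ?thesis
        by (rule dvd_combine2[OF _ 4(2), of _ _ "-1" x]) (simp add: algebra_simps)
    qed
    moreover have "\<not> P dvd z"
    proof
      assume "P dvd z"
      then have "P dvd z - z'"
        by (rule dvd_combine2[OF _ 4(2), of _ _ 2 "-1"]) simp
      then show False
        using ne by blast
    qed
    ultimately have "P dvd x" "P dvd x'"
      using dvd_mult by blast+
    then show ?thesis
      using ne(1) by (simp add: dvd_diff)
  qed
  then show ?thesis
    unfolding defs .
qed

end

section \<open>Short cycles\<close>

text \<open>Cyclic words of length 6 over three letters, with different neighbours and no letter
  occurring exactly once, are ababab, abcabc or abacbc up to renaming and rotation. The last one
  appears in three rotations relative to the first edge, hence five cases.\<close>

lemma six_colours:
  assumes ne: "c0 \<noteq> c1" "c1 \<noteq> c2" "c2 \<noteq> c3" "c3 \<noteq> c4" "c4 \<noteq> c5" "c5 \<noteq> c0"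
  and rep: "c0 = c2 \<or> c0 = c3 \<or> c0 = c4" "c1 = c3 \<or> c1 = c4 \<or> c1 = c5"
    "c2 = c4 \<or> c2 = c5 \<or> c2 = c0" "c3 = c5 \<or> c3 = c0 \<or> c3 = c1"
    "c4 = c0 \<or> c4 = c1 \<or> c4 = c2" "c5 = c1 \<or> c5 = c2 \<or> c5 = c3"
  and k: "k \<noteq> c0" "k \<noteq> c1"
  and A: "c2 = c0 \<or> c2 = k" "c5 = c1 \<or> c5 = k" "c3 = c0 \<or> c3 = c1 \<or> c3 = k" "c4 = c0 \<or> c4 = c1 \<or> c4 = k"
  shows "c2 = c0 \<and> c3 = c1 \<and> c4 = c0 \<and> c5 = c1 \<or> c2 = k \<and> c3 = c0 \<and> c4 = c1 \<and> c5 = k \<or>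
    c2 = c0 \<and> c3 = k \<and> c4 = c1 \<and> c5 = k \<or> c2 = k \<and> c3 = c0 \<and> c4 = k \<and> c5 = c1 \<or>
    c2 = k \<and> c3 = c1 \<and> c4 = c0 \<and> c5 = k"
proof (cases "c2 = c0")
  case True
  then have "c3 = c1 \<or> c3 = k"
    using A(3) ne(3) by auto
  then show ?thesis
  proof
    assume 1: "c3 = c1"
    then have "c4 = c0"
      using A(4) ne(4) rep(5) k True by auto
    then show ?thesis
      using 1 True A(2) rep(6) k by auto
  next
    assume 1: "c3 = k"
    then have "c5 = k"
      using rep(4) k by auto
    moreover have "c4 = c1"
      using calculation rep(2) 1 k by auto
    ultimately show ?thesis
      using 1 True by auto
  qed
next
  case False
  then have 2: "c2 = k"
    using A(1) by blast
  then have "c3 = c0 \<or> c3 = c1"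
    using A(3) ne(3) by auto
  then show ?thesis
  proof
    assume "c3 = c0"
    then show ?thesis
      using 2 rep(2,3) k ne by auto
  next
    assume 1: "c3 = c1"
    then have "c4 = c0"
      using rep(1) ne(1) False by auto
    then show ?thesis
      using 1 2 rep(3) k by auto
  qed
qed

context markoff
begin

text \<open>This and \<open>hexagon_edges\<close> record necessary conditions for lying on a 4-cycle
  or a 6-cycle. Unlike the cycles, edges satisfying such conditions on the constant coordinates are
  easy to count.\<close>

definition zero_edges :: "int triple set set" where
  "zero_edges = {{v, w} | v w i j k. axes i j k \<and> adj i v w \<and> co j v = 0}"

definition hexagon_edges :: "int triple set set" where
  "hexagon_edges = {{v, w} | v w i j k. axes i j k \<and> adj i v w \<and>
     (P dvd (co j v)\<^sup>2 - 1 \<or> P dvd (co j v)\<^sup>2 + (co k v)\<^sup>2 - 3)}"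

lemma adj_co_eq_iff: "\<lbrakk>adj c v w; c < 3; i < 3\<rbrakk> \<Longrightarrow> co i v = co i w \<longleftrightarrow> c \<noteq> i"
  using adj_coord_neq(1)[of c v w] by (auto simp: adj_def)

lemma no_three_cycle:
  assumes c: "c0 < 3" "c1 < 3" "c2 < 3"
    and e: "adj c0 v0 v1" "adj c1 v1 v2" "adj c2 v2 v0"
    and d: "v0 \<noteq> v2" "v1 \<noteq> v0" "v2 \<noteq> v1"
  shows False
proof -
  have "c0 \<noteq> c1" "c2 \<noteq> c0"
    using adj_distinct_colours c e d by metis+
  then show False
    using adj_co_eq_iff[OF e(1), of c0] adj_co_eq_iff[OF e(2), of c0] adj_co_eq_iff[OF e(3), of c0] c
    by simp
qed

lemma four_cycle_edge:
  assumes c: "c0 < 3" "c1 < 3" "c2 < 3" "c3 < 3"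
    and e: "adj c0 v0 v1" "adj c1 v1 v2" "adj c2 v2 v3" "adj c3 v3 v0"
    and d: "v0 \<noteq> v2" "v1 \<noteq> v3" "v2 \<noteq> v0" "v3 \<noteq> v1"
  shows "{v0, v1} \<in> zero_edges"
proof -
  have ne: "c0 \<noteq> c1" "c1 \<noteq> c2" "c2 \<noteq> c3" "c3 \<noteq> c0"
    using adj_distinct_colours c e d by metis+
  note co = adj_co_eq_iff[OF e(1)] adj_co_eq_iff[OF e(2)] adj_co_eq_iff[OF e(3)] adj_co_eq_iff[OF e(4)]
  have "c2 = c0"
    using co[of c0] c ne by metis
  moreover have "c3 = c1"
    using co[of c1] c ne by metis
  moreover obtain k where k: "axes c0 c1 k"
    using c ne(1) ex_axes[of c0] axes_def by (metis (no_types, lifting) axes_other)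
  ultimately have "co k v0 = 0"
    using four_cycle_coord[OF k] e by metis
  moreover have "axes c0 k c1"
    using k by (auto simp: axes_def)
  ultimately show ?thesis
    unfolding zero_edges_def using e(1) by blast
qed

text \<open>Each colour occurring on five edges occurs at least twice, so there are at most two
  colours; but two colours cannot alternate around an odd cycle.\<close>

lemma no_five_cycle:
  assumes c: "c0 < 3" "c1 < 3" "c2 < 3" "c3 < 3" "c4 < 3"
    and e: "adj c0 v0 v1" "adj c1 v1 v2" "adj c2 v2 v3" "adj c3 v3 v4" "adj c4 v4 v0"
    and d: "v0 \<noteq> v2" "v1 \<noteq> v3" "v2 \<noteq> v4" "v3 \<noteq> v0" "v4 \<noteq> v1"
  shows False
proof -
  have ne: "c0 \<noteq> c1" "c1 \<noteq> c2" "c2 \<noteq> c3" "c3 \<noteq> c4" "c4 \<noteq> c0"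
    using adj_distinct_colours c e d by metis+
  note co = adj_co_eq_iff[OF e(1)] adj_co_eq_iff[OF e(2)] adj_co_eq_iff[OF e(3)]
    adj_co_eq_iff[OF e(4)] adj_co_eq_iff[OF e(5)]
  have "c0 = c2 \<or> c0 = c3"
    using co[of c0] c ne by metis
  moreover have "c1 = c3 \<or> c1 = c4"
    using co[of c1] c ne by metis
  moreover have "c2 = c4 \<or> c2 = c0"
    using co[of c2] c ne by metis
  moreover have "c3 = c0 \<or> c3 = c1"
    using co[of c3] c ne by metis
  moreover have "c4 = c1 \<or> c4 = c2"
    using co[of c4] c ne by metis
  ultimately show False
    using ne by metis
qed

lemma six_cycle_edge:
  assumes p3: "p > 3" and c: "c0 < 3" "c1 < 3" "c2 < 3" "c3 < 3" "c4 < 3" "c5 < 3"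
    and e: "adj c0 v0 v1" "adj c1 v1 v2" "adj c2 v2 v3" "adj c3 v3 v4" "adj c4 v4 v5" "adj c5 v5 v0"
    and d: "v0 \<noteq> v2" "v1 \<noteq> v3" "v2 \<noteq> v4" "v3 \<noteq> v5" "v4 \<noteq> v0" "v5 \<noteq> v1"
  shows "{v0, v1} \<in> hexagon_edges"
proof -
  have ne: "c0 \<noteq> c1" "c1 \<noteq> c2" "c2 \<noteq> c3" "c3 \<noteq> c4" "c4 \<noteq> c5" "c5 \<noteq> c0"
    using adj_distinct_colours c e d by metis+
  note co = adj_co_eq_iff[OF e(1)] adj_co_eq_iff[OF e(2)] adj_co_eq_iff[OF e(3)]
    adj_co_eq_iff[OF e(4)] adj_co_eq_iff[OF e(5)] adj_co_eq_iff[OF e(6)]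
  have rep: "c0 = c2 \<or> c0 = c3 \<or> c0 = c4" "c1 = c3 \<or> c1 = c4 \<or> c1 = c5"
    "c2 = c4 \<or> c2 = c5 \<or> c2 = c0" "c3 = c5 \<or> c3 = c0 \<or> c3 = c1"
    "c4 = c0 \<or> c4 = c1 \<or> c4 = c2" "c5 = c1 \<or> c5 = c2 \<or> c5 = c3"
    using co[of c0] co[of c1] co[of c2] co[of c3] co[of c4] co[of c5] c ne by metis+
  obtain k where ax: "axes c0 c1 k"
    using c ne(1) ex_axes[of c0] axes_def by (metis (no_types, lifting) axes_other)
  have in3: "l = c0 \<or> l = c1 \<or> l = k" if "l < 3" for l
    using axes_other[OF ax that] by blast
  have k: "k \<noteq> c0" "k \<noteq> c1"
    using ax by (auto simp: axes_def)
  have "c2 = c0 \<or> c2 = k" "c5 = c1 \<or> c5 = k" "c3 = c0 \<or> c3 = c1 \<or> c3 = k" "c4 = c0 \<or> c4 = c1 \<or> c4 = k"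
    using in3 c ne by metis+
  then have "c2 = c0 \<and> c3 = c1 \<and> c4 = c0 \<and> c5 = c1 \<or> c2 = k \<and> c3 = c0 \<and> c4 = c1 \<and> c5 = k \<or>
    c2 = c0 \<and> c3 = k \<and> c4 = c1 \<and> c5 = k \<or> c2 = k \<and> c3 = c0 \<and> c4 = k \<and> c5 = c1 \<or>
    c2 = k \<and> c3 = c1 \<and> c4 = c0 \<and> c5 = k"
    using six_colours[OF ne rep k] by blast
  then consider "c2 = c0" "c3 = c1" "c4 = c0" "c5 = c1" | "c2 = k" "c3 = c0" "c4 = c1" "c5 = k"
    | "c2 = c0" "c3 = k" "c4 = c1" "c5 = k" | "c2 = k" "c3 = c0" "c4 = k" "c5 = c1"
    | "c2 = k" "c3 = c1" "c4 = c0" "c5 = k"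
    by blast
  then show ?thesis
  proof cases
    case 1
    then have "P dvd (co k v0)\<^sup>2 - 1"
      using six_cycle_coord[OF ax] e by metis
    moreover have "axes c0 k c1"
      using ax by (auto simp: axes_def)
    ultimately show ?thesis
      unfolding hexagon_edges_def using e(1) by blast
  next
    case 2
    then have "P dvd (co c1 v0)\<^sup>2 + (co k v0)\<^sup>2 - 3"
      using six_cycle_hexagon[OF ax p3] e by metis
    then show ?thesis
      unfolding hexagon_edges_def using e(1) ax by blast
  next
    case 3
    then show ?thesis
      using six_cycle_impossible[OF ax] e by metis
  next
    case 4
    have "axes c1 c0 k"
      using ax by (auto simp: axes_def)
    then show ?thesis
      using six_cycle_impossible[of c1 c0 k v5 v0 v1 v2 v3 v4] e 4 by metis
  next
    case 5
    have "axes c1 k c0"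
      using ax by (auto simp: axes_def)
    then show ?thesis
      using six_cycle_impossible[of c1 k c0 v1 v2 v3 v4 v5 v0] e 5 by metis
  qed
qed

abbreviation E :: "int triple set set" where
  "E \<equiv> proper_edges (markoff_graph p)"

text \<open>The weights are chosen such that every cycle weighs at least 84: seven ordinary edges, four
  edges of weight 21 or six edges of weight 14.\<close>

definition weight :: "int triple set \<Rightarrow> nat" where
  "weight e = 12 + (if e \<in> zero_edges then 9 else 0) + (if e \<in> hexagon_edges then 2 else 0)"

lemma cycle_weight:
  assumes p3: "p > 3" and cyc: "graph_cycle E vs"
  shows "84 \<le> sum weight (cycle_edges vs)"
proof -
  define n where "n = length vs"
  \<comment> \<open>Periodic indexing lets the cycle start anywhere, so the lemmas about the first
    edge of a short cycle apply to each of its edges.\<close>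
  define u where "u t = vs ! (t mod n)" for t
  have n: "3 \<le> n" "distinct vs" "cycle_edges vs \<subseteq> E"
    using cyc by (auto simp: graph_cycle_def n_def)
  have per: "u (t + n) = u t" for t
    by (simp add: u_def)
  have edges: "cycle_edges vs = {{u t, u (Suc t)} | t. t < n}"
    unfolding cycle_edges_def u_def n_def by (rule Collect_cong) (metis mod_less)
  have "\<exists>i<3. adj i (u t) (u (Suc t))" for t
  proof -
    have "{vs ! (t mod n), vs ! (Suc (t mod n) mod n)} \<in> cycle_edges vs"
      unfolding cycle_edges_def n_def[symmetric] using n(1) by (auto intro!: exI[of _ "t mod n"])
    then show ?thesis
      using n(3) edge_iff[of "u t" "u (Suc t)"] by (auto simp: u_def mod_Suc_eq)
  qed
  then obtain c where c: "\<And>t. c t < 3" "\<And>t. adj (c t) (u t) (u (Suc t))"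
    by metis
  have neq: "u t \<noteq> u (t + 2)" for t
  proof
    assume "u t = u (t + 2)"
    moreover have "t mod n < length vs" "(t + 2) mod n < length vs"
      using n(1) by (simp_all flip: n_def)
    ultimately have "t mod n = (t + 2) mod n"
      using n(2) by (simp add: u_def nth_eq_iff_index_eq)
    then have "n dvd 2"
      by (metis add_diff_cancel_left' mod_eq_dvd_iff_nat le_add1)
    then show False
      using n(1) by (auto dest: dvd_imp_le)
  qed
  have card: "card (cycle_edges vs) = n"
    using card_cycle_edges n by (simp add: n_def)
  have fin: "finite (cycle_edges vs)"
    using card n(1) by (intro card_ge_0_finite) simp
  have sum: "m * n \<le> sum weight (cycle_edges vs)" if "\<And>t. m \<le> weight {u t, u (Suc t)}" for m
  proof -
    have "card (cycle_edges vs) * m \<le> sum weight (cycle_edges vs)"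
      using that by (intro sum_bounded_below[where K = m, simplified]) (auto simp: edges)
    then show ?thesis
      by (simp add: card mult.commute)
  qed
  have step: "adj (c t) (u t) (u (t + 1))" "adj (c (t + 1)) (u (t + 1)) (u (t + 2))"
    "adj (c (t + 2)) (u (t + 2)) (u (t + 3))" "adj (c (t + 3)) (u (t + 3)) (u (t + 4))"
    "adj (c (t + 4)) (u (t + 4)) (u (t + 5))" "adj (c (t + 5)) (u (t + 5)) (u (t + 6))" for t
    using c(2)[of t] c(2)[of "t + 1"] c(2)[of "t + 2"] c(2)[of "t + 3"] c(2)[of "t + 4"] c(2)[of "t + 5"]
    by (simp_all add: eval_nat_numeral)
  have neqs: "u (t + 1) \<noteq> u (t + 3)" "u (t + 2) \<noteq> u (t + 4)" "u (t + 3) \<noteq> u (t + 5)"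
    "u (t + 4) \<noteq> u (t + 6)" "u (t + 5) \<noteq> u (t + 7)" for t
    using neq[of "t + 1"] neq[of "t + 2"] neq[of "t + 3"] neq[of "t + 4"] neq[of "t + 5"]
    by (simp_all add: eval_nat_numeral)
  consider "n = 3" | "n = 4" | "n = 5" | "n = 6" | "7 \<le> n"
    using n(1) by linarith
  then show ?thesis
  proof cases
    case 1
    have "u 3 = u 0" "u 4 = u 1"
      using per[of 0] per[of 1] 1 by simp_all
    then have False
      using no_three_cycle[of "c 0" "c 1" "c 2" "u 0" "u 1" "u 2"] c(1) step[of 0] neq[of 0] neqs[of 0]
      by (simp add: numeral_2_eq_2)
    then show ?thesis ..
  next
    case 2
    have "{u t, u (t + 1)} \<in> zero_edges" for t
    proof -
      have "u (t + 4) = u t" "u (t + 5) = u (t + 1)"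
        using per[of t] per[of "t + 1"] 2 by (simp_all add: ac_simps)
      then show ?thesis
        using four_cycle_edge[of "c t" "c (t + 1)" "c (t + 2)" "c (t + 3)" "u t" "u (t + 1)" "u (t + 2)" "u (t + 3)"]
          c(1) step[of t] neq[of t] neqs[of t] by simp
    qed
    then have "21 \<le> weight {u t, u (Suc t)}" for t
      by (simp add: weight_def)
    from sum[OF this] show ?thesis
      using 2 by simp
  next
    case 3
    have "u 5 = u 0" "u 6 = u 1"
      using per[of 0] per[of 1] 3 by simp_all
    then have False
      using no_five_cycle[of "c 0" "c 1" "c 2" "c 3" "c 4" "u 0" "u 1" "u 2" "u 3" "u 4"]
        c(1) step[of 0] neq[of 0] neqs[of 0] by (simp add: numeral_2_eq_2)
    then show ?thesis ..
  next
    case 4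
    have "{u t, u (t + 1)} \<in> hexagon_edges" for t
    proof -
      have "u (t + 6) = u t" "u (t + 7) = u (t + 1)"
        using per[of t] per[of "t + 1"] 4 by (simp_all add: ac_simps)
      then show ?thesis
        using six_cycle_edge[of "c t" "c (t + 1)" "c (t + 2)" "c (t + 3)" "c (t + 4)" "c (t + 5)"
            "u t" "u (t + 1)" "u (t + 2)" "u (t + 3)" "u (t + 4)" "u (t + 5)"]
          p3 c(1) step[of t] neq[of t] neqs[of t] by simp
    qed
    then have "14 \<le> weight {u t, u (Suc t)}" for t
      by (simp add: weight_def)
    from sum[OF this] show ?thesis
      using 4 by simp
  next
    case 5
    have "12 \<le> weight {u t, u (Suc t)}" for t
      by (simp add: weight_def)
    from sum[OF this] show ?thesis
      using 5 by simp
  qed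
qed

end

section \<open>Counting vertices and edges\<close>

context markoff
begin

abbreviation F :: "int set" where "F \<equiv> {0..<P}"

lemma card_square_roots:
  assumes "T \<subseteq> F" "\<And>z z'. z \<in> T \<Longrightarrow> z' \<in> T \<Longrightarrow> P dvd z\<^sup>2 - z'\<^sup>2"
  shows "card T \<le> 2"
proof (cases "T = {}")
  case False
  then obtain w where w: "w \<in> T"
    by blast
  have "z = w \<or> z = (- w) mod P" if z: "z \<in> T" for z
  proof -
    have "P dvd (z - w) * (z + w)"
      using assms(2)[OF z w] by (simp add: algebra_simps power2_eq_square)
    then consider "P dvd z - w" | "P dvd z - (- w)"
      using dvd_mult by auto
    then show ?thesis
    proof cases
      case 1
      then show ?thesis
        using residue_eqI assms(1) w z by blast
    next
      case 2
      then have "z mod P = (- w) mod P"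
        by (simp add: mod_eq_dvd_iff)
      then show ?thesis
        using assms(1) z by auto
    qed
  qed
  then have "T \<subseteq> {w, (- w) mod P}"
    by blast
  then have "card T \<le> card {w, (- w) mod P}"
    by (intro card_mono) auto
  also have "\<dots> \<le> 2"
    by (simp add: card_insert_if)
  finally show ?thesis .
qed simp

lemma card_square_fibres:
  assumes "T \<subseteq> S \<times> F" "finite S"
    and "\<And>y z z'. (y, z) \<in> T \<Longrightarrow> (y, z') \<in> T \<Longrightarrow> P dvd z\<^sup>2 - z'\<^sup>2"
  shows "finite T" "card T \<le> 2 * card S"
proof -
  have T: "T = (SIGMA y:S. {z. (y, z) \<in> T})"
    using assms(1) by auto
  have sub: "{z. (y, z) \<in> T} \<subseteq> F" for y
    using assms(1) by auto
  have "card {z. (y, z) \<in> T} \<le> 2" for y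
    by (rule card_square_roots[OF sub]) (use assms(3) in auto)
  then have "(\<Sum>y\<in>S. card {z. (y, z) \<in> T}) \<le> (\<Sum>y\<in>S. 2)"
    by (intro sum_mono)
  moreover have "card T = (\<Sum>y\<in>S. card {z. (y, z) \<in> T})"
    using assms(2) finite_subset[OF sub] by (subst T) (simp add: card_SigmaI)
  ultimately show "card T \<le> 2 * card S"
    by simp
  show "finite T"
    using assms by (intro finite_subset[OF assms(1)]) auto
qed

lemma edge_determined:
  assumes ax: "axes i j k" and "adj i v w" "adj i v' w'" "co j v = co j v'" "co k v = co k v'"
  shows "{v, w} = {v', w'}"
proof (cases "v' = v")
  case True
  then show ?thesis
    using adj_unique[of i v w w'] assms ax by (auto simp: axes_def)
next
  case False
  then have "adj i v v'"
    using assms adj_axes[OF ax] by auto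
  then have "w = v'"
    using adj_unique[of i v w v'] assms(2) ax by (auto simp: axes_def)
  moreover have "w' = v"
    using adj_unique[of i v' w' v] assms(3) adj_sym[OF \<open>adj i v v'\<close>] ax by (auto simp: axes_def)
  ultimately show ?thesis
    by blast
qed

text \<open>An edge in direction \<open>i\<close> joins the two points over its pair of constant
  coordinates, so admissible pairs bound the number of edges.\<close>

lemma card_edges_le:
  assumes ax: "axes i j k" and R: "finite R"
    and A: "\<And>e. e \<in> A \<Longrightarrow> \<exists>v w. e = {v, w} \<and> adj i v w \<and> (co j v, co k v) \<in> R"
  shows "card A \<le> card R"
proof -
  obtain g h where gh: "\<And>e. e \<in> A \<Longrightarrow> e = {g e, h e} \<and> adj i (g e) (h e) \<and> (co j (g e), co k (g e)) \<in> R"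
    using A by metis
  have "inj_on (\<lambda>e. (co j (g e), co k (g e))) A"
    using gh edge_determined[OF ax] by (intro inj_onI) (metis prod.inject)
  then show ?thesis
    using gh R by (intro card_inj_on_le) auto
qed

definition all_axes :: "(nat \<times> nat \<times> nat) set" where
  "all_axes = {(0, 1, 2), (0, 2, 1), (1, 0, 2), (1, 2, 0), (2, 0, 1), (2, 1, 0)}"

lemma all_axes: "(i, j, k) \<in> all_axes \<longleftrightarrow> axes i j k"
proof
  assume "axes i j k"
  then show "(i, j, k) \<in> all_axes"
    by (rule axes_cases) (simp_all add: all_axes_def)
qed (auto simp: all_axes_def axes_def)

lemma card_UN_axes:
  assumes "\<And>i j k. axes i j k \<Longrightarrow> card (A i j k) \<le> n"
    and "B \<subseteq> (\<Union>(i, j, k)\<in>all_axes. A i j k)"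
    and "\<And>i j k. axes i j k \<Longrightarrow> finite (A i j k)"
  shows "card B \<le> 6 * n"
proof -
  have fin: "finite all_axes" and c: "card all_axes = 6"
    by (simp_all add: all_axes_def)
  have "card B \<le> card (\<Union>(i, j, k)\<in>all_axes. A i j k)"
    using assms all_axes fin by (intro card_mono) auto
  also have "\<dots> \<le> (\<Sum>x\<in>all_axes. card (case x of (i, j, k) \<Rightarrow> A i j k))"
    by (rule card_UN_le[OF fin])
  also have "\<dots> \<le> (\<Sum>x\<in>all_axes. n)"
    using assms(1) all_axes by (intro sum_mono) auto
  finally show ?thesis
    using c by simp
qed

lemma finite_V: "finite V"
proof (rule finite_subset)
  show "V \<subseteq> F \<times> F \<times> F"
    by (auto simp: V_iff)
qed simp

lemma finite_Edge: "finite (Edge i)"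
proof (rule finite_subset)
  show "Edge i \<subseteq> Pow V"
    by (auto simp: Edge_def adj_def)
qed (simp add: finite_V)

definition fixed :: "nat \<Rightarrow> int triple set" where
  "fixed i = {v \<in> V. vieta_jump i v = v}"

lemma Edge_member:
  assumes "e \<in> Edge i" "x \<in> e"
  obtains w where "e = {x, w}" "adj i x w"
proof -
  obtain v w where vw: "e = {v, w}" "adj i v w"
    using assms(1) unfolding Edge_def by blast
  then consider "x = v" | "x = w"
    using assms(2) by blast
  then show thesis
  proof cases
    case 1
    then show ?thesis
      using that vw by blast
  next
    case 2
    then show ?thesis
      using that[of v] vw adj_sym by (simp add: insert_commute)
  qed
qed

text \<open>The edges in direction \<open>i\<close> are the two-element orbits of an involution on
  \<open>V\<close>, and the remaining vertices are its fixed points.\<close>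

lemma card_Edge:
  assumes i: "i < 3"
  shows "2 * card (Edge i) + card (fixed i) = card V"
proof -
  have "\<Union>(Edge i) = V - fixed i"
  proof (intro subset_antisym subsetI)
    fix v assume "v \<in> \<Union>(Edge i)"
    then obtain w where "adj i v w"
      using adj_sym unfolding Edge_def by blast
    then show "v \<in> V - fixed i"
      using adj_vieta_jump[OF i] by (auto simp: fixed_def)
  next
    fix v assume "v \<in> V - fixed i"
    then have "adj i v (vieta_jump i v)"
      using adj_vieta_jump[OF i] by (auto simp: fixed_def)
    then show "v \<in> \<Union>(Edge i)"
      unfolding Edge_def by blast
  qed
  moreover have "card (\<Union>(Edge i)) = sum card (Edge i)"
  proof (rule card_Union_disjoint)
    show "pairwise disjnt (Edge i)"
    proof (rule pairwiseI)
      fix e e' assume e: "e \<in> Edge i" "e' \<in> Edge i" "e \<noteq> e'"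
      have "e = e'" if x: "x \<in> e" "x \<in> e'" for x
      proof -
        obtain w where "e = {x, w}" "adj i x w"
          using Edge_member[OF e(1) x(1)] by blast
        moreover obtain w' where "e' = {x, w'}" "adj i x w'"
          using Edge_member[OF e(2) x(2)] by blast
        ultimately show ?thesis
          using adj_unique[OF i] by blast
      qed
      then show "disjnt e e'"
        using e(3) by (auto simp: disjnt_def)
    qed
  qed (auto simp: Edge_def)
  moreover have "sum card (Edge i) = sum (\<lambda>_. 2) (Edge i)"
    by (rule sum.cong) (auto simp: Edge_def adj_def)
  moreover have "fixed i \<subseteq> V"
    by (auto simp: fixed_def)
  ultimately have "card V - card (fixed i) = 2 * card (Edge i)" "card (fixed i) \<le> card V"
    using card_Diff_subset[of "fixed i" V] finite_V finite_subset[of "fixed i" V] card_mono[OF finite_V]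
    by auto
  then show ?thesis
    by linarith
qed

lemma Edge_disjoint:
  assumes "i < 3" "l < 3" "i \<noteq> l"
  shows "Edge i \<inter> Edge l = {}"
proof (rule equals0I)
  fix e assume "e \<in> Edge i \<inter> Edge l"
  then obtain v w v' w' where "e = {v, w}" "adj i v w" "e = {v', w'}" "adj l v' w'"
    unfolding Edge_def by blast
  then have "adj i v w" "adj l v w"
    using adj_sym by (metis doubleton_eq_iff)+
  then show False
    using adj_coord_neq(1)[OF assms(1), of v w] assms by (simp add: adj_def)
qed

lemma card_edges_vertices:
  "2 * card (proper_edges (markoff_graph p)) + (\<Sum>i<3. card (fixed i)) = 3 * card V"
proof -
  have "card (proper_edges (markoff_graph p)) = (\<Sum>i<3. card (Edge i))"
    unfolding proper_edges_eq by (rule card_UN_disjoint) (auto simp: finite_Edge Edge_disjoint)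
  then have "2 * card (proper_edges (markoff_graph p)) + (\<Sum>i<3. card (fixed i)) =
      (\<Sum>i<3. 2 * card (Edge i) + card (fixed i))"
    by (simp add: sum.distrib sum_distrib_left)
  also have "\<dots> = (\<Sum>i<3::nat. card V)"
    by (rule sum.cong) (auto simp: card_Edge)
  finally show ?thesis
    by simp
qed

lemma solve_linear:
  assumes "\<not> P dvd a"
  obtains t where "t \<in> F" "P dvd t * a - b"
proof -
  have "coprime a P"
    using prime_imp_coprime[OF P_prime assms] by (simp add: coprime_commute)
  then obtain s where "[a * s = 1] (mod P)"
    using cong_solve_coprime_int by blast
  then have s: "P dvd a * s - 1"
    by (simp add: cong_iff_dvd_diff)
  have "P dvd (b * s) mod P - b * s"
    by (simp add: mod_eq_dvd_iff[symmetric])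
  then have "P dvd ((b * s) mod P) * a - b"
    by (rule dvd_combine2[OF _ s, of _ _ a b]) (simp add: algebra_simps)
  then show thesis
    using that[of "(b * s) mod P"] P_gt by simp
qed

text \<open>A fixed point has a double root in coordinate \<open>i\<close>. With \<open>b\<close>
  and \<open>c\<close> the other coordinates, the vanishing discriminant reads
  \<open>(b\<^sup>2 - 4) * c\<^sup>2 = 4 * b\<^sup>2\<close> modulo \<open>P\<close>. Here
  \<open>b = 0\<close> would give the origin, and \<open>b\<^sup>2 = 4\<close> would give
  \<open>b = 0\<close>. So each of the \<open>p - 1\<close> values of \<open>b\<close> admits at
  most two values of \<open>c\<close>, and the pair determines the point.\<close>

lemma card_fixed:
  assumes i: "i < 3" and p3: "p > 3"
  shows "card (fixed i) \<le> 2 * (p - 1)"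
proof -
  obtain j k where ax: "axes i j k"
    using ex_axes i by blast
  have ax': "axes j k i" "axes k i j"
    using ax axes_rotate by blast+
  let ?f = "\<lambda>v :: int triple. (co j v, co k v)"
  have fx: "P dvd 2 * co i v - co j v * co k v" if "v \<in> fixed i" for v
  proof -
    have "co i v = (co j v * co k v - co i v) mod P"
      using that vieta_jump_co(1)[OF ax, of v] by (simp add: fixed_def)
    then have "P dvd co i v - (co j v * co k v - co i v)"
      by (metis mod_eq_dvd_iff mod_mod_trivial)
    then show ?thesis
      by (simp add: algebra_simps)
  qed
  have V: "v \<in> V" if "v \<in> fixed i" for v
    using that by (simp add: fixed_def)
  have inj: "inj_on ?f (fixed i)"
  proof (rule inj_onI)
    fix v w assume vw: "v \<in> fixed i" "w \<in> fixed i" "?f v = ?f w"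
    then have "P dvd 2 * (co i v - co i w)"
      by (intro dvd_combine2[OF fx[OF vw(1)] fx[OF vw(2)], of _ 1 "-1"]) simp
    then have "co i v = co i w"
      using two_invertible[OF p3] residue_eqI V_axes(1)[OF ax] V vw by blast
    then show "v = w"
      using vw(3) by (intro triple_eqI[OF ax]) auto
  qed
  have key: "P dvd ((co j v)\<^sup>2 - 4) * (co k v)\<^sup>2 - 4 * (co j v)\<^sup>2" if "v \<in> fixed i" for v
    by (rule dvd_combine2[OF V_axes(2)[OF ax V[OF that]] fx[OF that], of _ "-4" "2 * co i v - co j v * co k v"])
      (simp add: algebra_simps power2_eq_square)
  have j0: "co j v \<noteq> 0" if v: "v \<in> fixed i" for v
  proof
    assume 0: "co j v = 0"
    then have i0: "co i v = 0"
    proof -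
      have "P dvd 2 * co i v"
        using fx[OF v] 0 by simp
      then show ?thesis
        using two_invertible[OF p3] residue_0 V_axes(1)[OF ax V[OF v]] by blast
    qed
    then have "P dvd (co k v)\<^sup>2"
      using 0 V_axes(2)[OF ax V[OF v]] by simp
    then have "co k v = 0"
      using dvd_sq residue_0 V_axes(1)[OF ax'(2) V[OF v]] by blast
    then show False
      using 0 i0 V_axes(3)[OF ax V[OF v]] by blast
  qed
  have "card (fixed i) = card (?f ` fixed i)"
    using inj by (simp add: card_image)
  also have "\<dots> \<le> 2 * card {1..<P}"
  proof (rule card_square_fibres(2))
    show "?f ` fixed i \<subseteq> {1..<P} \<times> F"
    proof
      fix x assume "x \<in> ?f ` fixed i"
      then obtain v where v: "x = ?f v" "v \<in> fixed i"
        by blast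
      then show "x \<in> {1..<P} \<times> F"
        using j0[OF v(2)] V_axes(1)[OF ax'(1) V[OF v(2)]] V_axes(1)[OF ax'(2) V[OF v(2)]] by auto
    qed
    fix y z z' assume "(y, z) \<in> ?f ` fixed i" "(y, z') \<in> ?f ` fixed i"
    then obtain v w where vw: "v \<in> fixed i" "w \<in> fixed i" "co j v = y" "co j w = y" "co k v = z" "co k w = z'"
      by auto
    have k: "P dvd (y\<^sup>2 - 4) * z\<^sup>2 - 4 * y\<^sup>2" "P dvd (y\<^sup>2 - 4) * z'\<^sup>2 - 4 * y\<^sup>2"
      using key[OF vw(1)] key[OF vw(2)] unfolding vw(3-6) by blast+
    have "\<not> P dvd y\<^sup>2 - 4"
    proof
      assume "P dvd y\<^sup>2 - 4"
      then have "P dvd 2 * (2 * y\<^sup>2)"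
        by (rule dvd_combine2[OF _ k(1), of _ _ "z\<^sup>2" "-1"]) (simp add: algebra_simps)
      then have "P dvd y\<^sup>2"
        by (intro two_invertible[OF p3, of "y\<^sup>2"] two_invertible[OF p3, of "2 * y\<^sup>2"])
      then have "P dvd co j v"
        unfolding vw(3) dvd_sq .
      then show False
        using j0[OF vw(1)] residue_0[OF V_axes(1)[OF ax'(1) V[OF vw(1)]]] by blast
    qed
    moreover have "P dvd (y\<^sup>2 - 4) * (z\<^sup>2 - z'\<^sup>2)"
      by (rule dvd_combine2[OF k, of _ 1 "-1"]) (simp add: algebra_simps)
    ultimately show "P dvd z\<^sup>2 - z'\<^sup>2"
      using dvd_mult by blast
  qed auto
  finally show ?thesis
    by (simp add: nat_diff_distrib)
qed

text \<open>A point of the surface with nonzero coordinates is \<open>(tu, tv, t)\<close> with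
  \<open>t = (u\<^sup>2 + v\<^sup>2 + 1) / (uv)\<close>.\<close>

lemma card_V:
  assumes p3: "p > 3"
  shows "(p - 1) * (p - 3) \<le> card V"
proof -
  let ?U = "{1..<P} \<times> {1..<P}"
  \<comment> \<open>The pairs with \<open>t = 0\<close>, which would yield the origin. There are at
    most \<open>2 * (p - 1)\<close> of them among \<open>(p - 1) * (p - 1)\<close>; for the others
    \<open>t\<close> can be cancelled, so the parametrization is injective.\<close>
  define C where "C = {(u, v). (u, v) \<in> ?U \<and> P dvd u\<^sup>2 + v\<^sup>2 + 1}"
  have cU: "card {1..<P} = p - 1"
    by (simp add: nat_diff_distrib)
  have C: "finite C" "card C \<le> 2 * card {1..<P}"
  proof -
    have *: "C \<subseteq> {1..<P} \<times> F"
      by (auto simp: C_def)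
    have "P dvd z\<^sup>2 - z'\<^sup>2" if "(y, z) \<in> C" "(y, z') \<in> C" for y z z'
    proof -
      have "P dvd y\<^sup>2 + z\<^sup>2 + 1" "P dvd y\<^sup>2 + z'\<^sup>2 + 1"
        using that by (auto simp: C_def)
      then show ?thesis
        by (rule dvd_combine2[of _ _ _ _ 1 "-1"]) simp
    qed
    then show "finite C" "card C \<le> 2 * card {1..<P}"
      using card_square_fibres[OF *] by auto
  qed
  have nz: "\<not> P dvd u" if "u \<in> {1..<P}" for u
    using that residue_0[of u] by auto
  have "\<exists>t. t \<in> F \<and> P dvd t * (u * v) - (u\<^sup>2 + v\<^sup>2 + 1)" if "(u, v) \<in> ?U" for u v
  proof -
    have "\<not> P dvd u * v"
      using that nz dvd_mult by auto
    then show ?thesis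
      using solve_linear by metis
  qed
  then obtain t where t: "\<And>u v. (u, v) \<in> ?U \<Longrightarrow> t u v \<in> F \<and> P dvd t u v * (u * v) - (u\<^sup>2 + v\<^sup>2 + 1)"
    by metis
  define f where "f = (\<lambda>(u, v). (t u v * u mod P, t u v * v mod P, t u v))"
  have tn: "\<not> P dvd t u v" if "(u, v) \<in> ?U - C" for u v
  proof
    assume d: "P dvd t u v"
    have "P dvd u\<^sup>2 + v\<^sup>2 + 1"
      by (rule dvd_combine2[OF d, of "t u v * (u * v) - (u\<^sup>2 + v\<^sup>2 + 1)" _ "u * v" "-1"]) (use that t in auto)
    then show False
      using that by (auto simp: C_def)
  qed
  have inj: "inj_on f (?U - C)"
  proof (rule inj_onI)
    fix a b assume ab: "a \<in> ?U - C" "b \<in> ?U - C" "f a = f b"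
    obtain u v u' v' where uv: "a = (u, v)" "b = (u', v')"
      by fastforce
    then have eq: "t u v = t u' v'" "P dvd t u v * u - t u v * u'" "P dvd t u v * v - t u v * v'"
      using ab(3) by (auto simp: f_def mod_eq_dvd_iff)
    have "P dvd t u v * (u - u')" "P dvd t u v * (v - v')"
      using eq by (simp_all add: algebra_simps)
    then have "P dvd u - u'" "P dvd v - v'"
      using tn[of u v] ab uv dvd_mult by blast+
    then show "a = b"
      using residue_eqI[of u u'] residue_eqI[of v v'] ab uv by auto
  qed
  have "f ` (?U - C) \<subseteq> V"
  proof
    fix x assume "x \<in> f ` (?U - C)"
    then obtain u v where uv: "(u, v) \<in> ?U - C" "x = f (u, v)"
      by auto
    define s where "s = t u v"
    have s: "s \<in> F" "P dvd s * (u * v) - (u\<^sup>2 + v\<^sup>2 + 1)" "s \<noteq> 0"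
      using t tn[OF uv(1)] uv(1) by (auto simp: s_def)
    have d: "P dvd (s * u)\<^sup>2 + (s * v)\<^sup>2 + s\<^sup>2 - (s * u) * (s * v) * s"
      by (rule dvd_combine2[OF s(2) s(2), of _ "- s\<^sup>2" 0]) (simp add: algebra_simps power2_eq_square)
    have "[(s * u mod P)\<^sup>2 + (s * v mod P)\<^sup>2 + s\<^sup>2 - (s * u mod P) * (s * v mod P) * s =
        (s * u)\<^sup>2 + (s * v)\<^sup>2 + s\<^sup>2 - (s * u) * (s * v) * s] (mod P)"
      by (intro cong_add cong_diff cong_mult cong_pow) (simp_all add: cong_def)
    then have "P dvd (s * u mod P)\<^sup>2 + (s * v mod P)\<^sup>2 + s\<^sup>2 - (s * u mod P) * (s * v mod P) * s"
      using d cong_dvd_iff by blast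
    then have "(s * u mod P, s * v mod P, s) \<in> V"
      using s(1,3) P_gt by (simp add: V_iff)
    then show "x \<in> V"
      using uv(2) by (simp add: f_def s_def)
  qed
  then have "card (?U - C) \<le> card V"
    using inj finite_V by (intro card_inj_on_le)
  moreover have "card (?U - C) = card ?U - card C"
    using C by (intro card_Diff_subset) (auto simp: C_def)
  moreover have "card ?U = (p - 1) * (p - 1)"
    using cU by (simp add: card_cartesian_product)
  moreover have "(p - 1) * (p - 3) = (p - 1) * (p - 1) - 2 * (p - 1)"
    using p3 by (simp add: diff_mult_distrib2[symmetric] mult.commute[of 2])
  ultimately show ?thesis
    using C(2) cU by linarith
qed

text \<open>If one constant coordinate is 0, the other is not, because otherwise the vertex would be
  the origin; this leaves \<open>p - 1\<close> pairs for each of the six permutations.\<close>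

lemma card_zero_edges: "card zero_edges \<le> 6 * (p - 1)"
proof (rule card_UN_axes)
  let ?A = "\<lambda>i j k. {{v, w} | v w. adj i v w \<and> co j v = 0}"
  show "zero_edges \<subseteq> (\<Union>(i, j, k)\<in>all_axes. ?A i j k)"
    unfolding zero_edges_def using all_axes by blast
  fix i j k assume ax: "axes i j k"
  show "finite (?A i j k)"
    by (rule finite_subset[OF _ finite_Edge[of i]]) (unfold Edge_def, blast)
  have "card (?A i j k) \<le> card ({0::int} \<times> {1..<P})"
  proof (rule card_edges_le[OF ax])
    fix e assume "e \<in> ?A i j k"
    then obtain v w where e: "e = {v, w}" "adj i v w" "co j v = 0"
      by blast
    have v: "v \<in> V"
      using e(2) by (simp add: adj_def)
    have axk: "axes k i j"
      using ax axes_rotate by blast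
    have "co k v \<noteq> 0"
    proof
      assume 0: "co k v = 0"
      then have "P dvd (co i v)\<^sup>2"
        using V_axes(2)[OF ax v] e(3) by simp
      then have "co i v = 0"
        using dvd_sq residue_0 V_axes(1)[OF ax v] by blast
      then show False
        using V_axes(3)[OF ax v] 0 e(3) by blast
    qed
    then have "(co j v, co k v) \<in> {0::int} \<times> {1..<P}"
      using V_axes(1)[OF axk v] e(3) by auto
    then show "\<exists>v w. e = {v, w} \<and> adj i v w \<and> (co j v, co k v) \<in> {0::int} \<times> {1..<P}"
      using e by blast
  qed simp
  then show "card (?A i j k) \<le> p - 1"
    by (simp add: card_cartesian_product nat_diff_distrib)
qed

lemma card_hexagon_edges: "card hexagon_edges \<le> 24 * p"
proof -
  let ?A = "\<lambda>i j k. {{v, w} | v w. adj i v w \<and> P dvd (co j v)\<^sup>2 - 1}"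
  let ?B = "\<lambda>i j k. {{v, w} | v w. adj i v w \<and> P dvd (co j v)\<^sup>2 + (co k v)\<^sup>2 - 3}"
  have "card hexagon_edges \<le> 6 * (4 * p)"
  proof (rule card_UN_axes)
    show "hexagon_edges \<subseteq> (\<Union>(i, j, k)\<in>all_axes. ?A i j k \<union> ?B i j k)"
      unfolding hexagon_edges_def using all_axes by blast
    fix i j k assume ax: "axes i j k"
    have ax': "axes i k j" "axes j k i" "axes k i j"
      using ax by (auto simp: axes_def)
    show "finite (?A i j k \<union> ?B i j k)"
      by (rule finite_subset[OF _ finite_Edge[of i]]) (unfold Edge_def, blast)
    have V: "(co j v, co k v) \<in> F \<times> F" "(co k v, co j v) \<in> F \<times> F" if "adj i v w" for v w
      using V_axes(1)[OF ax'(2), of v] V_axes(1)[OF ax'(3), of v] that by (auto simp: adj_def)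
    \<comment> \<open>The pairs in \<open>R\<close> have the free coordinate first, because
      \<open>card_square_fibres\<close> bounds the second component given the first. Each set
      contributes \<open>2 * p\<close> pairs.\<close>
    define R S where "R = {(c, b). c \<in> F \<and> b \<in> F \<and> P dvd b\<^sup>2 - 1}"
      and "S = {(b, c). b \<in> F \<and> c \<in> F \<and> P dvd b\<^sup>2 + c\<^sup>2 - 3}"
    have R: "finite R" "card R \<le> 2 * card F"
    proof -
      have "R \<subseteq> F \<times> F"
        by (auto simp: R_def)
      moreover have "P dvd z\<^sup>2 - z'\<^sup>2" if "(y, z) \<in> R" "(y, z') \<in> R" for y z z'
      proof -
        have "P dvd z\<^sup>2 - 1" "P dvd z'\<^sup>2 - 1"
          using that by (auto simp: R_def)
        then show ?thesis
          by (rule dvd_combine2[of _ _ _ _ 1 "-1"]) simp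
      qed
      ultimately show "finite R" "card R \<le> 2 * card F"
        using card_square_fibres[of R F] by auto
    qed
    have S: "finite S" "card S \<le> 2 * card F"
    proof -
      have "S \<subseteq> F \<times> F"
        by (auto simp: S_def)
      moreover have "P dvd z\<^sup>2 - z'\<^sup>2" if "(y, z) \<in> S" "(y, z') \<in> S" for y z z'
      proof -
        have "P dvd y\<^sup>2 + z\<^sup>2 - 3" "P dvd y\<^sup>2 + z'\<^sup>2 - 3"
          using that by (auto simp: S_def)
        then show ?thesis
          by (rule dvd_combine2[of _ _ _ _ 1 "-1"]) simp
      qed
      ultimately show "finite S" "card S \<le> 2 * card F"
        using card_square_fibres[of S F] by auto
    qed
    have "card (?A i j k) \<le> card R"
    proof (rule card_edges_le[OF ax'(1) R(1)])
      fix e assume "e \<in> ?A i j k"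
      then obtain v w where e: "e = {v, w}" "adj i v w" "P dvd (co j v)\<^sup>2 - 1"
        by blast
      then have "(co k v, co j v) \<in> R"
        using V(2)[OF e(2)] by (simp add: R_def)
      then show "\<exists>v w. e = {v, w} \<and> adj i v w \<and> (co k v, co j v) \<in> R"
        using e by blast
    qed
    moreover have "card (?B i j k) \<le> card S"
    proof (rule card_edges_le[OF ax S(1)])
      fix e assume "e \<in> ?B i j k"
      then obtain v w where e: "e = {v, w}" "adj i v w" "P dvd (co j v)\<^sup>2 + (co k v)\<^sup>2 - 3"
        by blast
      then have "(co j v, co k v) \<in> S"
        using V(1)[OF e(2)] by (simp add: S_def)
      then show "\<exists>v w. e = {v, w} \<and> adj i v w \<and> (co j v, co k v) \<in> S"
        using e by blast
    qed
    moreover have "card F = p"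
      by simp
    ultimately show "card (?A i j k \<union> ?B i j k) \<le> 4 * p"
      using R(2) S(2) card_Un_le[of "?A i j k" "?B i j k"] by linarith
  qed
  then show ?thesis
    by simp
qed

end

section \<open>Planarity\<close>

context markoff
begin

lemma markoff_graph_wf:
  "fst (markoff_graph p) = V" "finite E" "\<Union>E \<subseteq> V"
proof -
  show "fst (markoff_graph p) = V"
    by (simp add: markoff_graph_def V_def)
  show "finite E"
    unfolding proper_edges_eq by (simp add: finite_Edge)
  show "\<Union>E \<subseteq> V"
    unfolding proper_edges_eq Edge_def adj_def by blast
qed

lemma plane_graphI:
  assumes "plane_drawing (markoff_graph p) pos \<gamma>"
  shows "plane_graph V E pos \<gamma>"
  using plane_drawing_imp_plane_graph[OF assms] markoff_graph_wf by simp

lemma special_edges_finite: "finite zero_edges" "finite hexagon_edges"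
proof -
  have "zero_edges \<subseteq> E"
    unfolding zero_edges_def proper_edges_eq Edge_def axes_def by blast
  moreover have "hexagon_edges \<subseteq> E"
    unfolding hexagon_edges_def proper_edges_eq Edge_def axes_def by blast
  ultimately show "finite zero_edges" "finite hexagon_edges"
    using markoff_graph_wf(2) finite_subset by blast+
qed

lemma sum_weight: "sum weight E \<le> 12 * card E + 9 * card zero_edges + 2 * card hexagon_edges"
proof -
  have "sum weight E = 12 * card E + 9 * card (E \<inter> zero_edges) + 2 * card (E \<inter> hexagon_edges)"
    using markoff_graph_wf(2) unfolding weight_def
    by (simp add: sum.distrib sum.If_cases)
  moreover have "card (E \<inter> zero_edges) \<le> card zero_edges" "card (E \<inter> hexagon_edges) \<le> card hexagon_edges"
    using special_edges_finite by (auto intro: card_mono)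
  ultimately show ?thesis
    by linarith
qed

theorem not_planar_large:
  assumes p: "67 \<le> p"
  shows "\<not> planar (markoff_graph p)"
proof
  assume "planar (markoff_graph p)"
  then obtain pos \<gamma> where "plane_drawing (markoff_graph p) pos \<gamma>"
    unfolding planar_def by blast
  then interpret plane_graph V E pos \<gamma>
    by (rule plane_graphI)
  have "(\<Sum>i<3. card (fixed i)) \<le> (\<Sum>i<3::nat. 2 * (p - 1))"
    using p by (intro sum_mono card_fixed) auto
  then have L: "(\<Sum>i<3. card (fixed i)) \<le> 6 * (p - 1)"
    by simp
  have V: "(p - 1) * (p - 3) \<le> card V"
    using p by (intro card_V) simp
  define q where "q = int p"
  have q: "67 \<le> q"
    using p by (simp add: q_def)
  have "int ((p - 1) * (p - 3)) = (q - 1) * (q - 3)"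
    using p by (simp add: q_def of_nat_diff)
  then have V': "(q - 1) * (q - 3) \<le> int (card V)"
    using V by linarith
  have "0 \<le> (q - 67) * q" "0 \<le> (q - 67) * (q - 67)"
    using q by simp_all
  \<comment> \<open>Inserting all bounds into Euler's inequality gives 6 |V| \<le> 384 q - 456, that
    is |V| \<le> 64 q - 76, while |V| \<ge> q^2 - 4 q + 3. The difference of the two bounds is this
    polynomial; its larger root lies between 66 and 67. Positivity follows from (q - 1) (q - 67)
    \<ge> 0.\<close>
  then have qq: "q * q - 68 * q + 79 > 0"
    by (simp add: algebra_simps)
  have EV: "2 * card E + (\<Sum>i<3. card (fixed i)) = 3 * card V"
    by (rule card_edges_vertices)
  have le: "int (card V) \<ge> q * q - 4 * q + 3"
    using V' by (simp add: algebra_simps)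
  have "int (6 * (p - 1)) = 6 * q - 6"
    using p by (simp add: q_def of_nat_diff)
  then have L': "int (\<Sum>i<3. card (fixed i)) \<le> 6 * q - 6"
    using L by linarith
  \<comment> \<open>Secures the second face that \<open>euler_weights\<close> relies on.\<close>
  have VE: "card V \<le> card E"
    using EV le L' qq q by linarith
  have "card V \<noteq> 0"
    using le qq q by linarith
  then have "V \<noteq> {}"
    by auto
  then have "84 * (card E + 2) \<le> 2 * sum weight E + 84 * card V"
    using VE finite_V markoff_graph_wf(3) cycle_weight p by (intro euler_weights) auto
  then have "84 * card E + 168 \<le> 2 * sum weight E + 84 * card V"
    by (simp add: add_mult_distrib2)
  then have "84 * card E + 168 \<le> 24 * card E + 18 * card zero_edges + 4 * card hexagon_edges + 84 * card V"
    using sum_weight by linarith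
  then have "60 * card E + 168 \<le> 108 * (p - 1) + 96 * p + 84 * card V"
    using card_zero_edges card_hexagon_edges by linarith
  then have "60 * int (card E) + 168 \<le> 204 * q - 108 + 84 * int (card V)"
    using p by (simp add: q_def)
  moreover have "2 * int (card E) + int (\<Sum>i<3. card (fixed i)) = 3 * int (card V)"
    using EV by linarith
  ultimately show False
    using le L' qq by linarith
qed

end

section \<open>Certificates for the small primes\<close>

fun on_surface :: "int \<Rightarrow> int triple \<Rightarrow> bool" where
  "on_surface q (x, y, z) \<longleftrightarrow> 0 \<le> x \<and> x < q \<and> 0 \<le> y \<and> y < q \<and> 0 \<le> z \<and> z < q \<and>
     (x, y, z) \<noteq> (0, 0, 0) \<and> (x * x + y * y + z * z - x * y * z) mod q = 0"

fun jumps :: "int \<Rightarrow> int triple \<Rightarrow> int triple list" where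
  "jumps q (x, y, z) = [((y * z - x) mod q, y, z), (x, (x * z - y) mod q, z), (x, y, (x * y - z) mod q)]"

text \<open>The surface equation is tested at the branch vertices only, since jumps preserve it.
  \<open>jumps\<close> also lists the vertex itself in the case of a loop, but distinctness keeps
  loops out of the paths.\<close>

definition K33_certificate :: "int \<Rightarrow> int triple list \<Rightarrow> int triple list list \<Rightarrow> bool" where
  "K33_certificate q bs ps \<longleftrightarrow> list_all (on_surface q) bs \<and> K33_subdivision (\<lambda>v w. w \<in> set (jumps q v)) bs ps"

context markoff
begin

lemma on_surface_V: "on_surface P v \<Longrightarrow> v \<in> V"
  by (cases v) (auto simp: V_iff power2_eq_square mod_eq_0_iff_dvd)

lemma set_jumps: "set (jumps P v) = (\<lambda>i. vieta_jump i v) ` {..<3}"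
proof -
  obtain x y z where v: "v = (x, y, z)"
    by (cases v)
  have "vieta_jump 0 v = ((y * z - x) mod P, y, z)" "vieta_jump 1 v = (x, (x * z - y) mod P, z)"
    "vieta_jump 2 v = (x, y, (x * y - z) mod P)"
    by (simp_all add: v vieta_jump_def move_eq del: move1.simps move2.simps move3.simps)
  moreover have "{..<3::nat} = {0, 1, 2}"
    by auto
  ultimately show ?thesis
    by (simp add: v)
qed

lemma edge_iff_jump: "{v, w} \<in> E \<longleftrightarrow> v \<in> V \<and> w \<noteq> v \<and> w \<in> set (jumps P v)"
proof -
  have "{v, w} \<in> E \<longleftrightarrow> (\<exists>i<3. v \<in> V \<and> w \<noteq> v \<and> w = vieta_jump i v)"
    unfolding edge_iff using adj_vieta_jump by metis
  then show ?thesis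
    unfolding set_jumps by blast
qed

theorem not_planar_certificate:
  assumes "K33_certificate P bs ps"
  shows "\<not> planar (markoff_graph p)"
proof
  assume "planar (markoff_graph p)"
  then obtain pos \<gamma> where "plane_drawing (markoff_graph p) pos \<gamma>"
    unfolding planar_def by blast
  then interpret plane_graph V E pos \<gamma>
    by (rule plane_graphI)
  have "set bs \<subseteq> V"
    using assms on_surface_V by (auto simp: K33_certificate_def list_all_iff)
  then show False
    using not_K33_subdivision[of "\<lambda>v w. w \<in> set (jumps P v)" bs ps] edge_iff_jump assms
    by (auto simp: K33_certificate_def)
qed

end

text \<open>For 5, 13, 17, 37, 41, 53 and 61 every branch vertex has a coordinate 0, and for 11, 23,
  29 and 43 a coordinate 1 or -1. The proper edges there that keep this coordinate belong to
  \<open>zero_edges\<close> or \<open>hexagon_edges\<close>.\<close>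

lemma K33_certificate_5: "K33_certificate 5
  [(1, 2, 0), (1, 0, 3), (4, 0, 2), (4, 0, 3), (1, 3, 0), (1, 0, 2)]
  [[(4, 2, 0), (4, 2, 3)],
   [],
   [(1, 2, 2)],
   [],
   [(1, 3, 3)],
   [],
   [],
   [(4, 3, 2), (4, 3, 0)],
   []]"
  by code_simp

lemma K33_certificate_11: "K33_certificate 11
  [(10, 1, 4), (7, 1, 1), (10, 4, 1), (10, 1, 6), (5, 1, 1), (10, 6, 1)]
  [[],
   [(5, 1, 4)],
   [(10, 6, 4)],
   [(7, 1, 6)],
   [],
   [(7, 6, 1)],
   [(10, 4, 6)],
   [(5, 4, 1)],
   []]"
  by code_simp

lemma K33_certificate_13: "K33_certificate 13
  [(5, 0, 1), (8, 0, 12), (0, 8, 12), (0, 5, 12), (8, 0, 1), (5, 0, 12)]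
  [[(5, 5, 1), (0, 5, 1)],
   [],
   [],
   [(8, 5, 12)],
   [],
   [],
   [],
   [(0, 8, 1), (8, 8, 1)],
   [(5, 8, 12)]]"
  by code_simp

lemma K33_certificate_17: "K33_certificate 17
  [(0, 16, 13), (13, 16, 0), (4, 1, 0), (4, 16, 0), (13, 1, 0), (0, 16, 4)]
  [[(4, 16, 13)],
   [(0, 1, 13), (13, 1, 13)],
   [],
   [],
   [],
   [(13, 16, 4)],
   [],
   [],
   [(4, 1, 4), (0, 1, 4)]]"
  by code_simp

lemma K33_certificate_19: "K33_certificate 19
  [(7, 14, 14), (6, 6, 9), (14, 7, 14), (10, 8, 14), (8, 10, 14), (6, 6, 8)]
  [[(7, 8, 14)],
   [(18, 14, 14), (18, 10, 14)],
   [(7, 14, 8), (7, 4, 8), (6, 4, 8)],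
   [(10, 6, 9), (10, 8, 9)],
   [(6, 10, 9), (8, 10, 9)],
   [],
   [(14, 18, 14), (10, 18, 14)],
   [(8, 7, 14)],
   [(14, 7, 8), (4, 7, 8), (4, 6, 8)]]"
  by code_simp

lemma K33_certificate_23: "K33_certificate 23
  [(1, 14, 1), (9, 22, 1), (1, 22, 9), (1, 22, 13), (1, 10, 1), (13, 22, 1)]
  [[(1, 14, 13)],
   [],
   [(13, 14, 1)],
   [(9, 22, 13)],
   [(9, 10, 1)],
   [],
   [],
   [(1, 10, 9)],
   [(13, 22, 9)]]"
  by code_simp

lemma K33_certificate_29: "K33_certificate 29
  [(28, 1, 21), (28, 21, 1), (8, 1, 1), (28, 1, 7), (22, 1, 1), (28, 7, 1)]
  [[],
   [(22, 1, 21)],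
   [(28, 7, 21)],
   [(28, 21, 7)],
   [(22, 21, 1)],
   [],
   [(8, 1, 7)],
   [],
   [(8, 7, 1)]]"
  by code_simp

lemma K33_certificate_31: "K33_certificate 31
  [(6, 25, 15), (11, 18, 1), (13, 20, 1), (6, 25, 11), (7, 20, 1), (11, 24, 1)]
  [[],
   [(28, 25, 15), (28, 23, 15), (7, 23, 15), (7, 20, 15)],
   [(6, 3, 15), (8, 3, 15), (8, 24, 15), (11, 24, 15)],
   [(11, 18, 11), (11, 10, 11), (6, 10, 11)],
   [(7, 18, 1)],
   [],
   [(13, 20, 11), (21, 20, 11), (21, 25, 11)],
   [],
   [(13, 24, 1)]]"
  by code_simp

lemma K33_certificate_37: "K33_certificate 37
  [(1, 0, 31), (1, 6, 0), (36, 31, 0), (1, 31, 0), (36, 6, 0), (1, 0, 6)]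
  [[(1, 31, 31)],
   [(36, 0, 31), (36, 6, 31)],
   [],
   [],
   [],
   [(1, 6, 6)],
   [],
   [],
   [(36, 31, 6), (36, 0, 6)]]"
  by code_simp

lemma K33_certificate_41: "K33_certificate 41
  [(1, 32, 0), (40, 9, 0), (40, 0, 9), (40, 0, 32), (1, 9, 0), (40, 32, 0)]
  [[(1, 32, 32), (1, 0, 32)],
   [],
   [],
   [(40, 9, 32)],
   [],
   [],
   [],
   [(1, 0, 9), (1, 9, 9)],
   [(40, 32, 9)]]"
  by code_simp

lemma K33_certificate_43: "K33_certificate 43
  [(19, 42, 42), (42, 42, 19), (42, 19, 42), (42, 25, 42), (25, 42, 42), (42, 42, 25)]
  [[(19, 25, 42)],
   [],
   [(19, 42, 25)],
   [(42, 25, 19)],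
   [(25, 42, 19)],
   [],
   [],
   [(25, 19, 42)],
   [(42, 19, 25)]]"
  by code_simp

lemma K33_certificate_47: "K33_certificate 47
  [(30, 12, 9), (46, 22, 13), (46, 12, 22), (30, 12, 22), (46, 22, 12), (46, 12, 13)]
  [[],
   [(30, 23, 9), (30, 23, 23), (30, 9, 23), (30, 9, 12), (30, 22, 12)],
   [(31, 12, 9), (31, 12, 34), (1, 12, 34), (1, 12, 25), (17, 12, 25), (17, 12, 38), (16, 12, 38), (16, 12, 13)],
   [(5, 22, 13), (5, 43, 13), (37, 43, 13), (37, 15, 13), (17, 15, 13), (17, 15, 7), (41, 15, 7), (41, 37, 7), (30, 37, 7), (30, 37, 22)],
   [],
   [],
   [],
   [(46, 13, 22), (46, 13, 12)],
   []]"
  by code_simp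

lemma K33_certificate_53: "K33_certificate 53
  [(0, 52, 30), (0, 1, 23), (30, 52, 0), (0, 1, 30), (0, 52, 23), (23, 52, 0)]
  [[],
   [],
   [(23, 52, 30)],
   [],
   [],
   [(23, 1, 23), (23, 1, 0)],
   [(30, 1, 0), (30, 1, 30)],
   [(30, 52, 23)],
   []]"
  by code_simp

lemma K33_certificate_59: "K33_certificate 59
  [(25, 42, 34), (25, 34, 42), (17, 34, 34), (18, 34, 34), (25, 34, 41), (25, 41, 34)]
  [[(46, 42, 34), (46, 47, 34), (18, 47, 34)],
   [(25, 42, 13), (25, 47, 13), (25, 47, 41)],
   [],
   [(46, 34, 42), (46, 34, 47), (18, 34, 47)],
   [],
   [(25, 13, 42), (25, 13, 47), (25, 41, 47)],
   [],
   [(17, 34, 13), (12, 34, 13), (12, 34, 41)],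
   [(17, 13, 34), (12, 13, 34), (12, 41, 34)]]"
  by code_simp

lemma K33_certificate_61: "K33_certificate 61
  [(0, 26, 42), (43, 0, 15), (18, 0, 46), (18, 0, 15), (43, 0, 46), (0, 35, 42)]
  [[(0, 26, 19), (6, 26, 19), (6, 26, 15), (18, 26, 15)],
   [(55, 26, 42), (55, 26, 46), (43, 26, 46)],
   [],
   [],
   [],
   [(43, 35, 15), (55, 35, 15), (55, 35, 19), (0, 35, 19)],
   [],
   [],
   [(18, 35, 46), (6, 35, 46), (6, 35, 42)]]"
  by code_simp

lemmas K33_certificate_small = K33_certificate_5 K33_certificate_11 K33_certificate_13 K33_certificate_17
  K33_certificate_19 K33_certificate_23 K33_certificate_29 K33_certificate_31
  K33_certificate_37 K33_certificate_41 K33_certificate_43 K33_certificate_47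
  K33_certificate_53 K33_certificate_59 K33_certificate_61

lemma not_planar_small:
  assumes "p \<in> {5, 11, 13, 17, 19, 23, 29, 31, 37, 41, 43, 47, 53, 59, 61}" "prime p"
  shows "\<not> planar (markoff_graph p)"
proof -
  interpret markoff p
    using assms(2) by unfold_locales
  have "\<exists>bs ps. K33_certificate (int p) bs ps"
    using assms(1) unfolding insert_iff empty_iff
    by (elim disjE FalseE; simp only: of_nat_numeral) (blast intro: K33_certificate_small)+
  then show ?thesis
    using not_planar_certificate by blast
qed

text \<open>Running through all triples guarantees that no vertex is missing from
  \<open>pts\<close>. Requiring a jump other than \<open>v\<close> excludes isolated vertices, as
  \<open>straight_line_drawing\<close> demands. An edge may be listed in either direction.\<close>

definition drawing_certificate ::
  "int \<Rightarrow> (int triple \<times> point) list \<Rightarrow> (int triple \<times> int triple) list \<Rightarrow> bool" where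
  "drawing_certificate q pts es \<longleftrightarrow>
     (let vs = map fst pts; f = the \<circ> map_of pts in
     (\<forall>x\<in>set [0..q - 1]. \<forall>y\<in>set [0..q - 1]. \<forall>z\<in>set [0..q - 1].
        on_surface q (x, y, z) \<longrightarrow> (x, y, z) \<in> set vs) \<and>
     distinct vs \<and> distinct (map snd pts) \<and>
     (\<forall>v\<in>set vs. (\<exists>w\<in>set (jumps q v). w \<noteq> v) \<and>
        (\<forall>w\<in>set (jumps q v). w = v \<or> (v, w) \<in> set es \<or> (w, v) \<in> set es)) \<and>
     sorted_wrt no_crossing (map (map_prod f f) es))"

theorem (in markoff) planar_certificate:
  assumes "drawing_certificate P pts es"
  shows "planar (markoff_graph p)"
proof -
  define f where "f = the \<circ> map_of pts"
  have cover: "\<forall>x\<in>set [0..P - 1]. \<forall>y\<in>set [0..P - 1]. \<forall>z\<in>set [0..P - 1].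
      on_surface P (x, y, z) \<longrightarrow> (x, y, z) \<in> set (map fst pts)"
    and dist: "distinct (map fst pts)" "distinct (map snd pts)"
    and jumps: "\<forall>v\<in>set (map fst pts). (\<exists>w\<in>set (jumps P v). w \<noteq> v) \<and>
      (\<forall>w\<in>set (jumps P v). w = v \<or> (v, w) \<in> set es \<or> (w, v) \<in> set es)"
    and cross: "sorted_wrt no_crossing (map (map_prod f f) es)"
    using assms unfolding drawing_certificate_def Let_def f_def by blast+
  have V: "v \<in> set (map fst pts)" if "v \<in> V" for v
  proof -
    obtain x y z where v: "v = (x, y, z)"
      by (cases v)
    then have "on_surface P (x, y, z)" "x \<in> set [0..P - 1]" "y \<in> set [0..P - 1]" "z \<in> set [0..P - 1]"
      using that by (auto simp: V_iff power2_eq_square)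
    then show ?thesis
      using cover v by blast
  qed
  have point: "(v, f v) \<in> set pts" if "v \<in> V" for v
    using V[OF that] dist(1) by (auto simp: f_def)
  show ?thesis
  proof (rule straight_line_drawing)
    show "inj_on f (fst (markoff_graph p))"
      unfolding markoff_graph_wf
    proof (rule inj_onI)
      fix v w assume "v \<in> V" "w \<in> V" "f v = f w"
      then have "(v, f v) \<in> set pts" "(w, f v) \<in> set pts"
        using point by metis+
      then show "v = w"
        using dist(2) inj_onD[of snd "set pts" "(v, f v)" "(w, f v)"] by (simp add: distinct_map)
    qed
    show "E \<subseteq> (\<lambda>(u, v). {u, v}) ` set es"
    proof
      fix e assume e: "e \<in> E"
      then obtain v w where vw: "e = {v, w}"
        unfolding proper_edges_eq Edge_def by blast
      then have "v \<in> V" "w \<noteq> v" "w \<in> set (jumps P v)"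
        using e edge_iff_jump by blast+
      then have "(v, w) \<in> set es \<or> (w, v) \<in> set es"
        using jumps V by blast
      then show "e \<in> (\<lambda>(u, v). {u, v}) ` set es"
      proof
        assume "(v, w) \<in> set es"
        then show ?thesis
          using vw by (intro image_eqI[of _ _ "(v, w)"]) simp_all
      next
        assume "(w, v) \<in> set es"
        then show ?thesis
          using vw by (intro image_eqI[of _ _ "(w, v)"]) (simp_all add: insert_commute)
      qed
    qed
    show "\<Union>E \<subseteq> fst (markoff_graph p)"
      using markoff_graph_wf by simp
    show "fst (markoff_graph p) \<subseteq> \<Union>E"
    proof
      fix v assume v: "v \<in> fst (markoff_graph p)"
      then obtain w where "w \<in> set (jumps P v)" "w \<noteq> v"
        using jumps V markoff_graph_wf(1) by blast
      then have "{v, w} \<in> E"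
        using v edge_iff_jump markoff_graph_wf(1) by simp
      then show "v \<in> \<Union>E"
        by blast
    qed
    show "sorted_wrt no_crossing (map (map_prod f f) es)"
      using cross by simp
  qed
qed

text \<open>The graph is a star with centre \<open>(1, 1, 1)\<close> and three leaves.\<close>

lemma drawing_certificate_2: "drawing_certificate 2
  [((1, 1, 1), (0, 0)), ((0, 1, 1), (1, 0)), ((1, 0, 1), (0, 1)), ((1, 1, 0), (-1, -1))]
  [((1, 1, 1), (0, 1, 1)), ((1, 1, 1), (1, 0, 1)), ((1, 1, 1), (1, 1, 0))]"
  by code_simp

text \<open>Modulo 3 the equation has only the zero solution, so there is nothing to draw.\<close>

lemma drawing_certificate_3: "drawing_certificate 3 [] []"
  by code_simp

text \<open>A drawing of 28 vertices and 36 edges on integer points, so that all orientation tests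
  are exact.\<close>

lemma drawing_certificate_7: "drawing_certificate 7
  [((1, 1, 4), (0, 19)), ((1, 3, 4), (13, 15)), ((1, 3, 6), (9, 12)),
   ((1, 4, 1), (-7, -1)), ((1, 4, 3), (-3, -2)), ((1, 6, 3), (-3, -1)),
   ((3, 1, 4), (-14, 13)), ((3, 1, 6), (-8, 11)), ((3, 3, 3), (0, 3)),
   ((3, 3, 6), (1, 9)), ((3, 4, 1), (-9, 0)), ((3, 4, 4), (-20, -1)),
   ((3, 6, 1), (-5, 2)), ((3, 6, 3), (-2, 2)), ((4, 1, 1), (10, -1)),
   ((4, 1, 3), (2, -1)), ((4, 3, 1), (13, 0)), ((4, 3, 4), (20, -1)),
   ((4, 4, 3), (-2, -3)), ((4, 4, 6), (-3, -10)), ((4, 6, 4), (15, -14)),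
   ((4, 6, 6), (3, -12)), ((6, 1, 3), (3, 1)), ((6, 3, 1), (7, 2)),
   ((6, 3, 3), (2, 3)), ((6, 4, 4), (-15, -14)), ((6, 4, 6), (-8, -12)),
   ((6, 6, 4), (-1, -21))]
  [((1, 1, 4), (3, 1, 4)), ((1, 1, 4), (1, 3, 4)), ((1, 3, 4), (1, 3, 6)),
   ((1, 3, 4), (4, 3, 4)), ((1, 3, 6), (3, 3, 6)), ((1, 4, 1), (1, 4, 3)),
   ((1, 4, 1), (3, 4, 1)), ((1, 4, 3), (4, 4, 3)), ((1, 4, 3), (1, 6, 3)),
   ((1, 6, 3), (3, 6, 3)), ((3, 1, 4), (3, 4, 4)), ((3, 1, 4), (3, 1, 6)),
   ((3, 1, 6), (3, 3, 6)), ((3, 3, 3), (3, 3, 6)), ((3, 3, 3), (6, 3, 3)),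
   ((3, 3, 3), (3, 6, 3)), ((3, 4, 1), (3, 4, 4)), ((3, 4, 1), (3, 6, 1)),
   ((3, 4, 4), (6, 4, 4)), ((3, 6, 1), (3, 6, 3)), ((4, 1, 1), (4, 3, 1)),
   ((4, 1, 1), (4, 1, 3)), ((4, 1, 3), (4, 4, 3)), ((4, 1, 3), (6, 1, 3)),
   ((4, 3, 1), (6, 3, 1)), ((4, 3, 1), (4, 3, 4)), ((4, 3, 4), (4, 6, 4)),
   ((4, 4, 3), (4, 4, 6)), ((4, 4, 6), (4, 6, 6)), ((4, 4, 6), (6, 4, 6)),
   ((4, 6, 4), (4, 6, 6)), ((4, 6, 4), (6, 6, 4)), ((6, 1, 3), (6, 3, 3)),
   ((6, 3, 1), (6, 3, 3)), ((6, 4, 4), (6, 4, 6)), ((6, 4, 4), (6, 6, 4))]"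
  by code_simp

lemma small_or_large_prime:
  assumes "prime p" "p < 67"
  shows "p \<in> {2, 3, 7} \<or> p \<in> {5, 11, 13, 17, 19, 23, 29, 31, 37, 41, 43, 47, 53, 59, 61::nat}"
proof -
  have "\<forall>q\<in>set [0..<67]. prime q \<longrightarrow>
      q \<in> set [2, 3, 7] \<or> q \<in> set [5, 11, 13, 17, 19, 23, 29, 31, 37, 41, 43, 47, 53, 59, 61::nat]"
    by code_simp
  then show ?thesis
    using assms by (simp only: set_simps set_upt) auto
qed

theorem theorem1p1:
  fixes p :: nat
  assumes "prime p"
  shows "planar (markoff_graph p) \<longleftrightarrow> p \<in> {2, 3, 7}"
proof
  interpret markoff p
    using assms by unfold_locales
  show "p \<in> {2, 3, 7}" if "planar (markoff_graph p)"
    using that not_planar_large not_planar_small[OF _ assms] small_or_large_prime[OF assms]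
    by (meson not_le)
  show "planar (markoff_graph p)" if "p \<in> {2, 3, 7}"
  proof -
    have "\<exists>pts es. drawing_certificate P pts es"
      using that unfolding insert_iff empty_iff
      by (elim disjE FalseE; simp only: of_nat_numeral)
        (blast intro: drawing_certificate_2 drawing_certificate_3 drawing_certificate_7)+
    then show ?thesis
      using planar_certificate by blast
  qed
qed

end
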